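(* Let $d \ge 1$ and let $f$ be an arbitrary probability density on $\mathbb{R}^d$. Let $(r_n)$ be a sequence of positive reals with $\lim_{n\to\infty} n r_n^d = \infty$ and $\lim_{n\to\infty} r_n = 0$. For each $n$, let $X_1,\ldots,X_n$ be i.i.d. with density $f$ and let $G_n$ be the random geometric graph on vertex set $[n]$ in which $\{i,j\}$ ($i\neq j$) is an edge iff $\|X_i - X_j\| \le r_n$ (Euclidean norm). Then there exists an estimator $\Delta_n$ of $d$, computed from the adjacency matrix of $G_n$ alone (without knowledge of $d$, $f$, $r_n$ or the $X_i$; additional independent randomization such as a uniformly random relabeling of the vertices is allowed), such that $\Delta_n \to d$ in probability as $n \to \infty$. *)

theory Defs
  imports "HOL-Probability.Probability"
begin

text \<open>Points of R^d are represented as functions nat => real, only the coordinates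
  0..d-1 being relevant (the space of the product measure consists of the
  extensional functions on {..<d}).\<close>

definition eucl_dist :: "nat \<Rightarrow> (nat \<Rightarrow> real) \<Rightarrow> (nat \<Rightarrow> real) \<Rightarrow> real" where
  "eucl_dist d x y = sqrt (\<Sum>k<d. (x k - y k)^2)"

definition lebesgue_d :: "nat \<Rightarrow> (nat \<Rightarrow> real) measure" where
  "lebesgue_d d = PiM {..<d} (\<lambda>_. (lborel :: real measure))"

definition is_density :: "nat \<Rightarrow> ((nat \<Rightarrow> real) \<Rightarrow> real) \<Rightarrow> bool" where
  "is_density d f \<longleftrightarrow> f \<in> borel_measurable (lebesgue_d d) \<and> (\<forall>x. 0 \<le> f x)
     \<and> (\<integral>\<^sup>+ x. ennreal (f x) \<partial>lebesgue_d d) = 1"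

definition rgg_adj :: "nat \<Rightarrow> nat \<Rightarrow> real \<Rightarrow> (nat \<Rightarrow> nat \<Rightarrow> real) \<Rightarrow> nat \<Rightarrow> nat \<Rightarrow> bool" where
  "rgg_adj n d r X = (\<lambda>i j. i < n \<and> j < n \<and> i \<noteq> j \<and> eucl_dist d (X i) (X j) \<le> r)"

text \<open>Probability space: n i.i.d. points with density f, together with an independent
  uniform [0,1] variable serving as the estimator's auxiliary randomization.\<close>
definition sample_space :: "nat \<Rightarrow> nat \<Rightarrow> ((nat \<Rightarrow> real) \<Rightarrow> real)
    \<Rightarrow> ((nat \<Rightarrow> nat \<Rightarrow> real) \<times> real) measure" where
  "sample_space n d f =
     PiM {..<n} (\<lambda>_. density (lebesgue_d d) (\<lambda>x. ennreal (f x)))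
     \<Otimes>\<^sub>M uniform_measure lborel {0..1::real}"

end

theory Submission
  imports Defs
begin

text \<open>Given that vertex \<open>0\<close> sits at \<open>x\<close>, its neighbours are an i.i.d. sample of the density restricted
  to the ball \<open>B(x, r\<^sub>n)\<close>, which is asymptotically uniform because the average oscillation of \<open>f\<close> over
  such balls tends to \<open>0\<close> in \<open>L\<^sup>1\<close>. Cutting the neighbours of \<open>0\<close> into blocks of \<open>k + 1\<close> vertices and
  counting the blocks whose first vertex is adjacent to the \<open>k\<close> others therefore estimates
  \<open>s(d, k) = E(\<lambda>(U)\<^sup>k)\<close>, where \<open>U\<close> is uniform in the unit ball and \<open>\<lambda>(u)\<close> is the fraction of the unit
  ball covered by the unit ball around \<open>u\<close>. As \<open>1 - \<lambda>(u)\<close> is comparable to \<open>|u|\<close>, the number \<open>s(d, k)\<close>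
  is of order \<open>k\<^sup>-\<^sup>d\<close>, so for every \<open>d\<close> some moment \<open>k(d)\<close> and threshold \<open>\<tau>(d)\<close> separate the
  dimensions up to \<open>d\<close> from the larger ones, and the estimator is the least \<open>d\<close> whose empirical
  \<open>k(d)\<close>-th moment exceeds \<open>\<tau>(d)\<close>.\<close>

section \<open>Balls and affine maps\<close>

text \<open>The density may be unbounded and nowhere continuous, so comparison with a uniform
  distribution cannot be expected at every centre. It is only required outside a set of centres to
  which the law of vertex \<open>0\<close> gives small mass; there \<open>f\<close> also stays above
  a fixed \<delta> > 0, so the expected degree is at least a constant times
  \<open>n * r n ^ d\<close> and the oscillation is small relative to \<open>f x\<close>. The blocks
  are disjoint, so their centred indicators are uncorrelated once the neighbour set is fixed, and
  second moments suffice throughout. The limit of the frequencies involves neither \<open>f\<close>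
  nor the radius, because rescaling turns every ball into the unit ball. The bounds on \<lambda> are
  too crude to compare two dimensions at an arbitrary \<open>k\<close>; a large \<open>k\<close>,
  chosen separately for each threshold dimension, lets the powers of \<open>k\<close> beat the
  constants. Since the estimator takes the least index that passes, only the finitely many tests
  with index at most the true dimension have to be correct.\<close>

definition dball :: "nat \<Rightarrow> (nat \<Rightarrow> real) \<Rightarrow> real \<Rightarrow> (nat \<Rightarrow> real) set" where
  "dball d x r = {y \<in> space (lebesgue_d d). eucl_dist d x y \<le> r}"

text \<open>The restriction makes the value extensional, hence a point of
  \<open>lebesgue_d d\<close>, for arbitrary \<open>x\<close> and \<open>u\<close>. For
  \<open>c = 1\<close> this is a translation, in which \<open>x\<close> and \<open>u\<close> play
  symmetric roles.\<close>

definition affd :: "nat \<Rightarrow> (nat \<Rightarrow> real) \<Rightarrow> real \<Rightarrow> (nat \<Rightarrow> real) \<Rightarrow> nat \<Rightarrow> real" where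
  "affd d x c u = (\<lambda>k\<in>{..<d}. x k + c * u k)"

definition unit_vol :: "nat \<Rightarrow> real" where
  "unit_vol d = measure (lebesgue_d d) (dball d (\<lambda>_. 0) 1)"

lemma eucl_dist_L2: "eucl_dist d x y = L2_set (\<lambda>k. x k - y k) {..<d}"
  by (simp add: eucl_dist_def L2_set_def)

lemma eucl_dist_nonneg [simp]: "0 \<le> eucl_dist d x y"
  by (simp add: eucl_dist_L2)

lemma eucl_dist_commute: "eucl_dist d x y = eucl_dist d y x"
  by (simp add: eucl_dist_def power2_commute)

lemma eucl_dist_triangle: "eucl_dist d x z \<le> eucl_dist d x y + eucl_dist d y z"
  using L2_set_triangle_ineq[of "\<lambda>k. x k - y k" "\<lambda>k. y k - z k" "{..<d}"]
  by (simp add: eucl_dist_L2)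

lemma eucl_dist_cong:
  "(\<And>k. k < d \<Longrightarrow> x k - y k = x' k - y' k) \<Longrightarrow> eucl_dist d x y = eucl_dist d x' y'"
  unfolding eucl_dist_L2 by (intro L2_set_cong) auto

lemma eucl_dist_scale:
  assumes "0 \<le> c" "\<And>k. k < d \<Longrightarrow> x' k - y' k = c * (x k - y k)"
  shows "eucl_dist d x' y' = c * eucl_dist d x y"
  unfolding eucl_dist_L2 L2_set_right_distrib[OF assms(1)]
  by (intro L2_set_cong) (auto simp: assms)

lemma abs_component_le_eucl_dist: "k < d \<Longrightarrow> \<bar>x k - y k\<bar> \<le> eucl_dist d x y"
  unfolding eucl_dist_def by (rule real_le_rsqrt) (auto intro!: member_le_sum)

section \<open>The underlying measurable space and measurability of distances and affine
  maps\<close>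

lemma space_lebesgue_d: "space (lebesgue_d d) = extensional {..<d}"
  by (simp add: lebesgue_d_def space_PiM PiE_def)

lemma sets_lebesgue_d [measurable_cong]: "sets (lebesgue_d d) = sets (PiM {..<d} (\<lambda>_. borel))"
  unfolding lebesgue_d_def by (rule sets_PiM_cong) simp_all

lemma affd_in_space [simp]: "affd d x c u \<in> space (lebesgue_d d)"
  by (simp add: affd_def space_lebesgue_d)

lemma product_sigma_finite_lborel: "product_sigma_finite (\<lambda>_. lborel :: real measure)"
  by (simp add: product_sigma_finite_def lborel.sigma_finite_measure_axioms)

lemma sigma_finite_lebesgue_d: "sigma_finite_measure (lebesgue_d d)"
proof -
  interpret product_sigma_finite "\<lambda>_::nat. lborel :: real measure"
    by (rule product_sigma_finite_lborel)
  show ?thesis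
    unfolding lebesgue_d_def by (rule sigma_finite) simp
qed

lemma measurable_coord_lebesgue_d:
  "g \<in> measurable N (lebesgue_d d) \<Longrightarrow> k < d \<Longrightarrow> (\<lambda>x. g x k) \<in> borel_measurable N"
  by (rule measurable_component_singleton'[where M="\<lambda>_. borel" and I="{..<d}" and N=N and g="\<lambda>x. x"])
     (auto simp: measurable_cong_sets[OF refl sets_lebesgue_d])

lemma measurable_eucl_dist [measurable (raw)]:
  assumes [measurable]: "g \<in> measurable N (lebesgue_d d)" "h \<in> measurable N (lebesgue_d d)"
  shows "(\<lambda>x. eucl_dist d (g x) (h x)) \<in> borel_measurable N"
  unfolding eucl_dist_def
  by (intro borel_measurable_sqrt[THEN measurable_compose[rotated]] borel_measurable_sum
      borel_measurable_power borel_measurable_diff measurable_coord_lebesgue_d assms) auto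

lemma measurable_affd [measurable (raw)]:
  assumes [measurable]: "g \<in> measurable N (lebesgue_d d)" "h \<in> measurable N (lebesgue_d d)"
    "c \<in> borel_measurable N"
  shows "(\<lambda>x. affd d (g x) (c x) (h x)) \<in> measurable N (lebesgue_d d)"
  unfolding affd_def measurable_cong_sets[OF refl sets_lebesgue_d]
  by (intro measurable_restrict borel_measurable_add borel_measurable_times
      measurable_coord_lebesgue_d assms) auto

text \<open>Centres such as \<open>\<lambda>_. 0\<close> are not extensional, hence for
  \<open>d\<close>-dimensional purposes not points of the space. Restricting them changes no
  distance and no affine map, which brings the measurability lemmas to bear on arbitrary
  centres.\<close>

lemma eucl_dist_restrict1 [simp]: "eucl_dist d (restrict x {..<d}) y = eucl_dist d x y"
  by (intro eucl_dist_cong) auto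

lemma affd_restrict [simp]: "affd d (restrict x {..<d}) c u = affd d x c u"
  by (auto simp: affd_def)

lemma measurable_eucl_dist_const [measurable (raw)]:
  assumes [measurable]: "h \<in> measurable N (lebesgue_d d)"
  shows "(\<lambda>y. eucl_dist d x (h y)) \<in> borel_measurable N"
proof -
  have "(\<lambda>y. eucl_dist d (restrict x {..<d}) (h y)) \<in> borel_measurable N"
    by (rule measurable_eucl_dist) (auto simp: space_lebesgue_d)
  then show ?thesis by simp
qed

lemma measurable_affd_const [measurable (raw)]:
  assumes [measurable]: "h \<in> measurable N (lebesgue_d d)"
  shows "(\<lambda>y. affd d x c (h y)) \<in> measurable N (lebesgue_d d)"
proof -
  have "(\<lambda>y. affd d (restrict x {..<d}) c (h y)) \<in> measurable N (lebesgue_d d)"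
    by (rule measurable_affd) (auto simp: space_lebesgue_d)
  then show ?thesis by simp
qed

lemma sets_dball [measurable]: "dball d x r \<in> sets (lebesgue_d d)"
  unfolding dball_def by measurable

text \<open>Uniqueness of the product measure reduces the claim to boxes. There each coordinate
  contributes one factor \<open>c\<close> from the affine substitution on the line, and the factors
  combine to \<open>c ^ d\<close>.\<close>

lemma lebesgue_d_affine:
  assumes c: "0 < c"
  shows "lebesgue_d d = density (distr (lebesgue_d d) (lebesgue_d d) (affd d x c)) (\<lambda>_. ennreal (c ^ d))"
proof -
  interpret product_sigma_finite "\<lambda>_::nat. lborel :: real measure"
    by (rule product_sigma_finite_lborel)
  let ?P = "density (distr (lebesgue_d d) (lebesgue_d d) (affd d x c)) (\<lambda>_. ennreal (c ^ d))"
  have meas: "affd d x c \<in> measurable (lebesgue_d d) (lebesgue_d d)"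
    by measurable
  have "?P = PiM {..<d} (\<lambda>_. lborel)"
  proof (rule PiM_eqI)
    show "sets ?P = sets (PiM {..<d} (\<lambda>_. lborel))"
      by (simp add: lebesgue_d_def)
    fix A :: "nat \<Rightarrow> real set"
    assume A: "\<And>i. i \<in> {..<d} \<Longrightarrow> A i \<in> sets lborel"
    have 1: "emeasure lborel (A i) = ennreal c * emeasure lborel ((\<lambda>u. x i + c * u) -` A i)"
      if "i < d" for i
    proof -
      have [measurable]: "A i \<in> sets borel" using A that by auto
      show ?thesis
        using c by (subst lborel_real_affine[of c "x i"])
          (auto simp: emeasure_density nn_integral_cmult emeasure_distr)
    qed
    have box: "Pi\<^sub>E {..<d} A \<in> sets (lebesgue_d d)"
      unfolding lebesgue_d_def using A by (intro sets_PiM_I_finite) auto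
    have pre: "affd d x c -` Pi\<^sub>E {..<d} A \<inter> space (lebesgue_d d)
        = Pi\<^sub>E {..<d} (\<lambda>i. (\<lambda>u. x i + c * u) -` A i)"
      by (auto simp: affd_def space_lebesgue_d PiE_def Pi_def extensional_def)
    have "emeasure ?P (Pi\<^sub>E {..<d} A)
        = ennreal (c ^ d) * emeasure (lebesgue_d d) (Pi\<^sub>E {..<d} (\<lambda>i. (\<lambda>u. x i + c * u) -` A i))"
      using box by (simp add: emeasure_density nn_integral_cmult emeasure_distr meas pre)
    also have "\<dots> = ennreal c ^ d * (\<Prod>i<d. emeasure lborel ((\<lambda>u. x i + c * u) -` A i))"
    proof -
      have "(\<lambda>u. x i + c * u) -` A i \<in> sets lborel" if "i < d" for i
      proof -
        have [measurable]: "A i \<in> sets borel" using A that by auto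
        have "(\<lambda>u. x i + c * u) -` A i \<inter> space borel \<in> sets borel"
          by (rule measurable_sets[where A=borel]) auto
        then show ?thesis by simp
      qed
      then show ?thesis
        unfolding lebesgue_d_def using c by (subst emeasure_PiM) (auto simp: ennreal_power)
    qed
    also have "\<dots> = (\<Prod>i<d. ennreal c * emeasure lborel ((\<lambda>u. x i + c * u) -` A i))"
      by (simp add: prod.distrib)
    also have "\<dots> = (\<Prod>i<d. emeasure lborel (A i))"
      by (intro prod.cong) (auto simp: 1)
    finally show "emeasure ?P (Pi\<^sub>E {..<d} A) = (\<Prod>i<d. emeasure lborel (A i))" .
  qed simp
  then show ?thesis by (simp add: lebesgue_d_def)
qed

lemma nn_integral_affd:
  assumes "0 < c" and [measurable]: "F \<in> borel_measurable (lebesgue_d d)"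
  shows "(\<integral>\<^sup>+ y. F y \<partial>lebesgue_d d) = ennreal (c ^ d) * (\<integral>\<^sup>+ u. F (affd d x c u) \<partial>lebesgue_d d)"
proof -
  have "(\<integral>\<^sup>+ y. F y \<partial>lebesgue_d d) = (\<integral>\<^sup>+ y. F y \<partial>density (distr (lebesgue_d d) (lebesgue_d d) (affd d x c)) (\<lambda>_. ennreal (c ^ d)))"
    using lebesgue_d_affine[OF assms(1), of d x] by metis
  also have "\<dots> = ennreal (c ^ d) * (\<integral>\<^sup>+ u. F (affd d x c u) \<partial>lebesgue_d d)"
    by (simp add: nn_integral_density nn_integral_cmult nn_integral_distr)
  finally show ?thesis .
qed

lemma emeasure_affd:
  assumes "0 < c" and [measurable]: "A \<in> sets (lebesgue_d d)"
  shows "emeasure (lebesgue_d d) A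
    = ennreal (c ^ d) * emeasure (lebesgue_d d) {u \<in> space (lebesgue_d d). affd d x c u \<in> A}"
proof -
  have "emeasure (lebesgue_d d) A = (\<integral>\<^sup>+ y. indicator A y \<partial>lebesgue_d d)"
    by simp
  also have "\<dots> = ennreal (c ^ d) * (\<integral>\<^sup>+ u. indicator A (affd d x c u) \<partial>lebesgue_d d)"
    by (rule nn_integral_affd) (use assms in auto)
  also have "(\<integral>\<^sup>+ u. indicator A (affd d x c u) \<partial>lebesgue_d d)
      = (\<integral>\<^sup>+ u. indicator {u \<in> space (lebesgue_d d). affd d x c u \<in> A} u \<partial>lebesgue_d d)"
    by (intro nn_integral_cong) (auto split: split_indicator)
  finally show ?thesis by simp
qed

lemma measure_affd:
  assumes "0 < c" "A \<in> sets (lebesgue_d d)"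
  shows "measure (lebesgue_d d) A
    = c ^ d * measure (lebesgue_d d) {u \<in> space (lebesgue_d d). affd d x c u \<in> A}"
  using emeasure_affd[OF assms, of x] assms(1) by (simp add: measure_def enn2real_mult)

lemma integral_affd:
  fixes F :: "(nat \<Rightarrow> real) \<Rightarrow> real"
  assumes "0 < c" and [measurable]: "F \<in> borel_measurable (lebesgue_d d)"
  shows "(\<integral> y. F y \<partial>lebesgue_d d) = c ^ d * (\<integral> u. F (affd d x c u) \<partial>lebesgue_d d)"
proof -
  have "(\<integral> y. F y \<partial>lebesgue_d d) = (\<integral> y. F y \<partial>density (distr (lebesgue_d d) (lebesgue_d d) (affd d x c)) (\<lambda>_. ennreal (c ^ d)))"
    using lebesgue_d_affine[OF assms(1), of d x] by metis
  also have "\<dots> = c ^ d * (\<integral> u. F (affd d x c u) \<partial>lebesgue_d d)"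
    using assms(1) by (simp add: integral_density integral_distr)
  finally show ?thesis .
qed

lemma eucl_dist_affd:
  "0 \<le> c \<Longrightarrow> eucl_dist d (affd d x c u) (affd d x c v) = c * eucl_dist d u v"
  by (rule eucl_dist_scale) (auto simp: affd_def algebra_simps)

lemma eucl_dist_affd_center:
  "0 \<le> c \<Longrightarrow> eucl_dist d x (affd d x c v) = c * eucl_dist d (\<lambda>_. 0) v"
  by (rule eucl_dist_scale) (auto simp: affd_def)

lemma affd_in_dball_iff:
  assumes "0 < r" "u \<in> space (lebesgue_d d)"
  shows "affd d x r u \<in> dball d x r \<longleftrightarrow> u \<in> dball d (\<lambda>_. 0) 1"
  using assms by (simp add: dball_def eucl_dist_affd_center)

lemma affd_in_dball_affd_iff:
  assumes "0 < r" "u \<in> space (lebesgue_d d)"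
  shows "affd d x r u \<in> dball d (affd d x r v) r \<longleftrightarrow> u \<in> dball d v 1"
  using assms by (simp add: dball_def eucl_dist_affd)

section \<open>Volumes of balls\<close>

lemma dball_subset_box:
  assumes "r \<le> R" "\<And>k. k < d \<Longrightarrow> x k = 0"
  shows "dball d x r \<subseteq> Pi\<^sub>E {..<d} (\<lambda>_. {-R..R})"
proof
  fix y assume y: "y \<in> dball d x r"
  have "\<bar>y k\<bar> \<le> R" if "k < d" for k
    using abs_component_le_eucl_dist[OF that, of x y] y assms that by (auto simp: dball_def)
  then show "y \<in> Pi\<^sub>E {..<d} (\<lambda>_. {-R..R})"
    using y by (auto simp: dball_def space_lebesgue_d PiE_def abs_le_iff minus_le_iff)
qed

lemma emeasure_box:
  "emeasure (lebesgue_d d) (Pi\<^sub>E {..<d} (\<lambda>k. {a k..b k})) = (\<Prod>k<d. emeasure lborel {a k..b k})"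
proof -
  interpret product_sigma_finite "\<lambda>_::nat. lborel :: real measure"
    by (rule product_sigma_finite_lborel)
  show ?thesis unfolding lebesgue_d_def by (rule emeasure_PiM) auto
qed

lemma emeasure_unit_ball_finite: "emeasure (lebesgue_d d) (dball d (\<lambda>_. 0) 1) < \<infinity>"
proof -
  have "emeasure (lebesgue_d d) (dball d (\<lambda>_. 0) 1) \<le> emeasure (lebesgue_d d) (Pi\<^sub>E {..<d} (\<lambda>k. {-1..1}))"
    by (rule emeasure_mono[OF dball_subset_box]) (auto simp: sets_lebesgue_d intro!: sets_PiM_I_finite)
  also have "\<dots> < \<infinity>"
    unfolding emeasure_box by (simp add: ennreal_power flip: ennreal_numeral)
  finally show ?thesis .
qed

lemma unit_vol_pos: "0 < unit_vol d"
proof -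
  \<comment> \<open>Half the side of a cube inside the unit ball: the Euclidean norm is at most the
    sum of the absolute coordinates, here at most \<open>d / (d + 1)\<close>. The shift by one also
    covers \<open>d = 0\<close>.\<close>
  define a :: real where "a = 1 / (real d + 1)"
  have a: "0 < a" "d * a \<le> 1" by (auto simp: a_def field_simps)
  have "Pi\<^sub>E {..<d} (\<lambda>k. {-a..a}) \<subseteq> dball d (\<lambda>_. 0) 1"
  proof
    fix y assume y: "y \<in> Pi\<^sub>E {..<d} (\<lambda>k. {-a..a})"
    have "eucl_dist d (\<lambda>_. 0) y \<le> (\<Sum>k<d. \<bar>0 - y k\<bar>)"
      unfolding eucl_dist_L2 by (rule L2_set_le_sum_abs)
    also have "\<dots> \<le> (\<Sum>k<d. a)"
      using y by (intro sum_mono) (auto simp: PiE_def Pi_def abs_le_iff minus_le_iff)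
    also have "\<dots> \<le> 1" using a by simp
    finally show "y \<in> dball d (\<lambda>_. 0) 1"
      using y by (auto simp: dball_def space_lebesgue_d PiE_def)
  qed
  then have "emeasure (lebesgue_d d) (Pi\<^sub>E {..<d} (\<lambda>k. {-a..a})) \<le> emeasure (lebesgue_d d) (dball d (\<lambda>_. 0) 1)"
    by (rule emeasure_mono) simp
  moreover have "emeasure (lebesgue_d d) (Pi\<^sub>E {..<d} (\<lambda>k. {-a..a})) > 0"
    unfolding emeasure_box using a by (simp add: ennreal_power)
  ultimately have "emeasure (lebesgue_d d) (dball d (\<lambda>_. 0) 1) > 0" by (rule less_le_trans[rotated])
  then show ?thesis
    using emeasure_unit_ball_finite[of d] by (auto simp: unit_vol_def measure_def enn2real_positive_iff)
qed

lemma emeasure_dball: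
  assumes "0 < r"
  shows "emeasure (lebesgue_d d) (dball d x r) = ennreal (r ^ d * unit_vol d)"
proof -
  have "{u \<in> space (lebesgue_d d). affd d x r u \<in> dball d x r} = dball d (\<lambda>_. 0) 1"
    using affd_in_dball_iff[OF assms] by (auto simp: dball_def)
  then show ?thesis
    using emeasure_affd[OF assms, of "dball d x r" d x] emeasure_unit_ball_finite[of d] assms
    by (simp add: unit_vol_def ennreal_mult' emeasure_eq_ennreal_measure less_top[symmetric])
qed

lemma measure_dball: "0 < r \<Longrightarrow> measure (lebesgue_d d) (dball d x r) = r ^ d * unit_vol d"
  using unit_vol_pos[of d] by (simp add: measure_def emeasure_dball)

lemma fmeasurable_dball: "0 < r \<Longrightarrow> dball d x r \<in> fmeasurable (lebesgue_d d)"
  by (simp add: fmeasurable_def emeasure_dball)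

section \<open>Lens moments\<close>

definition lens :: "nat \<Rightarrow> (nat \<Rightarrow> real) \<Rightarrow> real" where
  "lens d u = measure (lebesgue_d d) (dball d (\<lambda>_. 0) 1 \<inter> dball d u 1) / unit_vol d"

text \<open>The probability that, of \<open>k + 1\<close> independent uniform points of the unit
  ball, the first is within distance 1 of the \<open>k\<close> others.\<close>

definition lens_moment :: "nat \<Rightarrow> nat \<Rightarrow> real" where
  "lens_moment d k =
     (\<integral> u. indicator (dball d (\<lambda>_. 0) 1) u * lens d u ^ k \<partial>lebesgue_d d) / unit_vol d"

text \<open>The sets are the sections of one measurable subset of the product space. The measure
  \<open>M\<close> is kept general because the result serves both the volume and the law of a sample
  point.\<close>

lemma measurable_measure_Int_dball:
  assumes M: "sigma_finite_measure M" "sets M = sets (lebesgue_d d)" and A: "A \<in> sets (lebesgue_d d)"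
  shows "(\<lambda>x. measure M (A \<inter> dball d x r)) \<in> borel_measurable (lebesgue_d d)"
proof -
  interpret sigma_finite_measure M by fact
  let ?Q = "{p \<in> space (lebesgue_d d \<Otimes>\<^sub>M M). snd p \<in> A \<and> eucl_dist d (fst p) (snd p) \<le> r}"
  have [measurable]: "snd \<in> measurable (lebesgue_d d \<Otimes>\<^sub>M M) (lebesgue_d d)"
    using M(2) by (simp add: measurable_cong_sets[OF refl M(2)[symmetric]])
  have sp: "space M = space (lebesgue_d d)"
    by (rule sets_eq_imp_space_eq[OF M(2)])
  have [measurable]: "A \<in> sets (lebesgue_d d)" by fact
  have Q: "?Q \<in> sets (lebesgue_d d \<Otimes>\<^sub>M M)"
    by measurable
  have "(\<lambda>x. enn2real (emeasure M (Pair x -` ?Q))) \<in> borel_measurable (lebesgue_d d)"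
    using measurable_emeasure_Pair[OF Q] by measurable
  moreover have "enn2real (emeasure M (Pair x -` ?Q)) = measure M (A \<inter> dball d x r)"
    if "x \<in> space (lebesgue_d d)" for x
    using that sets.sets_into_space[OF A]
    by (auto simp: measure_def dball_def space_pair_measure sp intro!: arg_cong[where f="\<lambda>A. enn2real (emeasure M A)"])
  ultimately show ?thesis
    by (simp cong: measurable_cong)
qed

lemma measurable_lens [measurable]: "lens d \<in> borel_measurable (lebesgue_d d)"
  unfolding lens_def[abs_def]
  using measurable_measure_Int_dball[OF sigma_finite_lebesgue_d refl sets_dball, of d "\<lambda>_. 0" 1 1]
  by measurable

lemma lens_nonneg: "0 \<le> lens d u"
  using unit_vol_pos[of d] by (simp add: lens_def)

lemma lens_le_1: "lens d u \<le> 1"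
proof -
  have "measure (lebesgue_d d) (dball d (\<lambda>_. 0) 1 \<inter> dball d u 1) \<le> measure (lebesgue_d d) (dball d (\<lambda>_. 0) 1)"
    by (rule measure_mono_fmeasurable) (auto intro!: fmeasurable_dball)
  then show ?thesis
    using unit_vol_pos[of d] by (simp add: lens_def unit_vol_def)
qed

text \<open>Subadditivity of the volume of \<open>B \ (B + u)\<close> replaces an explicit (rotation-based) computation
  of the lens volume.\<close>

lemma measure_ball_diff_multiple_le:
  "measure (lebesgue_d d) (dball d (\<lambda>_. 0) 1 - dball d (affd d (\<lambda>_. 0) (real j) u) 1)
    \<le> real j * measure (lebesgue_d d) (dball d (\<lambda>_. 0) 1 - dball d u 1)"
proof (induction j)
  case 0
  have "dball d (affd d (\<lambda>_. 0) 0 u) 1 = dball d (\<lambda>_. 0) 1"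
    unfolding dball_def by (auto simp: affd_def)
  then show ?case by simp
next
  case (Suc j)
  let ?B = "\<lambda>j. dball d (affd d (\<lambda>_. 0) (real j) u) 1" and ?L = "lebesgue_d d"
  let ?O = "dball d (\<lambda>_. 0) 1"
  have fm: "A - B \<in> fmeasurable ?L" if "A \<in> fmeasurable ?L" "B \<in> sets ?L" for A B
    using that by (rule fmeasurable_Diff)
  \<comment> \<open>Translation by \<open>u\<close> carries the difference for \<open>j\<close> to
    the one between the balls at \<open>u\<close> and at \<open>(j + 1) u\<close>, so passing from
    \<open>j\<close> to \<open>Suc j\<close> costs just one more copy of the basic
    difference.\<close>
  have "measure ?L (dball d u 1 - ?B (Suc j))
     = 1 ^ d * measure ?L {v \<in> space ?L. affd d u 1 v \<in> dball d u 1 - ?B (Suc j)}"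
    by (rule measure_affd) auto
  also have "{v \<in> space ?L. affd d u 1 v \<in> dball d u 1 - ?B (Suc j)} = ?O - ?B j"
  proof -
    have 1: "eucl_dist d u (affd d u 1 v) = eucl_dist d (\<lambda>_. 0) v" for v
      by (simp add: eucl_dist_affd_center)
    have 2: "eucl_dist d (affd d (\<lambda>_. 0) (real (Suc j)) u) (affd d u 1 v)
        = eucl_dist d (affd d (\<lambda>_. 0) (real j) u) v" for v
      by (rule eucl_dist_cong) (auto simp: affd_def algebra_simps)
    show ?thesis by (auto simp: dball_def 1 2 simp del: of_nat_Suc)
  qed
  finally have tr: "measure ?L (dball d u 1 - ?B (Suc j)) = measure ?L (?O - ?B j)" by simp
  have "measure ?L (?O - ?B (Suc j)) \<le> measure ?L ((?O - dball d u 1) \<union> (dball d u 1 - ?B (Suc j)))"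
    by (rule measure_mono_fmeasurable) (auto intro!: fmeasurable.Un fm fmeasurable_dball)
  also have "\<dots> \<le> measure ?L (?O - dball d u 1) + measure ?L (dball d u 1 - ?B (Suc j))"
    by (rule measure_Un_le) auto
  also have "\<dots> \<le> measure ?L (?O - dball d u 1) + real j * measure ?L (?O - dball d u 1)"
    using Suc.IH unfolding tr by (rule add_left_mono)
  finally show ?case by (simp add: algebra_simps)
qed

text \<open>For a multiple \<open>j\<close> just above \<open>2 / t\<close> the centre
  \<open>j u\<close> is farther than 2 from the origin, so its unit ball misses the original one and
  the whole volume is lost in \<open>j\<close> shifts. By subadditivity a single shift loses at
  least the fraction \<open>1 / j\<close>, and \<open>j \<le> 2 / t + 1 \<le> 3 / t\<close>.\<close>

lemma lens_upper_bound:
  assumes t: "0 < t" "t \<le> 1" and u: "eucl_dist d (\<lambda>_. 0) u > t"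
  shows "lens d u \<le> 1 - t / 3"
proof -
  let ?O = "dball d (\<lambda>_. 0) 1" and ?L = "lebesgue_d d"
  obtain j :: nat where j: "2 / t < real j" "real j \<le> 2 / t + 1"
  proof
    show "2 / t < real (nat \<lfloor>2 / t\<rfloor> + 1)" using t by linarith
    have "0 \<le> 2 / t" using t by simp
    then have "real (nat \<lfloor>2 / t\<rfloor>) \<le> 2 / t" by (simp add: of_nat_nat)
    then show "real (nat \<lfloor>2 / t\<rfloor> + 1) \<le> 2 / t + 1" by simp
  qed
  have "?O \<inter> dball d (affd d (\<lambda>_. 0) (real j) u) 1 = {}"
  proof -
    have "False" if v: "v \<in> ?O" "v \<in> dball d (affd d (\<lambda>_. 0) (real j) u) 1" for v
    proof -
      have "2 < real j * t" using j t by (simp add: field_simps)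
      also have "\<dots> \<le> real j * eucl_dist d (\<lambda>_. 0) u"
        using u by (intro mult_left_mono) auto
      also have "\<dots> = eucl_dist d (\<lambda>_. 0) (affd d (\<lambda>_. 0) (real j) u)"
        by (simp add: eucl_dist_affd_center)
      also have "\<dots> \<le> eucl_dist d (\<lambda>_. 0) v + eucl_dist d v (affd d (\<lambda>_. 0) (real j) u)"
        by (rule eucl_dist_triangle)
      also have "\<dots> \<le> 1 + 1"
        using v by (intro add_mono) (auto simp: dball_def eucl_dist_commute)
      finally show False by simp
    qed
    then show ?thesis by auto
  qed
  then have "?O - dball d (affd d (\<lambda>_. 0) (real j) u) 1 = ?O" by auto
  then have "unit_vol d \<le> real j * measure ?L (?O - dball d u 1)"
    using measure_ball_diff_multiple_le[of d j u] by (simp add: unit_vol_def)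
  also have "\<dots> \<le> (3 / t) * measure ?L (?O - dball d u 1)"
  proof (rule mult_right_mono)
    have "1 \<le> 1 / t" using t by simp
    then show "real j \<le> 3 / t" using j(2) by (simp add: field_simps)
  qed simp
  finally have *: "t / 3 * unit_vol d \<le> measure ?L (?O - dball d u 1)"
    using t by (simp add: field_simps)
  have "measure ?L (?O - dball d u 1) = measure ?L (?O - (?O \<inter> dball d u 1))"
    by (rule arg_cong[where f="measure ?L"]) auto
  also have "\<dots> = unit_vol d - measure ?L (?O \<inter> dball d u 1)"
    unfolding unit_vol_def
    by (rule measurable_measure_Diff) (auto intro!: fmeasurable_dball)
  finally have "measure ?L (?O \<inter> dball d u 1) \<le> (1 - t / 3) * unit_vol d"
    using * by (simp add: algebra_simps)
  then show ?thesis
    using unit_vol_pos[of d] by (simp add: lens_def divide_le_eq)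
qed

section \<open>Two-sided bounds for the lens moments\<close>

lemma integrable_indicator_dball:
  "0 < r \<Longrightarrow> integrable (lebesgue_d d) (\<lambda>u. indicator (dball d x r) u :: real)"
  using emeasure_dball[of r d x] by simp

lemma integrable_lens_power:
  "integrable (lebesgue_d d) (\<lambda>u. indicator (dball d (\<lambda>_. 0) 1) u * lens d u ^ k)"
proof (rule Bochner_Integration.integrable_bound[OF integrable_indicator_dball[of 1 d "\<lambda>_. 0"]])
  show "AE u in lebesgue_d d. norm (indicator (dball d (\<lambda>_. 0) 1) u * lens d u ^ k)
      \<le> norm (indicator (dball d (\<lambda>_. 0) 1) u :: real)"
    by (intro AE_I2) (auto simp: lens_nonneg power_le_one lens_le_1 split: split_indicator)
qed simp_all

lemma integral_indicator_dball:
  "0 < r \<Longrightarrow> (\<integral> u. indicator (dball d x r) u \<partial>lebesgue_d d) = r ^ d * unit_vol d"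
proof -
  have "space (lebesgue_d d) \<inter> dball d x r = dball d x r" by (auto simp: dball_def)
  then show "0 < r \<Longrightarrow> ?thesis"
    using measure_dball[of r d x] by (simp add: Int_commute)
qed

text \<open>The unit ball is split at radius \<open>t\<close>: the inner ball has relative volume
  \<open>t ^ d\<close> and the integrand is at most 1 there, while outside it the lens is at most
  \<open>1 - t / 3\<close>.\<close>

lemma lens_moment_upper_bound:
  assumes t: "0 < t" "t \<le> 1"
  shows "lens_moment d k \<le> t ^ d + (1 - t / 3) ^ k"
proof -
  let ?O = "dball d (\<lambda>_. 0)" and ?L = "lebesgue_d d"
  have "(\<integral> u. indicator (?O 1) u * lens d u ^ k \<partial>?L)
     \<le> (\<integral> u. indicator (?O t) u + (1 - t / 3) ^ k * indicator (?O 1) u \<partial>?L)"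
  proof (rule integral_mono)
    show "integrable ?L (\<lambda>u. indicator (?O 1) u * lens d u ^ k)"
      by (rule integrable_lens_power)
    show "integrable ?L (\<lambda>u. indicator (?O t) u + (1 - t / 3) ^ k * indicator (?O 1) u :: real)"
      using t by (intro Bochner_Integration.integrable_add integrable_mult_right integrable_indicator_dball) auto
    fix u assume "u \<in> space ?L"
    show "indicator (?O 1) u * lens d u ^ k \<le> indicator (?O t) u + (1 - t / 3) ^ k * indicator (?O 1) u"
    proof (cases "u \<in> ?O 1 \<and> u \<notin> ?O t")
      case True
      then have "lens d u ^ k \<le> (1 - t / 3) ^ k"
        using t by (intro power_mono lens_upper_bound lens_nonneg) (auto simp: dball_def)
      then show ?thesis using True by simp
    next
      case False
      have "lens d u ^ k \<le> 1" by (simp add: lens_nonneg power_le_one lens_le_1)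
      moreover have "0 \<le> (1 - t / 3) ^ k" using t by simp
      ultimately show ?thesis using False by (auto split: split_indicator)
    qed
  qed
  also have "\<dots> = t ^ d * unit_vol d + (1 - t / 3) ^ k * unit_vol d"
    using t integral_indicator_dball[of t d "\<lambda>_. 0"] integral_indicator_dball[of 1 d "\<lambda>_. 0"]
    by (subst Bochner_Integration.integral_add)
       (auto intro!: integrable_mult_right integrable_indicator_dball simp del: Bochner_Integration.integral_indicator)
  also have "\<dots> = (t ^ d + (1 - t / 3) ^ k) * unit_vol d"
    by (simp add: algebra_simps)
  finally show ?thesis
    using unit_vol_pos[of d] by (simp add: lens_moment_def divide_le_eq)
qed

text \<open>The ball of radius \<open>1 - e / 2\<close> around the midpoint \<open>u / 2\<close> is
  contained in both unit balls.\<close>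

lemma lens_lower_bound:
  assumes "eucl_dist d (\<lambda>_. 0) u \<le> e" "e \<le> 1"
  shows "(1 - e / 2) ^ d \<le> lens d u"
proof -
  let ?O = "dball d (\<lambda>_. 0) 1" and ?L = "lebesgue_d d"
  define w where "w = affd d (\<lambda>_. 0) (1/2) u"
  have e: "0 \<le> e" using assms(1) eucl_dist_nonneg[of d "\<lambda>_. 0" u] by linarith
  have w: "eucl_dist d (\<lambda>_. 0) w \<le> e / 2"
    using assms(1) by (simp add: w_def eucl_dist_affd_center)
  have "eucl_dist d u w = 1 / 2 * eucl_dist d u (\<lambda>_. 0)"
    by (rule eucl_dist_scale) (auto simp: w_def affd_def)
  then have uw: "eucl_dist d u w \<le> e / 2"
    using assms(1) by (simp add: eucl_dist_commute)
  have "dball d w (1 - e / 2) \<subseteq> ?O \<inter> dball d u 1"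
  proof
    fix v assume v: "v \<in> dball d w (1 - e / 2)"
    then have "eucl_dist d w v \<le> 1 - e / 2" by (simp add: dball_def)
    then show "v \<in> ?O \<inter> dball d u 1"
      using v w uw eucl_dist_triangle[of d "\<lambda>_. 0" v w] eucl_dist_triangle[of d u v w]
      by (simp add: dball_def)
  qed
  then have "measure ?L (dball d w (1 - e / 2)) \<le> measure ?L (?O \<inter> dball d u 1)"
    by (rule measure_mono_fmeasurable) (auto intro!: fmeasurable.Int fmeasurable_dball)
  then show ?thesis
    using assms e unit_vol_pos[of d] by (simp add: lens_def measure_dball pos_le_divide_eq)
qed

text \<open>Only the ball of radius \<open>1 / k\<close> is used, of relative volume
  \<open>(1 / k) ^ d\<close>. On it the lens is at least \<open>(1 - 1 / (2 k)) ^ d\<close>, and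
  Bernoulli's inequality keeps the \<open>k\<close>-th power of this above
  \<open>(1 / 2) ^ d\<close>.\<close>

lemma lens_moment_lower_bound:
  assumes k: "1 \<le> k"
  shows "(1 / (2 * real k)) ^ d \<le> lens_moment d k"
proof -
  let ?O = "dball d (\<lambda>_. 0)" and ?L = "lebesgue_d d"
  have "(1/2) ^ d * ((1 / real k) ^ d * unit_vol d) = (\<integral> u. (1/2) ^ d * indicator (?O (1 / real k)) u \<partial>?L)"
    using k integral_indicator_dball[of "1 / real k" d "\<lambda>_. 0"]
    by (simp del: Bochner_Integration.integral_indicator)
  also have "\<dots> \<le> (\<integral> u. indicator (?O 1) u * lens d u ^ k \<partial>?L)"
  proof (rule integral_mono)
    show "integrable ?L (\<lambda>u. indicator (?O 1) u * lens d u ^ k)"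
      by (rule integrable_lens_power)
    show "integrable ?L (\<lambda>u. (1/2) ^ d * indicator (?O (1 / real k)) u :: real)"
      using k by (intro integrable_mult_right integrable_indicator_dball) auto
    fix u assume "u \<in> space ?L"
    show "(1/2) ^ d * indicator (?O (1 / real k)) u \<le> indicator (?O 1) u * lens d u ^ k"
    proof (cases "u \<in> ?O (1 / real k)")
      case True
      have "1 / real k \<le> 1" using k by simp
      then have "u \<in> ?O 1" using True by (auto simp: dball_def)
      have "(1/2 :: real) \<le> 1 + real k * (- (1 / real k / 2))" using k by simp
      also have "\<dots> \<le> (1 + (- (1 / real k / 2))) ^ k"
        using k by (intro Bernoulli_inequality) (auto simp: field_simps)
      finally have "(1/2) ^ d \<le> ((1 - 1 / real k / 2) ^ k) ^ d"
        by (intro power_mono) auto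
      also have "\<dots> = ((1 - 1 / real k / 2) ^ d) ^ k" by (simp add: power_mult[symmetric] mult.commute)
      also have "\<dots> \<le> lens d u ^ k"
        using True \<open>1 / real k \<le> 1\<close> k
        by (intro power_mono lens_lower_bound zero_le_power) (auto simp: dball_def field_simps)
      finally show ?thesis using True \<open>u \<in> ?O 1\<close> by simp
    qed (auto simp: lens_nonneg)
  qed
  finally show ?thesis
    using unit_vol_pos[of d] by (simp add: lens_moment_def pos_le_divide_eq power_divide power_mult_distrib)
qed

text \<open>For large \<open>k\<close> the \<open>k\<close>-th lens moment is of order \<open>k\<^sup>-\<^sup>d\<close>; the choice
  \<open>k = N ^ (2 * d + 2)\<close>, \<open>t = N ^ -(2 * d + 1)\<close> in the upper bound makes this visible.\<close>

lemma lens_moment_separates: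
  "\<exists>k \<tau>. (\<forall>d'\<le>d. \<tau> < lens_moment d' k) \<and> (\<forall>d'>d. lens_moment d' k < \<tau>)"
proof -
  \<comment> \<open>Chosen so that \<open>exp (- N / 3)\<close> equals \<open>b\<close> times
    \<open>C * ((N / 3) ^ (2 * d * (d + 1)) / exp (N / 3))\<close>: one factor cancels the
    \<open>2 ^ d\<close> in \<open>b\<close>, the other rewrites powers of \<open>N\<close> as
    powers of \<open>N / 3\<close>.\<close>
  define C :: real where "C = 2 ^ d * 3 ^ (2 * d * (d + 1))"
  have "((\<lambda>N. 2 ^ d / real N ^ (d + 1)) \<longlongrightarrow> 0) sequentially"
    by (intro tendsto_divide_0[OF tendsto_const] filterlim_at_top_imp_at_infinity
        filterlim_pow_at_top filterlim_real_sequentially) simp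
  then have ev1: "eventually (\<lambda>N. 2 ^ d / real N ^ (d + 1) < 1 / 2) sequentially"
    by (rule order_tendstoD) simp
  have "((\<lambda>x::real. x ^ (2 * d * (d + 1)) / exp x) \<longlongrightarrow> 0) at_top"
    by (rule tendsto_power_div_exp_0)
  moreover have "filterlim (\<lambda>N. 1 / 3 * real N) at_top sequentially"
    by (rule filterlim_tendsto_pos_mult_at_top[OF tendsto_const _ filterlim_real_sequentially]) simp
  ultimately have "((\<lambda>N. (1 / 3 * real N) ^ (2 * d * (d + 1)) / exp (1 / 3 * real N)) \<longlongrightarrow> 0) sequentially"
    by (rule filterlim_compose)
  then have "((\<lambda>N. C * ((1 / 3 * real N) ^ (2 * d * (d + 1)) / exp (1 / 3 * real N))) \<longlongrightarrow> 0) sequentially"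
    by (rule tendsto_mult_right_zero)
  then have ev2: "eventually (\<lambda>N. C * ((1 / 3 * real N) ^ (2 * d * (d + 1)) / exp (1 / 3 * real N)) < 1 / 2) sequentially"
    by (rule order_tendstoD) simp
  obtain N :: nat where N: "1 \<le> N" and N1: "2 ^ d / real N ^ (d + 1) < 1 / 2"
    and N2: "C * ((1 / 3 * real N) ^ (2 * d * (d + 1)) / exp (1 / 3 * real N)) < 1 / 2"
    using eventually_happens'[OF sequentially_bot
        eventually_conj[OF eventually_ge_at_top[of "1::nat"] eventually_conj[OF ev1 ev2]]]
    by blast
  define k where "k = N ^ (2 * d + 2)"
  define t where "t = 1 / real N ^ (2 * d + 1)"
  \<comment> \<open>\<open>b\<close> is the lower bound in dimension \<open>d\<close>, which
    decreases in the dimension and so holds for all smaller ones; \<open>a\<close> is the upper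
    bound in dimension \<open>d + 1\<close>, valid for all larger ones. The exponent of
    \<open>1 / N\<close> in \<open>t ^ (d + 1)\<close> exceeds that in \<open>b\<close> by
    \<open>d + 1\<close>, and \<open>k t = N\<close> makes the other summand of \<open>a\<close>
    exponentially small in \<open>N\<close>.\<close>
  define b where "b = (1 / (2 * real k)) ^ d"
  define a where "a = t ^ (d + 1) + (1 - t / 3) ^ k"
  have k: "1 \<le> k" using N by (simp add: k_def)
  have "1 \<le> real N ^ (2 * d + 1)" using N by (intro one_le_power) simp
  then have t: "0 < t" "t \<le> 1" by (auto simp: t_def)
  have kt: "real k * t = real N"
    using N by (simp add: k_def t_def power_add)
  have b: "b = 1 / (2 ^ d * real N ^ (2 * d * (d + 1)))"
  proof -
    have "(2 * d + 2) * d = 2 * d * (d + 1)" by (simp add: algebra_simps)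
    then have "(real N ^ (2 * d + 2)) ^ d = real N ^ (2 * d * (d + 1))"
      by (metis power_mult)
    then show ?thesis
      by (simp only: b_def k_def power_divide power_mult_distrib of_nat_power power_one)
  qed
  have bpos: "0 < b" using N by (simp add: b)
  have "t ^ (d + 1) = b * (2 ^ d / real N ^ (d + 1))"
  proof -
    have "(2 * d + 1) * (d + 1) = 2 * d * (d + 1) + (d + 1)" by (simp add: algebra_simps)
    then have "real N ^ ((2 * d + 1) * (d + 1)) = real N ^ (2 * d * (d + 1)) * real N ^ (d + 1)"
      by (metis power_add)
    then have "(real N ^ (2 * d + 1)) ^ (d + 1) = real N ^ (2 * d * (d + 1)) * real N ^ (d + 1)"
      by (metis power_mult)
    then have "t ^ (d + 1) = 1 / (real N ^ (2 * d * (d + 1)) * real N ^ (d + 1))"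
      by (simp only: t_def power_divide power_one)
    then show ?thesis
      unfolding b by (simp only: times_divide_times_eq) (simp del: power_add_numeral power_Suc)
  qed
  also have "\<dots> < b * (1 / 2)" using N1 bpos by (rule mult_strict_left_mono)
  finally have a1: "t ^ (d + 1) < b / 2" by simp
  have "(1 - t / 3) ^ k \<le> exp (- t / 3) ^ k"
    using t exp_ge_add_one_self[of "- t / 3"] by (intro power_mono) auto
  also have "\<dots> = exp (real k * (- t / 3))" by (rule exp_of_nat_mult[symmetric])
  also have "real k * (- t / 3) = - (1 / 3 * real N)" using kt by simp
  also have "exp (- (1 / 3 * real N)) = b * (C * ((1 / 3 * real N) ^ (2 * d * (d + 1)) / exp (1 / 3 * real N)))"
  proof -
    have "(1 / 3 * real N) ^ (2 * d * (d + 1)) = real N ^ (2 * d * (d + 1)) / 3 ^ (2 * d * (d + 1))"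
      by (simp only: power_mult_distrib power_divide power_one) simp
    then have "C * ((1 / 3 * real N) ^ (2 * d * (d + 1)) / exp (1 / 3 * real N))
        = 2 ^ d * real N ^ (2 * d * (d + 1)) / exp (1 / 3 * real N)"
      unfolding C_def by (simp only: times_divide_eq_left times_divide_eq_right) simp
    then show ?thesis
      using N unfolding b exp_minus by (simp only: times_divide_times_eq inverse_eq_divide) simp
  qed
  also have "\<dots> < b * (1 / 2)" using N2 bpos by (rule mult_strict_left_mono)
  finally have a2: "(1 - t / 3) ^ k < b / 2" by simp
  have ab: "a < b" using a1 a2 by (simp add: a_def)
  have lo: "b \<le> lens_moment d' k" if "d' \<le> d" for d'
  proof -
    have "b \<le> (1 / (2 * real k)) ^ d'"
      unfolding b_def using k that by (intro power_decreasing) auto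
    also have "\<dots> \<le> lens_moment d' k" by (rule lens_moment_lower_bound[OF k])
    finally show ?thesis .
  qed
  have up: "lens_moment d' k \<le> a" if "d' > d" for d'
  proof -
    have "lens_moment d' k \<le> t ^ d' + (1 - t / 3) ^ k" by (rule lens_moment_upper_bound[OF t])
    also have "t ^ d' \<le> t ^ (d + 1)" using t that by (intro power_decreasing) auto
    finally show ?thesis by (simp add: a_def)
  qed
  show ?thesis
    using lo up ab by (intro exI[of _ k] exI[of _ "(a + b) / 2"]) force
qed

section \<open>Continuity of translations in \<open>L\<^sup>1\<close>\<close>

definition box_d :: "nat \<Rightarrow> (nat \<Rightarrow> real) \<Rightarrow> (nat \<Rightarrow> real) \<Rightarrow> (nat \<Rightarrow> real) set" where
  "box_d d a b = Pi\<^sub>E {..<d} (\<lambda>k. {a k..b k})"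

text \<open>\<open>affd d u 1 x\<close> is \<open>x + u\<close>. Shifts are bounded coordinatewise,
  which suits boxes, and the nonnegative integral keeps integrability side conditions out of the
  closure properties.\<close>

definition L1_translation_continuous :: "nat \<Rightarrow> ((nat \<Rightarrow> real) \<Rightarrow> real) \<Rightarrow> bool" where
  "L1_translation_continuous d f \<longleftrightarrow> (\<forall>e>0. \<exists>\<delta>>0. \<forall>u. (\<forall>k<d. \<bar>u k\<bar> \<le> \<delta>) \<longrightarrow>
     (\<integral>\<^sup>+ x. ennreal \<bar>f (affd d u 1 x) - f x\<bar> \<partial>lebesgue_d d) \<le> ennreal e)"

section \<open>Boxes as a generator and their volumes\<close>

lemma box_d_Int: "box_d d a b \<inter> box_d d a' b' = box_d d (\<lambda>k. max (a k) (a' k)) (\<lambda>k. min (b k) (b' k))"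
  by (auto simp: box_d_def PiE_def Pi_def)

lemma mem_box_d: "x \<in> box_d d a b \<longleftrightarrow> x \<in> space (lebesgue_d d) \<and> (\<forall>k<d. a k \<le> x k \<and> x k \<le> b k)"
  by (auto simp: box_d_def PiE_def Pi_def space_lebesgue_d)

lemma sets_box_d [measurable]: "box_d d a b \<in> sets (lebesgue_d d)"
  unfolding box_d_def sets_lebesgue_d by (intro sets_PiM_I_finite) auto

lemma emeasure_box_d: "emeasure (lebesgue_d d) (box_d d a b) = ennreal (\<Prod>k<d. max 0 (b k - a k))"
proof -
  have "emeasure (lebesgue_d d) (box_d d a b) = (\<Prod>k<d. emeasure lborel {a k..b k})"
    unfolding box_d_def by (rule emeasure_box)
  also have "\<dots> = (\<Prod>k<d. ennreal (max 0 (b k - a k)))"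
    by (intro prod.cong) (auto simp: emeasure_lborel_Icc_eq max_def)
  also have "\<dots> = ennreal (\<Prod>k<d. max 0 (b k - a k))"
    by (rule prod_ennreal) simp
  finally show ?thesis .
qed

lemma integrable_indicator_box_d: "integrable (lebesgue_d d) (indicator (box_d d a b) :: _ \<Rightarrow> real)"
  by (simp add: emeasure_box_d)

text \<open>Provides the intersection-stable generator for the Dynkin argument below. Closed
  intervals generate \<open>borel\<close>, and the line is a countable union of them, as the
  description of product sigma-algebras by generators requires.\<close>

lemma sets_lebesgue_d_eq_sigma_boxes:
  "sets (lebesgue_d d) = sigma_sets (space (lebesgue_d d)) {box_d d a b |a b. True}"
proof -
  let ?E = "\<lambda>_::nat. range (\<lambda>(a,b). {a..b::real})"
  let ?P = "{{f\<in>(\<Pi>\<^sub>E i\<in>{..<d}. UNIV). \<forall>i\<in>j. f i \<in> A i} | A j. j \<in> {{..<d}} \<and> A \<in> Pi j ?E}"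
  have "sets (lebesgue_d d) = sets (PiM {..<d} (\<lambda>i. sigma UNIV (?E i)))"
    unfolding sets_lebesgue_d borel_eq_atLeastAtMost ..
  also have "\<dots> = sets (sigma (\<Pi>\<^sub>E i\<in>{..<d}. UNIV) ?P)"
  proof (rule sets_PiM_sigma)
    fix i
    show "\<exists>S\<subseteq>?E i. countable S \<and> UNIV = \<Union>S"
    proof (intro exI[of _ "range (\<lambda>n::nat. {- real n..real n})"] conjI)
      show "UNIV = (\<Union>n::nat. {- real n..real n})"
      proof (intro set_eqI iffI UNIV_I)
        fix x :: real
        obtain n :: nat where "\<bar>x\<bar> \<le> real n" using real_arch_simple by blast
        then show "x \<in> (\<Union>n::nat. {- real n..real n})" by (auto intro!: exI[of _ n])
      qed
    qed auto
  qed auto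
  also have "?P = {box_d d a b |a b. True}"
  proof (intro set_eqI iffI)
    fix X assume "X \<in> ?P"
    then obtain A j where "X = {f\<in>(\<Pi>\<^sub>E i\<in>{..<d}. UNIV). \<forall>i\<in>j. f i \<in> A i}"
      and "j \<in> {{..<d}}" and "A \<in> Pi j ?E"
      unfolding mem_Collect_eq by (elim exE conjE) (rule that)
    then have X: "X = {f\<in>(\<Pi>\<^sub>E i\<in>{..<d}. UNIV). \<forall>i\<in>{..<d}. f i \<in> A i}"
      and A: "A \<in> Pi {..<d} ?E" by simp_all
    have "\<exists>p. A i = {fst p..snd p}" if "i < d" for i
    proof -
      have "A i \<in> range (\<lambda>(a,b). {a..b})" using A that by auto
      then show ?thesis by (auto simp: case_prod_beta)
    qed
    then obtain p where p: "\<And>i. i < d \<Longrightarrow> A i = {fst (p i)..snd (p i)}"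
      using that[of "\<lambda>i. SOME p. A i = {fst p..snd p}"] someI_ex[of "\<lambda>p. A _ = {fst p..snd p}"] by blast
    have "X = box_d d (\<lambda>i. fst (p i)) (\<lambda>i. snd (p i))"
      unfolding X box_d_def using p by (auto simp: PiE_def Pi_def)
    then show "X \<in> {box_d d a b |a b. True}" by blast
  next
    fix X assume "X \<in> {box_d d a b |a b. True}"
    then obtain a b where X: "X = box_d d a b" by blast
    have "X = {f\<in>(\<Pi>\<^sub>E i\<in>{..<d}. UNIV). \<forall>i\<in>{..<d}. f i \<in> {a i..b i}}"
      unfolding X box_d_def by (auto simp: PiE_def Pi_def)
    moreover have "(\<lambda>i. {a i..b i}) \<in> Pi {..<d} ?E" by auto
    ultimately show "X \<in> ?P"
      unfolding mem_Collect_eq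
      by (intro exI[of _ "\<lambda>i. {a i..b i}"] exI[of _ "{..<d}"] conjI) simp_all
  qed
  also have "sets (sigma (\<Pi>\<^sub>E i\<in>{..<d}. UNIV) {box_d d a b |a b. True})
      = sigma_sets (\<Pi>\<^sub>E i\<in>{..<d}. UNIV) {box_d d a b |a b. True}"
    by (rule sets_measure_of) (auto simp: box_d_def PiE_def)
  finally show ?thesis by (simp add: space_lebesgue_d PiE_def)
qed

section \<open>From boxes to all integrable functions\<close>

lemma L1_translation_continuous_add:
  assumes f: "L1_translation_continuous d f" "f \<in> borel_measurable (lebesgue_d d)"
    and g: "L1_translation_continuous d g" "g \<in> borel_measurable (lebesgue_d d)"
  shows "L1_translation_continuous d (\<lambda>x. f x + g x)"
  unfolding L1_translation_continuous_def
proof (intro allI impI)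
  fix e :: real assume e: "0 < e"
  note [measurable] = f(2) g(2)
  obtain \<delta>1 where 1: "\<delta>1 > 0" "\<And>u. (\<forall>k<d. \<bar>u k\<bar> \<le> \<delta>1) \<Longrightarrow>
      (\<integral>\<^sup>+ x. ennreal \<bar>f (affd d u 1 x) - f x\<bar> \<partial>lebesgue_d d) \<le> ennreal (e / 2)"
    using f(1) e unfolding L1_translation_continuous_def by (meson half_gt_zero)
  obtain \<delta>2 where 2: "\<delta>2 > 0" "\<And>u. (\<forall>k<d. \<bar>u k\<bar> \<le> \<delta>2) \<Longrightarrow>
      (\<integral>\<^sup>+ x. ennreal \<bar>g (affd d u 1 x) - g x\<bar> \<partial>lebesgue_d d) \<le> ennreal (e / 2)"
    using g(1) e unfolding L1_translation_continuous_def by (meson half_gt_zero)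
  show "\<exists>\<delta>>0. \<forall>u. (\<forall>k<d. \<bar>u k\<bar> \<le> \<delta>) \<longrightarrow>
     (\<integral>\<^sup>+ x. ennreal \<bar>f (affd d u 1 x) + g (affd d u 1 x) - (f x + g x)\<bar> \<partial>lebesgue_d d) \<le> ennreal e"
  proof (intro exI[of _ "min \<delta>1 \<delta>2"] conjI allI impI)
    fix u :: "nat \<Rightarrow> real" assume u: "\<forall>k<d. \<bar>u k\<bar> \<le> min \<delta>1 \<delta>2"
    have "(\<integral>\<^sup>+ x. ennreal \<bar>f (affd d u 1 x) + g (affd d u 1 x) - (f x + g x)\<bar> \<partial>lebesgue_d d)
      \<le> (\<integral>\<^sup>+ x. ennreal \<bar>f (affd d u 1 x) - f x\<bar> + ennreal \<bar>g (affd d u 1 x) - g x\<bar> \<partial>lebesgue_d d)"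
      by (intro nn_integral_mono) (simp del: ennreal_plus add: ennreal_plus[symmetric] ennreal_leI)
    also have "\<dots> = (\<integral>\<^sup>+ x. ennreal \<bar>f (affd d u 1 x) - f x\<bar> \<partial>lebesgue_d d)
        + (\<integral>\<^sup>+ x. ennreal \<bar>g (affd d u 1 x) - g x\<bar> \<partial>lebesgue_d d)"
      by (rule nn_integral_add) measurable
    also have "\<dots> \<le> ennreal (e / 2) + ennreal (e / 2)"
      using u by (intro add_mono 1 2) auto
    also have "\<dots> = ennreal e" using e by (simp flip: ennreal_plus)
    finally show "(\<integral>\<^sup>+ x. ennreal \<bar>f (affd d u 1 x) + g (affd d u 1 x) - (f x + g x)\<bar> \<partial>lebesgue_d d) \<le> ennreal e" .
  qed (use 1 2 in auto)
qed

lemma L1_translation_continuous_cmult: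
  assumes f: "L1_translation_continuous d f" "f \<in> borel_measurable (lebesgue_d d)"
  shows "L1_translation_continuous d (\<lambda>x. c * f x)"
  unfolding L1_translation_continuous_def
proof (intro allI impI)
  fix e :: real assume e: "0 < e"
  note [measurable] = f(2)
  have "0 < e / (\<bar>c\<bar> + 1)" using e by (intro divide_pos_pos) auto
  then obtain \<delta>1 where 1: "\<delta>1 > 0" "\<And>u. (\<forall>k<d. \<bar>u k\<bar> \<le> \<delta>1) \<Longrightarrow>
      (\<integral>\<^sup>+ x. ennreal \<bar>f (affd d u 1 x) - f x\<bar> \<partial>lebesgue_d d) \<le> ennreal (e / (\<bar>c\<bar> + 1))"
    using f(1) unfolding L1_translation_continuous_def by meson
  show "\<exists>\<delta>>0. \<forall>u. (\<forall>k<d. \<bar>u k\<bar> \<le> \<delta>) \<longrightarrow>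
     (\<integral>\<^sup>+ x. ennreal \<bar>c * f (affd d u 1 x) - c * f x\<bar> \<partial>lebesgue_d d) \<le> ennreal e"
  proof (intro exI[of _ "\<delta>1"] conjI allI impI)
    fix u :: "nat \<Rightarrow> real" assume u: "\<forall>k<d. \<bar>u k\<bar> \<le> \<delta>1"
    have "(\<integral>\<^sup>+ x. ennreal \<bar>c * f (affd d u 1 x) - c * f x\<bar> \<partial>lebesgue_d d)
      = (\<integral>\<^sup>+ x. ennreal \<bar>c\<bar> * ennreal \<bar>f (affd d u 1 x) - f x\<bar> \<partial>lebesgue_d d)"
      by (intro nn_integral_cong) (simp add: right_diff_distrib[symmetric] abs_mult ennreal_mult)
    also have "\<dots> = ennreal \<bar>c\<bar> * (\<integral>\<^sup>+ x. ennreal \<bar>f (affd d u 1 x) - f x\<bar> \<partial>lebesgue_d d)"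
      by (rule nn_integral_cmult) measurable
    also have "\<dots> \<le> ennreal \<bar>c\<bar> * ennreal (e / (\<bar>c\<bar> + 1))"
      using u by (intro mult_left_mono 1) auto
    also have "\<dots> = ennreal (\<bar>c\<bar> * (e / (\<bar>c\<bar> + 1)))"
      using e by (intro ennreal_mult[symmetric]) auto
    also have "\<dots> \<le> ennreal e"
      using e by (intro ennreal_leI) (simp add: field_simps)
    finally show "(\<integral>\<^sup>+ x. ennreal \<bar>c * f (affd d u 1 x) - c * f x\<bar> \<partial>lebesgue_d d) \<le> ennreal e" .
  qed (use 1 in auto)
qed

text \<open>Dominated convergence yields one \<open>s n\<close> within \<open>e / 3\<close> of
  \<open>f\<close> in the mean. Translation invariance of the measure gives the same bound after the
  shift, so the triangle inequality leaves only the shift of \<open>s n\<close> itself.\<close>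

lemma L1_translation_continuous_dominated_limit:
  assumes s: "\<And>n::nat. L1_translation_continuous d (s n)" "\<And>n. s n \<in> borel_measurable (lebesgue_d d)"
    and f: "f \<in> borel_measurable (lebesgue_d d)"
    and lim: "\<And>x. x \<in> space (lebesgue_d d) \<Longrightarrow> (\<lambda>n. s n x) \<longlonglongrightarrow> f x"
    and w: "integrable (lebesgue_d d) w" "\<And>n x. x \<in> space (lebesgue_d d) \<Longrightarrow> \<bar>s n x\<bar> \<le> w x"
  shows "L1_translation_continuous d f"
  unfolding L1_translation_continuous_def
proof (intro allI impI)
  fix e :: real assume e: "0 < e"
  note [measurable] = s(2) f
  let ?L = "lebesgue_d d"
  have "(\<lambda>n. \<integral>\<^sup>+ x. norm (f x - s n x) \<partial>?L) \<longlonglongrightarrow> 0"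
  proof (rule nn_integral_dominated_convergence_norm[where w="\<lambda>x. \<bar>w x\<bar>"])
    show "(\<integral>\<^sup>+ x. ennreal \<bar>w x\<bar> \<partial>?L) < \<infinity>"
      using w(1) by (simp add: integrable_iff_bounded)
    show "AE x in ?L. norm (s n x) \<le> \<bar>w x\<bar>" for n
    proof (rule AE_I2)
      fix x assume "x \<in> space ?L"
      then have "\<bar>s n x\<bar> \<le> w x" by (rule w(2))
      then show "norm (s n x) \<le> \<bar>w x\<bar>" by simp
    qed
    show "(\<lambda>x. \<bar>w x\<bar>) \<in> borel_measurable ?L" using w(1) by measurable
  qed (use lim in auto)
  then have "eventually (\<lambda>n. (\<integral>\<^sup>+ x. norm (f x - s n x) \<partial>?L) < ennreal (e / 3)) sequentially"
    by (rule order_tendstoD) (use e in simp)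
  then have "\<exists>n. (\<integral>\<^sup>+ x. norm (f x - s n x) \<partial>?L) < ennreal (e / 3)"
    by (rule eventually_happens'[OF sequentially_bot])
  then obtain n where "(\<integral>\<^sup>+ x. norm (f x - s n x) \<partial>?L) < ennreal (e / 3)" ..
  then have n: "(\<integral>\<^sup>+ x. ennreal \<bar>f x - s n x\<bar> \<partial>?L) \<le> ennreal (e / 3)"
    by (simp add: less_imp_le)
  have "0 < e / 3" using e by simp
  then obtain \<delta> where \<delta>: "\<delta> > 0" "\<And>u. (\<forall>k<d. \<bar>u k\<bar> \<le> \<delta>) \<Longrightarrow>
      (\<integral>\<^sup>+ x. ennreal \<bar>s n (affd d u 1 x) - s n x\<bar> \<partial>?L) \<le> ennreal (e / 3)"
    using s(1)[of n] unfolding L1_translation_continuous_def by meson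
  show "\<exists>\<delta>>0. \<forall>u. (\<forall>k<d. \<bar>u k\<bar> \<le> \<delta>) \<longrightarrow>
     (\<integral>\<^sup>+ x. ennreal \<bar>f (affd d u 1 x) - f x\<bar> \<partial>?L) \<le> ennreal e"
  proof (intro exI[of _ "\<delta>"] conjI allI impI)
    fix u :: "nat \<Rightarrow> real" assume u: "\<forall>k<d. \<bar>u k\<bar> \<le> \<delta>"
    have "(\<integral>\<^sup>+ x. ennreal \<bar>f (affd d u 1 x) - f x\<bar> \<partial>?L)
      \<le> (\<integral>\<^sup>+ x. ennreal \<bar>f (affd d u 1 x) - s n (affd d u 1 x)\<bar>
            + (ennreal \<bar>s n (affd d u 1 x) - s n x\<bar> + ennreal \<bar>f x - s n x\<bar>) \<partial>?L)"
      by (intro nn_integral_mono) (simp del: ennreal_plus add: ennreal_plus[symmetric] ennreal_leI)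
    also have "\<dots> = (\<integral>\<^sup>+ x. ennreal \<bar>f (affd d u 1 x) - s n (affd d u 1 x)\<bar> \<partial>?L)
            + ((\<integral>\<^sup>+ x. ennreal \<bar>s n (affd d u 1 x) - s n x\<bar> \<partial>?L) + (\<integral>\<^sup>+ x. ennreal \<bar>f x - s n x\<bar> \<partial>?L))"
      by (simp add: nn_integral_add)
    also have "(\<integral>\<^sup>+ x. ennreal \<bar>f (affd d u 1 x) - s n (affd d u 1 x)\<bar> \<partial>?L) = (\<integral>\<^sup>+ x. ennreal \<bar>f x - s n x\<bar> \<partial>?L)"
      using nn_integral_affd[of 1 "\<lambda>x. ennreal \<bar>f x - s n x\<bar>" d u] by simp
    also have "(\<integral>\<^sup>+ x. ennreal \<bar>f x - s n x\<bar> \<partial>?L) + ((\<integral>\<^sup>+ x. ennreal \<bar>s n (affd d u 1 x) - s n x\<bar> \<partial>?L) + (\<integral>\<^sup>+ x. ennreal \<bar>f x - s n x\<bar> \<partial>?L))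
        \<le> ennreal (e / 3) + (ennreal (e / 3) + ennreal (e / 3))"
      using u by (intro add_mono n \<delta>) auto
    also have "\<dots> = ennreal e" using e by (simp flip: ennreal_plus)
    finally show "(\<integral>\<^sup>+ x. ennreal \<bar>f (affd d u 1 x) - f x\<bar> \<partial>?L) \<le> ennreal e" .
  qed (use \<delta> in auto)
qed

text \<open>A box and its translate can differ only in the shell between the box enlarged and the
  box shrunk by \<delta>, whose volume tends to zero with \<delta>.\<close>

lemma L1_translation_continuous_box_d: "L1_translation_continuous d (indicator (box_d d a b))"
  unfolding L1_translation_continuous_def
proof (intro allI impI)
  fix e :: real assume e: "0 < e"
  \<comment> \<open>The volume of the shell. The maxima with 0 account for boxes that are degenerate
    or become empty when shrunk, and keep \<open>h\<close> continuous.\<close>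
  define h where "h \<delta> = (\<Prod>k<d. max 0 (b k - a k + 2 * \<delta>)) - (\<Prod>k<d. max 0 (b k - a k - 2 * \<delta>))" for \<delta> :: real
  have "isCont h 0" unfolding h_def by (intro continuous_intros)
  then have "(h \<longlongrightarrow> h 0) (at_right 0)"
    unfolding isCont_def by (rule tendsto_within_subset) simp
  moreover have "h 0 < e" using e by (simp add: h_def)
  ultimately have "eventually (\<lambda>\<delta>. h \<delta> < e) (at_right 0)" by (rule order_tendstoD)
  then obtain \<delta> where \<delta>: "0 < \<delta>" "h \<delta> < e"
    using eventually_happens'[OF trivial_limit_at_right_real eventually_conj[OF eventually_at_right_less[of "0::real"]]]
    by blast
  let ?L = "lebesgue_d d"
  let ?O = "box_d d (\<lambda>k. a k - \<delta>) (\<lambda>k. b k + \<delta>)"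
  let ?I = "box_d d (\<lambda>k. a k + \<delta>) (\<lambda>k. b k - \<delta>)"
  have inner: "a k + \<delta> \<le> x k \<and> x k \<le> b k - \<delta>" if "x \<in> ?I" "k < d" for x k
    using that by (simp add: mem_box_d)
  have sub: "?I \<subseteq> ?O"
  proof
    fix x assume x: "x \<in> ?I"
    have "a k - \<delta> \<le> x k \<and> x k \<le> b k + \<delta>" if "k < d" for k
      using inner[OF x that] \<delta>(1) by linarith
    then show "x \<in> ?O" using x by (simp add: mem_box_d)
  qed
  have emO: "emeasure ?L ?O = ennreal (\<Prod>k<d. max 0 (b k - a k + 2 * \<delta>))"
  proof -
    have "(b k + \<delta>) - (a k - \<delta>) = b k - a k + 2 * \<delta>" for k by simp
    then show ?thesis by (simp only: emeasure_box_d)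
  qed
  have emI: "emeasure ?L ?I = ennreal (\<Prod>k<d. max 0 (b k - a k - 2 * \<delta>))"
  proof -
    have "(b k - \<delta>) - (a k + \<delta>) = b k - a k - 2 * \<delta>" for k by simp
    then show ?thesis by (simp only: emeasure_box_d)
  qed
  have "emeasure ?L (?O - ?I) = emeasure ?L ?O - emeasure ?L ?I"
    using sub by (intro emeasure_Diff) (auto simp: emI)
  also have "\<dots> = ennreal (h \<delta>)"
    unfolding emO emI h_def by (rule ennreal_minus) (simp add: prod_nonneg)
  finally have em: "emeasure ?L (?O - ?I) \<le> ennreal e"
    using \<delta>(2) by (simp add: ennreal_leI)
  show "\<exists>\<delta>>0. \<forall>u. (\<forall>k<d. \<bar>u k\<bar> \<le> \<delta>) \<longrightarrow>
     (\<integral>\<^sup>+ x. ennreal \<bar>indicator (box_d d a b) (affd d u 1 x) - indicator (box_d d a b) x\<bar> \<partial>?L) \<le> ennreal e"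
  proof (intro exI[of _ "\<delta>"] conjI allI impI)
    fix u :: "nat \<Rightarrow> real" assume u: "\<forall>k<d. \<bar>u k\<bar> \<le> \<delta>"
    have "(\<integral>\<^sup>+ x. ennreal \<bar>indicator (box_d d a b) (affd d u 1 x) - indicator (box_d d a b) x\<bar> \<partial>?L)
      \<le> (\<integral>\<^sup>+ x. indicator (?O - ?I) x \<partial>?L)"
    proof (rule nn_integral_mono)
      fix x assume x: "x \<in> space ?L"
      have 1: "x \<in> ?I \<Longrightarrow> affd d u 1 x \<in> box_d d a b \<and> x \<in> box_d d a b"
      proof -
        assume xI: "x \<in> ?I"
        have "a k \<le> u k + x k \<and> u k + x k \<le> b k \<and> a k \<le> x k \<and> x k \<le> b k" if "k < d" for k
          using u[rule_format, OF that] \<delta>(1) inner[OF xI that] by linarith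
        then show ?thesis using x by (simp add: mem_box_d) (simp add: affd_def)
      qed
      have 2: "affd d u 1 x \<in> box_d d a b \<or> x \<in> box_d d a b \<Longrightarrow> x \<in> ?O"
      proof -
        assume "affd d u 1 x \<in> box_d d a b \<or> x \<in> box_d d a b"
        then have *: "(a k \<le> u k + x k \<and> u k + x k \<le> b k) \<or> (a k \<le> x k \<and> x k \<le> b k)" if "k < d" for k
          using that by (auto simp: mem_box_d affd_def)
        have "a k - \<delta> \<le> x k \<and> x k \<le> b k + \<delta>" if "k < d" for k
          using *[OF that] u[rule_format, OF that] \<delta>(1) by linarith
        then show ?thesis using x by (simp add: mem_box_d)
      qed
      show "ennreal \<bar>indicator (box_d d a b) (affd d u 1 x) - indicator (box_d d a b) x\<bar> \<le> indicator (?O - ?I) x"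
        by (cases "x \<in> ?I"; cases "x \<in> box_d d a b"; cases "affd d u 1 x \<in> box_d d a b")
          (use 1 2 in \<open>simp_all add: indicator_def\<close>)
    qed
    also have "\<dots> \<le> ennreal e" using em by simp
    finally show "(\<integral>\<^sup>+ x. ennreal \<bar>indicator (box_d d a b) (affd d u 1 x) - indicator (box_d d a b) x\<bar> \<partial>?L) \<le> ennreal e" .
  qed (use \<delta> in auto)
qed

text \<open>A Dynkin argument over the boxes. Intersecting with one fixed box keeps every indicator
  integrable: a complement becomes a difference of integrable indicators, and a disjoint union a
  limit dominated by the indicator of the box.\<close>

lemma L1_translation_continuous_indicator_Int_box:
  assumes "A \<in> sets (lebesgue_d d)"
  shows "L1_translation_continuous d (indicator (A \<inter> box_d d a b))"
proof -
  let ?G = "{box_d d a b |a b. True}" and ?L = "lebesgue_d d" and ?K = "box_d d a b"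
  have "Int_stable ?G"
    unfolding Int_stable_def using box_d_Int by blast
  moreover have "?G \<subseteq> Pow (space ?L)"
    by (auto simp: box_d_def space_lebesgue_d PiE_def)
  moreover have "A \<in> sigma_sets (space ?L) ?G"
    using assms by (simp add: sets_lebesgue_d_eq_sigma_boxes)
  ultimately show ?thesis
  proof (induction rule: sigma_sets_induct_disjoint)
    case (basic A)
    then show ?case by (auto simp: box_d_Int L1_translation_continuous_box_d)
  next
    case empty
    then show ?case by (auto simp: L1_translation_continuous_def)
  next
    case (compl A)
    then have [measurable]: "A \<in> sets ?L" by (simp add: sets_lebesgue_d_eq_sigma_boxes)
    have K: "?K \<subseteq> space ?L" by (auto simp: box_d_def space_lebesgue_d PiE_def)
    have "L1_translation_continuous d (\<lambda>x. indicator ?K x + (-1) * indicator (A \<inter> ?K) x)"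
      by (intro L1_translation_continuous_add L1_translation_continuous_cmult
          L1_translation_continuous_box_d compl) measurable
    also have "(\<lambda>x. indicator ?K x + (-1) * indicator (A \<inter> ?K) x :: real) = indicator ((space ?L - A) \<inter> ?K)"
      using K by (auto simp: fun_eq_iff split: split_indicator)
    finally show ?case .
  next
    case (union A)
    then have [measurable]: "A i \<in> sets ?L" for i by (auto simp: sets_lebesgue_d_eq_sigma_boxes)
    have cts: "L1_translation_continuous d (\<lambda>x. \<Sum>i<n. indicator (A i \<inter> ?K) x)" for n
    proof (induction n)
      case 0 then show ?case by (simp add: L1_translation_continuous_def)
    next
      case (Suc n)
      then show ?case
        by (simp, intro L1_translation_continuous_add union) measurable
    qed
    have sums: "(\<lambda>i. indicator (A i \<inter> ?K) x :: real) sums indicator (\<Union>i. A i \<inter> ?K) x" for x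
      using union(1) by (intro indicator_sums) (auto simp: disjoint_family_on_def)
    have le: "(\<Sum>i<n. indicator (A i \<inter> ?K) x :: real) \<le> indicator ?K x" for n x
    proof -
      have "(\<Sum>i<n. indicator (A i \<inter> ?K) x :: real) \<le> indicator (\<Union>i. A i \<inter> ?K) x"
        using sum_le_suminf[OF sums_summable[OF sums], of "{..<n}" x] sums_unique[OF sums, of x] by simp
      also have "\<dots> \<le> indicator ?K x" by (auto split: split_indicator)
      finally show ?thesis .
    qed
    have "L1_translation_continuous d (indicator (\<Union>i. A i \<inter> ?K))"
    proof (rule L1_translation_continuous_dominated_limit[OF cts, where w="indicator ?K"])
      show "(\<lambda>n. \<Sum>i<n. indicator (A i \<inter> ?K) x :: real) \<longlonglongrightarrow> indicator (\<Union>i. A i \<inter> ?K) x" for x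
        using sums[of x] by (simp add: sums_def)
      show "integrable ?L (indicator ?K :: _ \<Rightarrow> real)" by (rule integrable_indicator_box_d)
      show "\<bar>\<Sum>i<n. indicator (A i \<inter> ?K) x :: real\<bar> \<le> indicator ?K x" for n x
        using le[where n=n and x=x] by (simp add: sum_nonneg abs_of_nonneg)
    qed measurable
    then show ?case by simp
  qed
qed

text \<open>Induction over integrable functions. In the base case a set of finite measure is
  exhausted by its intersections with the cubes of half side \<open>n\<close>, dominated by its own
  indicator.\<close>

lemma L1_translation_continuous_integrable:
  assumes "integrable (lebesgue_d d) f"
  shows "L1_translation_continuous d f"
  using assms
proof (induction rule: integrable_induct)
  case (base A c)
  let ?L = "lebesgue_d d"
  let ?K = "\<lambda>n::nat. box_d d (\<lambda>_. - real n) (\<lambda>_. real n)"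
  note [measurable] = base(1)
  have "L1_translation_continuous d (indicator A)"
  proof (rule L1_translation_continuous_dominated_limit)
    show "L1_translation_continuous d (indicator (A \<inter> ?K n))" for n
      by (rule L1_translation_continuous_indicator_Int_box) fact
    show "integrable ?L (indicator A :: _ \<Rightarrow> real)" using base by simp
    show "(\<lambda>n. indicator (A \<inter> ?K n) x :: real) \<longlonglongrightarrow> indicator A x" if "x \<in> space ?L" for x
    proof -
      obtain N :: nat where N: "(\<Sum>k<d. \<bar>x k\<bar>) \<le> real N" using real_arch_simple by blast
      have "x \<in> ?K n" if "N \<le> n" for n
      proof -
        have "\<bar>x k\<bar> \<le> real n" if "k < d" for k
        proof -
          have "\<bar>x k\<bar> \<le> (\<Sum>k<d. \<bar>x k\<bar>)" using that by (intro member_le_sum) auto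
          then show ?thesis using N \<open>N \<le> n\<close> by linarith
        qed
        then show ?thesis
          using \<open>x \<in> space ?L\<close> by (auto simp: box_d_def PiE_def space_lebesgue_d abs_le_iff minus_le_iff)
      qed
      then have "eventually (\<lambda>n. indicator A x = (indicator (A \<inter> ?K n) x :: real)) sequentially"
        by (intro eventually_sequentiallyI[of N]) (auto split: split_indicator)
      then show ?thesis by (rule Lim_transform_eventually[OF tendsto_const])
    qed
  qed (auto split: split_indicator)
  then have "L1_translation_continuous d (\<lambda>x. c * indicator A x)"
    by (rule L1_translation_continuous_cmult) measurable
  then show ?case by (simp add: mult.commute)
next
  case (add f g)
  then show ?case by (intro L1_translation_continuous_add) auto
next
  case (lim f s)
  have w: "integrable (lebesgue_d d) (\<lambda>x. 2 * \<bar>f x\<bar>)"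
    by (intro integrable_mult_right integrable_abs) (use lim in auto)
  show ?case
    by (rule L1_translation_continuous_dominated_limit[where s=s, OF _ _ _ _ w]) (use lim in auto)
qed

section \<open>Oscillation of the density over small balls\<close>

definition local_osc :: "nat \<Rightarrow> ((nat \<Rightarrow> real) \<Rightarrow> real) \<Rightarrow> real \<Rightarrow> (nat \<Rightarrow> real) \<Rightarrow> ennreal" where
  "local_osc d f r x = (\<integral>\<^sup>+ y. indicator (dball d x r) y * ennreal \<bar>f y - f x\<bar> \<partial>lebesgue_d d)"

lemma pair_sigma_finite_lebesgue_d: "pair_sigma_finite (lebesgue_d d) (lebesgue_d d)"
  by (simp add: pair_sigma_finite_def sigma_finite_lebesgue_d)

lemma measurable_local_osc [measurable]:
  assumes [measurable]: "f \<in> borel_measurable (lebesgue_d d)"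
  shows "local_osc d f r \<in> borel_measurable (lebesgue_d d)"
proof -
  interpret sigma_finite_measure "lebesgue_d d" by (rule sigma_finite_lebesgue_d)
  have "(\<lambda>x. \<integral>\<^sup>+ y. indicator {p \<in> space (lebesgue_d d \<Otimes>\<^sub>M lebesgue_d d). eucl_dist d (fst p) (snd p) \<le> r} (x, y)
      * ennreal \<bar>f y - f x\<bar> \<partial>lebesgue_d d) \<in> borel_measurable (lebesgue_d d)"
    by measurable
  also have "?this \<longleftrightarrow> ?thesis"
    unfolding local_osc_def
    by (intro measurable_cong nn_integral_cong) (auto simp: dball_def space_pair_measure split: split_indicator)
  finally show ?thesis .
qed

text \<open>Substituting \<open>y = x + r u\<close> and exchanging the integrals gives, up to the
  factor \<open>r ^ d\<close>, the integral over the unit ball of the mean distance between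
  \<open>f\<close> and its translate by \<open>r u\<close>, which is at most \<open>e\<close> for
  small \<open>r\<close>. The oscillation is not divided by the volume of the ball, so that volume
  appears in the bound. This averaged estimate takes the place of pointwise Lebesgue
  differentiation.\<close>

lemma nn_integral_local_osc_small:
  assumes f: "integrable (lebesgue_d d) f" and e: "0 < e"
  shows "\<exists>\<delta>>0. \<forall>r. 0 < r \<and> r \<le> \<delta> \<longrightarrow>
    (\<integral>\<^sup>+ x. local_osc d f r x \<partial>lebesgue_d d) \<le> ennreal (r ^ d * unit_vol d * e)"
proof -
  interpret pair_sigma_finite "lebesgue_d d" "lebesgue_d d" by (rule pair_sigma_finite_lebesgue_d)
  let ?L = "lebesgue_d d" and ?B = "dball d (\<lambda>_. 0) 1"
  have [measurable]: "f \<in> borel_measurable ?L" using f by auto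
  obtain \<delta> where \<delta>: "\<delta> > 0" "\<And>u. (\<forall>k<d. \<bar>u k\<bar> \<le> \<delta>) \<Longrightarrow>
      (\<integral>\<^sup>+ x. ennreal \<bar>f (affd d u 1 x) - f x\<bar> \<partial>?L) \<le> ennreal e"
    using L1_translation_continuous_integrable[OF f] e unfolding L1_translation_continuous_def by meson
  show ?thesis
  proof (intro exI[of _ \<delta>] conjI allI impI \<delta>(1))
    fix r :: real assume r: "0 < r \<and> r \<le> \<delta>"
    have "(\<integral>\<^sup>+ x. local_osc d f r x \<partial>?L)
       = (\<integral>\<^sup>+ x. ennreal (r ^ d) * (\<integral>\<^sup>+ u. indicator ?B u * ennreal \<bar>f (affd d x r u) - f x\<bar> \<partial>?L) \<partial>?L)"
    proof (intro nn_integral_cong)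
      fix x assume "x \<in> space ?L"
      have "local_osc d f r x = ennreal (r ^ d) * (\<integral>\<^sup>+ u. indicator (dball d x r) (affd d x r u) * ennreal \<bar>f (affd d x r u) - f x\<bar> \<partial>?L)"
        unfolding local_osc_def by (rule nn_integral_affd) (use r in auto)
      also have "(\<integral>\<^sup>+ u. indicator (dball d x r) (affd d x r u) * ennreal \<bar>f (affd d x r u) - f x\<bar> \<partial>?L)
         = (\<integral>\<^sup>+ u. indicator ?B u * ennreal \<bar>f (affd d x r u) - f x\<bar> \<partial>?L)"
        using r by (intro nn_integral_cong) (auto simp: affd_in_dball_iff split: split_indicator)
      finally show "local_osc d f r x = ennreal (r ^ d) * (\<integral>\<^sup>+ u. indicator ?B u * ennreal \<bar>f (affd d x r u) - f x\<bar> \<partial>?L)" .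
    qed
    also have "\<dots> = ennreal (r ^ d) * (\<integral>\<^sup>+ x. (\<integral>\<^sup>+ u. indicator ?B u * ennreal \<bar>f (affd d x r u) - f x\<bar> \<partial>?L) \<partial>?L)"
      by (rule nn_integral_cmult) measurable
    also have "(\<integral>\<^sup>+ x. (\<integral>\<^sup>+ u. indicator ?B u * ennreal \<bar>f (affd d x r u) - f x\<bar> \<partial>?L) \<partial>?L)
       = (\<integral>\<^sup>+ u. (\<integral>\<^sup>+ x. indicator ?B u * ennreal \<bar>f (affd d x r u) - f x\<bar> \<partial>?L) \<partial>?L)"
      by (rule Fubini'[symmetric]) measurable
    also have "\<dots> \<le> (\<integral>\<^sup>+ u. ennreal e * indicator ?B u \<partial>?L)"
    proof (intro nn_integral_mono)
      fix u assume "u \<in> space ?L"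
      show "(\<integral>\<^sup>+ x. indicator ?B u * ennreal \<bar>f (affd d x r u) - f x\<bar> \<partial>?L) \<le> ennreal e * indicator ?B u"
      proof (cases "u \<in> ?B")
        case True
        \<comment> \<open>The point \<open>x + r u\<close> is read as a translation of
          \<open>x\<close> by \<open>r u\<close>, whose coordinates are bounded by
          \<open>r \<le> \<delta>\<close>.\<close>
        have eq: "affd d x r u = affd d (\<lambda>k. r * u k) 1 x" for x by (auto simp: affd_def)
        have "\<bar>r * u k\<bar> \<le> \<delta>" if "k < d" for k
        proof -
          have "\<bar>u k\<bar> \<le> 1"
            using True abs_component_le_eucl_dist[OF that, of "\<lambda>_. 0" u] by (auto simp: dball_def)
          then have "r * \<bar>u k\<bar> \<le> r * 1" using r by (intro mult_left_mono) auto
          then have "r * \<bar>u k\<bar> \<le> \<delta>" using r by linarith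
          then show ?thesis using r by (simp add: abs_mult)
        qed
        then show ?thesis using True by (simp add: eq \<delta>(2))
      qed simp
    qed
    also have "\<dots> = ennreal e * ennreal (unit_vol d)"
      using emeasure_dball[of 1 d "\<lambda>_. 0"] by (simp add: nn_integral_cmult_indicator)
    finally show "(\<integral>\<^sup>+ x. local_osc d f r x \<partial>?L) \<le> ennreal (r ^ d * unit_vol d * e)"
      using r e unit_vol_pos[of d] by (simp add: ennreal_mult mult_left_mono mult.assoc mult.commute[of "unit_vol d"])
  qed
qed

section \<open>Concentration of block frequencies\<close>

text \<open>The first entry of each block is the centre of a star and the next \<open>k\<close>
  entries are its leaves. An incomplete last block is dropped, and a list without a complete block
  gives \<open>0\<close>.\<close>

definition block_freq :: "(nat \<Rightarrow> nat \<Rightarrow> bool) \<Rightarrow> nat list \<Rightarrow> nat \<Rightarrow> real" where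
  "block_freq a xs k =
     (\<Sum>b<length xs div (k+1). of_bool (\<forall>l\<in>{1..k}. a (xs ! (b*(k+1))) (xs ! (b*(k+1)+l))))
       / real (length xs div (k+1))"

text \<open>The view from a fixed centre, stripped of geometry: \<open>B\<close> stands for the ball
  around it, \<open>R\<close> for adjacency and \<open>N\<close> for the remaining vertices.\<close>

locale local_sample = prob_space M for M :: "'a measure" +
  fixes B :: "'a set" and R :: "'a \<Rightarrow> 'a \<Rightarrow> bool" and N :: "nat set"
  assumes B_sets [measurable]: "B \<in> sets M"
    and R_meas: "Measurable.pred (M \<Otimes>\<^sub>M M) (\<lambda>p. R (fst p) (snd p))"
    and finite_N: "finite N"
    and B_pos: "0 < measure M B"
begin

abbreviation Q :: "(nat \<Rightarrow> 'a) measure" where "Q \<equiv> PiM N (\<lambda>_. M)"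

definition nbrs :: "(nat \<Rightarrow> 'a) \<Rightarrow> nat set" where "nbrs y = {i\<in>N. y i \<in> B}"

text \<open>The conditional probability, given that \<open>k + 1\<close> independent points all fall
  into \<open>B\<close>, that the first is related to the \<open>k\<close> others.\<close>

definition star_prob :: "nat \<Rightarrow> real" where
  "star_prob k = (\<integral> x. indicator B x * measure M {z\<in>B. R x z} ^ k \<partial>M) / measure M B ^ (k+1)"

sublocale P: product_prob_space "\<lambda>_::nat. M"
  by unfold_locales

lemma prob_space_PiM_M: "prob_space (PiM I (\<lambda>_::nat. M))"
  by (rule prob_space_PiM) unfold_locales

lemma pred_R [measurable (raw)]:
  assumes "f \<in> measurable K M" "g \<in> measurable K M"
  shows "Measurable.pred K (\<lambda>x. R (f x) (g x))"
  using measurable_compose[OF measurable_Pair[OF assms] R_meas] by simp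

lemma B_sub: "B \<subseteq> space M"
  using B_sets by (rule sets.sets_into_space)

lemma measurable_slice [measurable]: "(\<lambda>x. measure M {z\<in>B. R x z}) \<in> borel_measurable M"
proof -
  let ?W = "{p \<in> space (M \<Otimes>\<^sub>M M). snd p \<in> B \<and> R (fst p) (snd p)}"
  have W: "?W \<in> sets (M \<Otimes>\<^sub>M M)" by measurable
  have "(\<lambda>x. measure M (Pair x -` ?W)) \<in> borel_measurable M"
    using measurable_emeasure_Pair[OF W] unfolding measure_def by measurable
  also have "?this \<longleftrightarrow> ?thesis"
    using B_sub by (intro measurable_cong arg_cong[where f="measure M"]) (auto simp: space_pair_measure)
  finally show ?thesis .
qed

lemma slice_sets: "x \<in> space M \<Longrightarrow> {z\<in>B. R x z} \<in> sets M"
proof -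
  assume x: "x \<in> space M"
  have "{z\<in>space M. z \<in> B \<and> R x z} \<in> sets M" using x by measurable
  also have "{z\<in>space M. z \<in> B \<and> R x z} = {z\<in>B. R x z}" using B_sub by auto
  finally show ?thesis .
qed

lemma star_prob_bounds: "0 \<le> star_prob k" "star_prob k \<le> 1"
proof -
  show "0 \<le> star_prob k"
    unfolding star_prob_def by (intro divide_nonneg_nonneg integral_nonneg) auto
  have "(\<integral> x. indicator B x * measure M {z\<in>B. R x z} ^ k \<partial>M) \<le> (\<integral> x. indicator B x * measure M B ^ k \<partial>M)"
  proof (rule integral_mono)
    show "integrable M (\<lambda>x. indicator B x * measure M {z\<in>B. R x z} ^ k)"
      by (rule integrable_const_bound[where B=1])
         (auto intro!: AE_I2 power_le_one split: split_indicator)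
    show "integrable M (\<lambda>x. indicator B x * measure M B ^ k)"
      by (intro integrable_mult_left) (auto simp: less_top[symmetric])
    show "indicator B x * measure M {z\<in>B. R x z} ^ k \<le> indicator B x * measure M B ^ k" for x
      by (intro mult_left_mono power_mono finite_measure_mono) auto
  qed
  also have "\<dots> = measure M B ^ (k + 1)"
    using B_sub by (simp add: Int_absorb2)
  finally show "star_prob k \<le> 1"
    unfolding star_prob_def using B_pos by (simp add: divide_le_eq)
qed

text \<open>For a fixed centre the leaves are independent, so integrating them out leaves the
  \<open>k\<close>-th power of the slice measure minus \<open>star_prob k * measure M B ^ k\<close>.
  Integrating the centre over \<open>B\<close> then gives zero by the choice of
  \<open>star_prob\<close>.\<close>

lemma integral_block_zero:
  fixes c :: nat
  assumes J: "finite J" "c \<notin> J" "card J = k"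
  shows "(\<integral> z. (\<Prod>j\<in>insert c J. indicator B (z j)) * (of_bool (\<forall>j\<in>J. R (z c) (z j)) - star_prob k)
     \<partial>PiM (insert c J) (\<lambda>_. M)) = 0"
proof -
  let ?q = "star_prob k" and ?P = "PiM (insert c J) (\<lambda>_. M)"
  let ?f = "\<lambda>z. (\<Prod>j\<in>insert c J. indicator B (z j)) * (of_bool (\<forall>j\<in>J. R (z c) (z j)) - ?q) :: real"
  interpret PJ: prob_space ?P by (rule prob_space_PiM_M)
  have mf: "?f \<in> borel_measurable ?P" using J(1) by measurable
  have "integrable ?P ?f"
    using mf star_prob_bounds[of k] by (intro PJ.integrable_const_bound[where B=1])
       (auto intro!: AE_I2 prod_le_1 mult_le_one simp: abs_mult abs_prod of_bool_def)
  then have "(\<integral> z. ?f z \<partial>PiM ({c} \<union> J) (\<lambda>_. M))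
     = (\<integral> x. (\<integral> y. ?f (merge {c} J (x, y)) \<partial>PiM J (\<lambda>_. M)) \<partial>PiM {c} (\<lambda>_. M))"
    using J by (intro P.product_integral_fold) auto
  also have "\<dots> = (\<integral> x. indicator B (x c) * (measure M {z\<in>B. R (x c) z} ^ k - ?q * measure M B ^ k) \<partial>PiM {c} (\<lambda>_. M))"
  proof (rule Bochner_Integration.integral_cong[OF refl])
    fix x assume "x \<in> space (PiM {c} (\<lambda>_. M))"
    then have xc: "x c \<in> space M" by (auto simp: space_PiM)
    have S: "{z\<in>B. R (x c) z} \<in> sets M" by (rule slice_sets[OF xc])
    have "?f (merge {c} J (x, y)) = indicator B (x c) *
        ((\<Prod>j\<in>J. indicator {z\<in>B. R (x c) z} (y j)) - ?q * (\<Prod>j\<in>J. indicator B (y j)))" for y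
    proof -
      have "(\<Prod>j\<in>J. indicator B (merge {c} J (x, y) j)) = (\<Prod>j\<in>J. indicator B (y j) :: real)"
        using J(2) by (intro prod.cong) (auto simp: merge_def)
      moreover have "(\<forall>j\<in>J. R (merge {c} J (x, y) c) (merge {c} J (x, y) j)) \<longleftrightarrow> (\<forall>j\<in>J. R (x c) (y j))"
        using J(2) by (auto simp: merge_def)
      moreover have "(\<Prod>j\<in>J. indicator {z\<in>B. R (x c) z} (y j)) = (\<Prod>j\<in>J. indicator B (y j)) * (of_bool (\<forall>j\<in>J. R (x c) (y j)) :: real)"
        using J(1)
      proof (induction J)
        case (insert j J)
        then show ?case by (auto simp: indicator_def)
      qed simp
      ultimately show ?thesis
        using J by (simp add: merge_def right_diff_distrib ac_simps)
    qed
    then have "(\<integral> y. ?f (merge {c} J (x, y)) \<partial>PiM J (\<lambda>_. M))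
       = indicator B (x c) * (\<integral> y. (\<Prod>j\<in>J. indicator {z\<in>B. R (x c) z} (y j)) - ?q * (\<Prod>j\<in>J. indicator B (y j)) \<partial>PiM J (\<lambda>_. M))"
      by simp
    also have "(\<integral> y. (\<Prod>j\<in>J. indicator {z\<in>B. R (x c) z} (y j)) - ?q * (\<Prod>j\<in>J. indicator B (y j)) \<partial>PiM J (\<lambda>_. M))
      = (\<integral> y. (\<Prod>j\<in>J. indicator {z\<in>B. R (x c) z} (y j)) \<partial>PiM J (\<lambda>_. M)) - (\<integral> y. ?q * (\<Prod>j\<in>J. indicator B (y j)) \<partial>PiM J (\<lambda>_. M))"
      using S J(1)
      by (intro Bochner_Integration.integral_diff integrable_mult_right P.product_integrable_prod)
         (auto simp: less_top[symmetric])
    also have "(\<integral> y. (\<Prod>j\<in>J. indicator {z\<in>B. R (x c) z} (y j)) \<partial>PiM J (\<lambda>_. M)) = measure M {z\<in>B. R (x c) z} ^ k"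
      using S J sets.sets_into_space[OF S] by (subst P.product_integral_prod) (auto simp: less_top[symmetric] Int_absorb2)
    also have "(\<integral> y. ?q * (\<Prod>j\<in>J. indicator B (y j)) \<partial>PiM J (\<lambda>_. M)) = ?q * measure M B ^ k"
      using J B_sub by (simp, subst P.product_integral_prod) (auto simp: less_top[symmetric] Int_absorb2)
    finally show "(\<integral> y. ?f (merge {c} J (x, y)) \<partial>PiM J (\<lambda>_. M))
      = indicator B (x c) * (measure M {z\<in>B. R (x c) z} ^ k - ?q * measure M B ^ k)" .
  qed
  also have "\<dots> = (\<integral> x. indicator B x * (measure M {z\<in>B. R x z} ^ k - ?q * measure M B ^ k) \<partial>M)"
    by (rule P.product_integral_singleton) measurable
  also have "\<dots> = (\<integral> x. indicator B x * measure M {z\<in>B. R x z} ^ k - indicator B x * (?q * measure M B ^ k) \<partial>M)"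
    by (simp add: right_diff_distrib)
  also have "\<dots> = (\<integral> x. indicator B x * measure M {z\<in>B. R x z} ^ k \<partial>M) - (\<integral> x. indicator B x * (?q * measure M B ^ k) \<partial>M)"
  proof (rule Bochner_Integration.integral_diff)
    show "integrable M (\<lambda>x. indicator B x * measure M {z\<in>B. R x z} ^ k)"
      by (rule integrable_const_bound[where B=1])
         (auto intro!: AE_I2 power_le_one split: split_indicator)
    show "integrable M (\<lambda>x. indicator B x * (?q * measure M B ^ k))"
      by (intro integrable_mult_left) (auto simp: less_top[symmetric])
  qed
  also have "(\<integral> x. indicator B x * (?q * measure M B ^ k) \<partial>M) = ?q * measure M B ^ (k + 1)"
    using B_sub by (simp add: Int_absorb2)
  also have "(\<integral> x. indicator B x * measure M {z\<in>B. R x z} ^ k \<partial>M) = ?q * measure M B ^ (k + 1)"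
    unfolding star_prob_def using B_pos by simp
  finally show ?thesis by simp
qed

section \<open>Second moments of block sums on a fixed neighbour set\<close>

lemma measurable_nbrs_eq [measurable]: "Measurable.pred Q (\<lambda>y. nbrs y = A)"
proof -
  have "(nbrs y = A) \<longleftrightarrow> A \<subseteq> N \<and> (\<forall>i\<in>N. (y i \<in> B) = (i \<in> A))" for y
    by (auto simp: nbrs_def)
  then show ?thesis using finite_N by simp
qed

lemma measurable_star:
  assumes "finite J" "insert c J \<subseteq> I"
  shows "Measurable.pred (PiM I (\<lambda>_. M)) (\<lambda>y. \<forall>j\<in>J. R (y c) (y j))"
proof -
  have [measurable]: "j \<in> I" if "j \<in> insert c J" for j using that assms by auto
  show ?thesis
    using assms by (intro pred_intros_finite pred_R measurable_component_singleton) auto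
qed

text \<open>The event \<open>nbrs y = A\<close> is a product of conditions on single coordinates.
  Freezing all coordinates outside the first block therefore leaves a constant times the integral of
  one centred block, which vanishes.\<close>

lemma integral_cross_zero:
  assumes A: "A \<subseteq> N"
    and J: "c \<notin> J" "card J = k" "insert c J \<subseteq> A"
    and J': "insert c' J' \<subseteq> A" "insert c J \<inter> insert c' J' = {}"
  shows "(\<integral> y. of_bool (nbrs y = A) * ((of_bool (\<forall>j\<in>J. R (y c) (y j)) - star_prob k) *
     (of_bool (\<forall>j\<in>J'. R (y c') (y j)) - star_prob k)) \<partial>Q) = 0"
proof -
  let ?q = "star_prob k" and ?K = "insert c J"
  let ?g = "\<lambda>y. of_bool (\<forall>j\<in>J. R (y c) (y j)) - ?q" and ?g' = "\<lambda>y. of_bool (\<forall>j\<in>J'. R (y c') (y j)) - ?q"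
  let ?f = "\<lambda>y. of_bool (nbrs y = A) * (?g y * ?g' y) :: real"
  have fin: "finite A" "finite J" "finite J'"
    using A J J' finite_N by (auto intro: finite_subset)
  interpret Q: prob_space Q by (rule prob_space_PiM_M)
  have [measurable]: "Measurable.pred Q (\<lambda>y. \<forall>j\<in>J. R (y c) (y j))" "Measurable.pred Q (\<lambda>y. \<forall>j\<in>J'. R (y c') (y j))"
    using A J J' fin by (auto intro!: measurable_star)
  have int: "integrable Q ?f"
    using star_prob_bounds[of k] by (intro Q.integrable_const_bound[where B=1])
       (auto intro!: AE_I2 mult_le_one simp: abs_mult of_bool_def)
  have NU: "N = (N - ?K) \<union> ?K" using A J by auto
  have "(\<integral> y. ?f y \<partial>Q) = (\<integral> y. ?f y \<partial>PiM ((N - ?K) \<union> ?K) (\<lambda>_. M))"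
    using NU by simp
  also have "\<dots> = (\<integral> x. (\<integral> z. ?f (merge (N - ?K) ?K (x, z)) \<partial>PiM ?K (\<lambda>_. M)) \<partial>PiM (N - ?K) (\<lambda>_. M))"
    using fin finite_N NU int by (intro P.product_integral_fold) auto
  also have "\<dots> = (\<integral> x. 0 \<partial>PiM (N - ?K) (\<lambda>_. M))"
  proof (rule Bochner_Integration.integral_cong[OF refl])
    fix x assume "x \<in> space (PiM (N - ?K) (\<lambda>_. M))"
    \<comment> \<open>\<open>?C\<close> collects what does not involve the block \<open>?K\<close>:
      the membership pattern outside it and the factor of the second block, which is disjoint from
      it.\<close>
    let ?C = "of_bool (\<forall>i\<in>N - ?K. (x i \<in> B) = (i \<in> A)) * ?g' x :: real"
    have "?f (merge (N - ?K) ?K (x, z)) = ?C * ((\<Prod>j\<in>?K. indicator B (z j)) * ?g z)" for z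
    proof -
      let ?m = "merge (N - ?K) ?K (x, z)"
      have mK: "?m j = z j" if "j \<in> ?K" for j using that by (auto simp: merge_def)
      have mI: "?m j = x j" if "j \<in> N - ?K" for j using that by (auto simp: merge_def)
      have pr: "(\<Prod>j\<in>?K. indicator B (z j)) = (of_bool (\<forall>i\<in>?K. z i \<in> B) :: real)"
      proof (cases "\<forall>i\<in>?K. z i \<in> B")
        case True
        then have p: "(\<Prod>j\<in>?K. indicator B (z j) :: real) = 1" by (intro prod.neutral) auto
        have t: "of_bool (\<forall>i\<in>?K. z i \<in> B) = (1 :: real)" using True by simp
        show ?thesis by (rule trans[OF p t[symmetric]])
      next
        case False
        then obtain i where "i \<in> ?K" "z i \<notin> B" by blast
        then have "\<exists>j\<in>?K. (indicator B (z j) :: real) = 0" by (intro bexI[of _ i]) simp_all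
        then have "(\<Prod>j\<in>?K. indicator B (z j) :: real) = 0"
          using fin(2) by (intro prod_zero) auto
        then show ?thesis using False by simp
      qed
      have "nbrs ?m = A \<longleftrightarrow> (\<forall>i\<in>N. (?m i \<in> B) = (i \<in> A))"
        using A by (auto simp: nbrs_def)
      also have "\<dots> \<longleftrightarrow> (\<forall>i\<in>N - ?K. (?m i \<in> B) = (i \<in> A)) \<and> (\<forall>i\<in>?K. (?m i \<in> B) = (i \<in> A))"
        by (subst NU) (rule ball_Un)
      also have "\<dots> \<longleftrightarrow> (\<forall>i\<in>N - ?K. (x i \<in> B) = (i \<in> A)) \<and> (\<forall>i\<in>?K. z i \<in> B)"
        using J(3) by (simp only: mK mI cong: ball_cong) blast
      finally have "of_bool (nbrs ?m = A) = (of_bool (\<forall>i\<in>N - ?K. (x i \<in> B) = (i \<in> A)) * (\<Prod>j\<in>?K. indicator B (z j)) :: real)"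
        unfolding pr by simp
      moreover have "?g ?m = ?g z"
        by (simp add: mK)
      moreover have "?g' ?m = ?g' x"
      proof -
        have "insert c' J' \<subseteq> N - ?K" using A J' by auto
        then have "?m c' = x c'" "\<And>j. j \<in> J' \<Longrightarrow> ?m j = x j" by (auto intro!: mI)
        then show ?thesis by simp
      qed
      ultimately show ?thesis by (simp only: ac_simps)
    qed
    then have "(\<integral> z. ?f (merge (N - ?K) ?K (x, z)) \<partial>PiM ?K (\<lambda>_. M))
      = ?C * (\<integral> z. (\<Prod>j\<in>?K. indicator B (z j)) * ?g z \<partial>PiM ?K (\<lambda>_. M))"
      by (simp only: integral_mult_right_zero)
    also have "\<dots> = 0" using integral_block_zero[OF fin(2) J(1,2)] by simp
    finally show "(\<integral> z. ?f (merge (N - ?K) ?K (x, z)) \<partial>PiM ?K (\<lambda>_. M)) = 0" .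
  qed
  finally show ?thesis by simp
qed

text \<open>Expanding the square, the off-diagonal terms vanish because distinct blocks are
  disjoint, and each diagonal term is at most the probability of the event, since \<open>g\<close>
  is bounded by 1.\<close>

lemma second_moment_blocks:
  assumes A: "A \<subseteq> N" and fin: "finite I"
    and J: "\<And>b. b \<in> I \<Longrightarrow> c b \<notin> J b" "\<And>b. b \<in> I \<Longrightarrow> card (J b) = k"
      "\<And>b. b \<in> I \<Longrightarrow> insert (c b) (J b) \<subseteq> A"
    and disj: "\<And>b b'. b \<in> I \<Longrightarrow> b' \<in> I \<Longrightarrow> b \<noteq> b' \<Longrightarrow> insert (c b) (J b) \<inter> insert (c b') (J b') = {}"
  defines "g \<equiv> \<lambda>b y. of_bool (\<forall>j\<in>J b. R (y (c b)) (y j)) - star_prob k :: real"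
  shows "integrable Q (\<lambda>y. of_bool (nbrs y = A) * (\<Sum>b\<in>I. g b y)\<^sup>2)"
    and "(\<integral> y. of_bool (nbrs y = A) * (\<Sum>b\<in>I. g b y)\<^sup>2 \<partial>Q) \<le> real (card I) * measure Q {y\<in>space Q. nbrs y = A}"
proof -
  interpret Q: prob_space Q by (rule prob_space_PiM_M)
  have fJ: "finite (J b)" if "b \<in> I" for b
    using J(3)[OF that] A finite_N by (auto intro: finite_subset)
  have mst: "Measurable.pred Q (\<lambda>y. \<forall>j\<in>J b. R (y (c b)) (y j))" if "b \<in> I" for b
    using J(3)[OF that] A fJ[OF that] by (intro measurable_star) auto
  have mg: "g b \<in> borel_measurable Q" if "b \<in> I" for b
    unfolding g_def using mst[OF that] by measurable
  have g1: "\<bar>g b y\<bar> \<le> 1" for b y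
    using star_prob_bounds[of k] by (auto simp: g_def of_bool_def)
  have int: "integrable Q (\<lambda>y. of_bool (nbrs y = A) * (g b y * g b' y))" if "b \<in> I" "b' \<in> I" for b b'
    using mg[OF that(1)] mg[OF that(2)] g1[of b] g1[of b']
    by (intro Q.integrable_const_bound[where B=1])
       (auto intro!: AE_I2 mult_le_one simp: abs_mult)
  have eq: "of_bool (nbrs y = A) * (\<Sum>b\<in>I. g b y)\<^sup>2 = (\<Sum>b\<in>I. \<Sum>b'\<in>I. of_bool (nbrs y = A) * (g b y * g b' y))" for y
  proof -
    have "(\<Sum>b\<in>I. g b y)\<^sup>2 = (\<Sum>b\<in>I. \<Sum>b'\<in>I. g b y * g b' y)"
      unfolding power2_eq_square by (rule sum_product)
    then show ?thesis by (simp only: sum_distrib_left)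
  qed
  show "integrable Q (\<lambda>y. of_bool (nbrs y = A) * (\<Sum>b\<in>I. g b y)\<^sup>2)"
    unfolding eq by (intro Bochner_Integration.integrable_sum int)
  have "(\<integral> y. of_bool (nbrs y = A) * (\<Sum>b\<in>I. g b y)\<^sup>2 \<partial>Q)
      = (\<Sum>b\<in>I. \<Sum>b'\<in>I. \<integral> y. of_bool (nbrs y = A) * (g b y * g b' y) \<partial>Q)"
    unfolding eq by (simp add: Bochner_Integration.integral_sum Bochner_Integration.integrable_sum int)
  also have "\<dots> = (\<Sum>b\<in>I. \<integral> y. of_bool (nbrs y = A) * (g b y * g b y) \<partial>Q)"
  proof (rule sum.cong[OF refl])
    fix b assume b: "b \<in> I"
    have "(\<integral> y. of_bool (nbrs y = A) * (g b y * g b' y) \<partial>Q) = 0" if "b' \<in> I - {b}" for b'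
      unfolding g_def using that b A by (intro integral_cross_zero J disj) auto
    then show "(\<Sum>b'\<in>I. \<integral> y. of_bool (nbrs y = A) * (g b y * g b' y) \<partial>Q)
        = (\<integral> y. of_bool (nbrs y = A) * (g b y * g b y) \<partial>Q)"
      using b fin by (subst sum.remove[of I b]) auto
  qed
  also have "\<dots> \<le> (\<Sum>b\<in>I. measure Q {y\<in>space Q. nbrs y = A})"
  proof (rule sum_mono)
    fix b assume b: "b \<in> I"
    have "(\<integral> y. of_bool (nbrs y = A) * (g b y * g b y) \<partial>Q) \<le> (\<integral> y. indicator {y\<in>space Q. nbrs y = A} y \<partial>Q)"
    proof (rule integral_mono)
      show "integrable Q (\<lambda>y. of_bool (nbrs y = A) * (g b y * g b y))" by (rule int[OF b b])
      show "integrable Q (indicator {y\<in>space Q. nbrs y = A} :: _ \<Rightarrow> real)"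
        by (auto simp: less_top[symmetric])
      fix y assume "y \<in> space Q"
      have "\<bar>g b y * g b y\<bar> \<le> 1" unfolding abs_mult by (intro mult_le_one g1) auto
      then show "of_bool (nbrs y = A) * (g b y * g b y) \<le> indicator {y\<in>space Q. nbrs y = A} y"
        using \<open>y \<in> space Q\<close> by (auto simp: indicator_def)
    qed
    also have "\<dots> = measure Q {y\<in>space Q. nbrs y = A}"
      by (auto intro!: arg_cong[where f="measure Q"])
    finally show "(\<integral> y. of_bool (nbrs y = A) * (g b y * g b y) \<partial>Q) \<le> measure Q {y\<in>space Q. nbrs y = A}" .
  qed
  finally show "(\<integral> y. of_bool (nbrs y = A) * (\<Sum>b\<in>I. g b y)\<^sup>2 \<partial>Q) \<le> real (card I) * measure Q {y\<in>space Q. nbrs y = A}"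
    by simp
qed

section \<open>The number of neighbours\<close>

lemma integral_centered_pair:
  assumes ij: "i \<in> N" "j \<in> N" "i \<noteq> j"
  shows "(\<integral> y. (indicator B (y i) - measure M B) * (indicator B (y j) - measure M B) \<partial>Q) = 0"
proof -
  let ?h = "\<lambda>x. indicator B x - measure M B :: real"
  \<comment> \<open>The two centred indicators are padded with factors \<open>1\<close> to a product
    over all of \<open>N\<close>, so that the integral of a product of coordinate functions can be
    computed factor by factor.\<close>
  let ?F = "\<lambda>l x. if l = i \<or> l = j then ?h x else 1"
  have h: "integrable M ?h" "(\<integral> x. ?h x \<partial>M) = 0"
    using B_sub by (auto simp: less_top[symmetric] Int_absorb2 prob_space)
  have eq: "(\<Prod>l\<in>N. ?F l (y l)) = ?h (y i) * ?h (y j)" for y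
  proof -
    have "(\<Prod>l\<in>N. ?F l (y l)) = ?F i (y i) * (?F j (y j) * (\<Prod>l\<in>N - {i} - {j}. ?F l (y l)))"
      using ij finite_N by (subst prod.remove[of N i], simp, simp, subst prod.remove[of "N - {i}" j]) auto
    also have "(\<Prod>l\<in>N - {i} - {j}. ?F l (y l)) = 1" by (intro prod.neutral) auto
    finally show ?thesis by simp
  qed
  have "(\<integral> y. (\<Prod>l\<in>N. ?F l (y l)) \<partial>Q) = (\<Prod>l\<in>N. \<integral> x. ?F l x \<partial>M)"
  proof (rule P.product_integral_prod[OF finite_N])
    fix l
    show "integrable M (?F l)"
      by (cases "l = i \<or> l = j") (use h(1) in simp_all)
  qed
  also have "\<dots> = 0"
    using h(2) ij(1) by (intro prod_zero[OF finite_N] bexI[of _ i]) simp_all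
  finally show ?thesis unfolding eq .
qed

lemma integral_centered_square_le:
  assumes i: "i \<in> N"
  shows "(\<integral> y. (indicator B (y i) - measure M B) * (indicator B (y i) - measure M B) \<partial>Q) \<le> measure M B"
proof -
  let ?h = "\<lambda>x. (indicator B x - measure M B) * (indicator B x - measure M B) :: real"
  let ?F = "\<lambda>l x. if l = i then ?h x else 1"
  have hb: "?h x = indicator B x * (1 - 2 * measure M B) + measure M B * measure M B" for x
    by (simp add: indicator_def algebra_simps)
  have h: "integrable M ?h" "(\<integral> x. ?h x \<partial>M) = measure M B - measure M B * measure M B"
    unfolding hb using B_sub by (auto simp: less_top[symmetric] Int_absorb2 prob_space algebra_simps)
  have eq: "(\<Prod>l\<in>N. ?F l (y l)) = ?h (y i)" for y
  proof -
    have "(\<Prod>l\<in>N. ?F l (y l)) = ?F i (y i) * (\<Prod>l\<in>N - {i}. ?F l (y l))"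
      using i finite_N by (rule prod.remove[rotated])
    also have "(\<Prod>l\<in>N - {i}. ?F l (y l)) = 1" by (intro prod.neutral) auto
    finally show ?thesis by simp
  qed
  have "(\<integral> y. (\<Prod>l\<in>N. ?F l (y l)) \<partial>Q) = (\<Prod>l\<in>N. \<integral> x. ?F l x \<partial>M)"
  proof (rule P.product_integral_prod[OF finite_N])
    fix l
    show "integrable M (?F l)"
      by (cases "l = i") (use h(1) in simp_all)
  qed
  also have "\<dots> = (\<integral> x. ?F i x \<partial>M) * (\<Prod>l\<in>N - {i}. \<integral> x. ?F l x \<partial>M)"
    using i finite_N by (rule prod.remove[rotated])
  also have "(\<Prod>l\<in>N - {i}. \<integral> x. ?F l x \<partial>M) = 1" by (intro prod.neutral) (auto simp: prob_space)
  finally show ?thesis unfolding eq using h(2) by simp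
qed

text \<open>Chebyshev's inequality: the number of neighbours has mean \<open>K\<close> and variance
  at most \<open>K\<close>, and a deviation of \<open>K / 2\<close> gives
  \<open>K / (K / 2)\<^sup>2\<close>.\<close>

lemma few_nbrs_unlikely:
  assumes K: "K = real (card N) * measure M B" "0 < K"
  shows "measure Q {y\<in>space Q. real (card (nbrs y)) < K / 2} \<le> 4 / K"
proof -
  interpret Q: prob_space Q by (rule prob_space_PiM_M)
  let ?h = "\<lambda>i y. indicator B (y i) - measure M B :: real"
  let ?S = "\<lambda>y. \<Sum>i\<in>N. ?h i y"
  have mh [measurable]: "?h i \<in> borel_measurable Q" if "i \<in> N" for i
    using that by measurable
  have h1: "\<bar>?h i y\<bar> \<le> 1" for i y by (auto simp: indicator_def)
  have int: "integrable Q (\<lambda>y. ?h i y * ?h j y)" if "i \<in> N" "j \<in> N" for i j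
    using mh[OF that(1)] mh[OF that(2)] h1[of _ i] h1[of _ j]
    by (intro Q.integrable_const_bound[where B=1]) (auto intro!: AE_I2 mult_le_one simp: abs_mult)
  have eq: "(?S y)\<^sup>2 = (\<Sum>i\<in>N. \<Sum>j\<in>N. ?h i y * ?h j y)" for y
    unfolding power2_eq_square by (rule sum_product)
  have intS: "integrable Q (\<lambda>y. (?S y)\<^sup>2)"
    unfolding eq by (intro Bochner_Integration.integrable_sum int)
  have "(\<integral> y. (?S y)\<^sup>2 \<partial>Q) = (\<Sum>i\<in>N. \<Sum>j\<in>N. \<integral> y. ?h i y * ?h j y \<partial>Q)"
    unfolding eq by (simp add: Bochner_Integration.integral_sum Bochner_Integration.integrable_sum int)
  also have "\<dots> = (\<Sum>i\<in>N. \<integral> y. ?h i y * ?h i y \<partial>Q)"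
  proof (rule sum.cong[OF refl])
    fix i assume i: "i \<in> N"
    have "(\<Sum>j\<in>N - {i}. \<integral> y. ?h i y * ?h j y \<partial>Q) = 0"
      using i by (intro sum.neutral ballI integral_centered_pair) auto
    then show "(\<Sum>j\<in>N. \<integral> y. ?h i y * ?h j y \<partial>Q) = (\<integral> y. ?h i y * ?h i y \<partial>Q)"
      using i finite_N by (subst sum.remove[of N i]) auto
  qed
  also have "\<dots> \<le> (\<Sum>i\<in>N. measure M B)"
    by (intro sum_mono integral_centered_square_le)
  also have "\<dots> = K" by (simp add: K)
  finally have ES: "(\<integral> y. (?S y)\<^sup>2 \<partial>Q) \<le> K" .
  have "{y\<in>space Q. real (card (nbrs y)) < K / 2} \<subseteq> {y\<in>space Q. (?S y)\<^sup>2 \<ge> K\<^sup>2 / 4}"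
  proof safe
    fix y assume y: "y \<in> space Q" "real (card (nbrs y)) < K / 2"
    have "(\<Sum>i\<in>N. indicator B (y i) :: real) = real (card (nbrs y))"
      using finite_N by (simp add: nbrs_def indicator_def sum.If_cases Int_def)
    then have "?S y = real (card (nbrs y)) - K"
      by (simp add: sum_subtractf K)
    then have "K / 2 \<le> \<bar>?S y\<bar>" using y by linarith
    then have "(K / 2)\<^sup>2 \<le> \<bar>?S y\<bar>\<^sup>2" using K(2) by (intro power_mono) auto
    then show "(?S y)\<^sup>2 \<ge> K\<^sup>2 / 4" by (simp add: power_divide)
  qed
  then have "measure Q {y\<in>space Q. real (card (nbrs y)) < K / 2} \<le> measure Q {y\<in>space Q. (?S y)\<^sup>2 \<ge> K\<^sup>2 / 4}"
    using intS by (intro Q.finite_measure_mono) measurable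
  also have "\<dots> \<le> (\<integral> y. (?S y)\<^sup>2 \<partial>Q) / (K\<^sup>2 / 4)"
    using K(2) by (intro integral_Markov_inequality_measure[OF intS, of "{}"]) auto
  also have "\<dots> \<le> K / (K\<^sup>2 / 4)"
    using ES K(2) by (intro divide_right_mono) auto
  also have "\<dots> = 4 / K" using K(2) by (simp add: power2_eq_square)
  finally show ?thesis .
qed

section \<open>Deviation of the block frequency\<close>

lemma measurable_block_freq:
  assumes "set xs \<subseteq> N"
  shows "(\<lambda>y. block_freq (\<lambda>i j. R (y i) (y j)) xs k) \<in> borel_measurable Q"
proof -
  have "Measurable.pred Q (\<lambda>y. \<forall>l\<in>{1..k}. R (y (xs ! (b*(k+1)))) (y (xs ! (b*(k+1)+l))))"
    if b: "b < length xs div (k+1)" for b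
  proof -
    have mem: "xs ! (b*(k+1)+l) \<in> N" if "l \<le> k" for l
    proof -
      have "b*(k+1) + l < (b + 1) * (k+1)" using that by (simp add: algebra_simps)
      also have "\<dots> \<le> (length xs div (k+1)) * (k+1)" using b by (intro mult_right_mono) auto
      also have "\<dots> \<le> length xs" by (rule div_times_less_eq_dividend)
      finally show ?thesis using assms nth_mem by blast
    qed
    show ?thesis
      using mem mem[of 0] by (intro pred_intros_finite pred_R measurable_component_singleton) auto
  qed
  then show ?thesis
    unfolding block_freq_def
    by (intro borel_measurable_divide borel_measurable_sum borel_measurable_const) auto
qed

text \<open>Chebyshev's inequality confined to the event that the neighbour set is \<open>A\<close>.
  Nothing is conditioned; instead the probability of the event stays as a factor on the right, so
  that the bounds can be summed over \<open>A\<close>.\<close>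

lemma block_freq_on_nbrs:
  assumes e: "0 < e" and A: "A \<subseteq> N" "m * (k+1) \<le> card A" "1 \<le> m"
  shows "measure Q {y\<in>space Q. nbrs y = A \<and>
      \<bar>block_freq (\<lambda>i j. R (y i) (y j)) (sorted_list_of_set A) k - star_prob k\<bar> > e}
    \<le> measure Q {y\<in>space Q. nbrs y = A} / (e\<^sup>2 * real m)"
proof -
  interpret Q: prob_space Q by (rule prob_space_PiM_M)
  define xs where "xs = sorted_list_of_set A"
  define m' where "m' = length xs div (k+1)"
  define c where "c b = xs ! (b*(k+1))" for b
  define J where "J b = (\<lambda>l. xs ! (b*(k+1)+l)) ` {1..k}" for b
  define g where "g = (\<lambda>b y. of_bool (\<forall>j\<in>J b. R (y (c b)) (y j)) - star_prob k :: real)"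
  have fA: "finite A" using A finite_N by (auto intro: finite_subset)
  have xs: "distinct xs" "set xs = A" "length xs = card A"
    using fA by (auto simp: xs_def)
  have "m * (k+1) div (k+1) \<le> card A div (k+1)" using A(2) by (rule div_le_mono)
  moreover have "m * (k+1) div (k+1) = m" by (rule div_mult_self_is_m) simp
  ultimately have "m \<le> card A div (k+1)" by metis
  then have m': "m \<le> m'" by (simp add: m'_def xs)
  have idx: "b*(k+1)+l < length xs" if "b < m'" "l \<le> k" for b l
  proof -
    have "b*(k+1) + l < (b + 1) * (k+1)" using that by (simp add: algebra_simps)
    also have "\<dots> \<le> m' * (k+1)" using that by (intro mult_right_mono) auto
    also have "\<dots> \<le> length xs" unfolding m'_def by (rule div_times_less_eq_dividend)
    finally show ?thesis .
  qed
  have ins: "insert (c b) (J b) = (\<lambda>l. xs ! (b*(k+1)+l)) ` {..k}" for b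
  proof -
    have "{..k} = insert 0 {1..k}" by auto
    then show ?thesis by (simp add: c_def J_def)
  qed
  have inj: "l = l' \<and> b = b'"
    if "b < m'" "b' < m'" "l \<le> k" "l' \<le> k" "xs ! (b*(k+1)+l) = xs ! (b'*(k+1)+l')" for b b' l l'
  proof -
    have eq: "b*(k+1)+l = b'*(k+1)+l'"
      using that idx xs(1) by (simp add: nth_eq_iff_index_eq)
    have "(b*(k+1)+l) div (k+1) = b" "(b'*(k+1)+l') div (k+1) = b'"
      using that by (auto simp del: mult_Suc_right)
    then have "b = b'" using eq by metis
    then show ?thesis using eq by simp
  qed
  have J1: "c b \<notin> J b" if "b < m'" for b
  proof
    assume "c b \<in> J b"
    then obtain l where l: "l \<in> {1..k}" "xs ! (b*(k+1)) = xs ! (b*(k+1)+l)"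
      unfolding c_def J_def by blast
    then show False using inj[OF that that, of 0 l] by simp
  qed
  have J2: "card (J b) = k" if "b < m'" for b
    unfolding J_def using inj[OF that that] by (subst card_image) (auto simp: inj_on_def)
  have J3: "insert (c b) (J b) \<subseteq> A" if "b < m'" for b
    unfolding ins using idx[OF that] nth_mem[of _ xs] xs(2) by auto
  have disj: "insert (c b) (J b) \<inter> insert (c b') (J b') = {}" if "b < m'" "b' < m'" "b \<noteq> b'" for b b'
    unfolding ins using inj[OF that(1,2)] that(3) by auto
  have sm: "integrable Q (\<lambda>y. of_bool (nbrs y = A) * (\<Sum>b<m'. g b y)\<^sup>2)"
     "(\<integral> y. of_bool (nbrs y = A) * (\<Sum>b<m'. g b y)\<^sup>2 \<partial>Q) \<le> real m' * measure Q {y\<in>space Q. nbrs y = A}"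
    unfolding g_def
    using second_moment_blocks[OF A(1), of "{..<m'}" c J k] J1 J2 J3 disj by simp_all
  have mpos: "0 < real m'" using m' A(3) by simp
  have bf: "block_freq (\<lambda>i j. R (y i) (y j)) xs k - star_prob k = (\<Sum>b<m'. g b y) / real m'" for y
  proof -
    have 1: "(\<Sum>b<m'. g b y) = (\<Sum>b<m'. of_bool (\<forall>j\<in>J b. R (y (c b)) (y j))) - real m' * star_prob k"
      by (simp add: g_def sum_subtractf)
    have 2: "block_freq (\<lambda>i j. R (y i) (y j)) xs k = (\<Sum>b<m'. of_bool (\<forall>j\<in>J b. R (y (c b)) (y j))) / real m'"
    proof -
      have "(\<forall>j\<in>J b. p j) \<longleftrightarrow> (\<forall>l\<in>{1..k}. p (xs ! (b*(k+1)+l)))" for b p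
        unfolding J_def by blast
      then show ?thesis by (simp only: block_freq_def m'_def c_def)
    qed
    show ?thesis
      unfolding 1 2 diff_divide_distrib using mpos by simp
  qed
  let ?t = "e\<^sup>2 * (real m')\<^sup>2"
  have "{y\<in>space Q. nbrs y = A \<and> \<bar>block_freq (\<lambda>i j. R (y i) (y j)) xs k - star_prob k\<bar> > e}
     \<subseteq> {y\<in>space Q. of_bool (nbrs y = A) * (\<Sum>b<m'. g b y)\<^sup>2 \<ge> ?t}"
  proof safe
    fix y assume y: "\<bar>block_freq (\<lambda>i j. R (y i) (y j)) xs k - star_prob k\<bar> > e" "A = nbrs y"
    have "e \<le> \<bar>\<Sum>b<m'. g b y\<bar> / real m'" using y(1) by (simp add: bf)
    then have "e * real m' \<le> \<bar>\<Sum>b<m'. g b y\<bar>" using mpos by (simp add: field_simps)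
    then have "(e * real m')\<^sup>2 \<le> \<bar>\<Sum>b<m'. g b y\<bar>\<^sup>2" using e by (intro power_mono) auto
    then show "?t \<le> of_bool (nbrs y = nbrs y) * (\<Sum>b<m'. g b y)\<^sup>2"
      by (simp add: power_mult_distrib)
  qed
  then have "measure Q {y\<in>space Q. nbrs y = A \<and> \<bar>block_freq (\<lambda>i j. R (y i) (y j)) xs k - star_prob k\<bar> > e}
      \<le> measure Q {y\<in>space Q. of_bool (nbrs y = A) * (\<Sum>b<m'. g b y)\<^sup>2 \<ge> ?t}"
    by (rule Q.finite_measure_mono)
       (rule borel_measurable_le[OF borel_measurable_const borel_measurable_integrable[OF sm(1)]])
  also have "\<dots> \<le> (\<integral> y. of_bool (nbrs y = A) * (\<Sum>b<m'. g b y)\<^sup>2 \<partial>Q) / ?t"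
    using e mpos by (intro integral_Markov_inequality_measure[OF sm(1), of "{}"]) auto
  also have "\<dots> \<le> real m' * measure Q {y\<in>space Q. nbrs y = A} / ?t"
    using sm(2) by (intro divide_right_mono) auto
  also have "\<dots> = measure Q {y\<in>space Q. nbrs y = A} / (e\<^sup>2 * real m')"
    using mpos by (simp add: power2_eq_square)
  also have "\<dots> \<le> measure Q {y\<in>space Q. nbrs y = A} / (e\<^sup>2 * real m)"
    using m' A(3) e by (intro divide_left_mono mult_left_mono mult_pos_pos) auto
  finally show ?thesis unfolding xs_def .
qed

text \<open>Either there are fewer than \<open>K / 2\<close> neighbours, or the neighbour set is one
  of the sets with room for \<open>m\<close> full blocks. The events for different sets are
  disjoint, so their probabilities add up to at most 1 and the total bound does not grow with the
  number of sets.\<close>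

lemma block_freq_concentration:
  assumes e: "0 < e" and K: "K = real (card N) * measure M B" "0 < K"
    and m: "1 \<le> m" "real (m * (k+1)) \<le> K / 2"
  shows "{y\<in>space Q. \<bar>block_freq (\<lambda>i j. R (y i) (y j)) (sorted_list_of_set (nbrs y)) k - star_prob k\<bar> > e} \<in> sets Q"
      (is "?Bad \<in> _")
    and "measure Q {y\<in>space Q. \<bar>block_freq (\<lambda>i j. R (y i) (y j)) (sorted_list_of_set (nbrs y)) k - star_prob k\<bar> > e}
      \<le> 4 / K + 1 / (e\<^sup>2 * real m)"
proof -
  interpret Q: prob_space Q by (rule prob_space_PiM_M)
  let ?BA = "\<lambda>A. {y\<in>space Q. nbrs y = A \<and>
      \<bar>block_freq (\<lambda>i j. R (y i) (y j)) (sorted_list_of_set A) k - star_prob k\<bar> > e}"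
  let ?few = "{y\<in>space Q. real (card (nbrs y)) < K / 2}"
  define F where "F = {A. A \<subseteq> N \<and> m * (k+1) \<le> card A}"
  have fF: "finite F" unfolding F_def using finite_N by simp
  have nb: "nbrs y \<subseteq> N" for y by (auto simp: nbrs_def)
  have mBA: "?BA A \<in> sets Q" if "A \<subseteq> N" for A
  proof -
    have [measurable]: "(\<lambda>y. block_freq (\<lambda>i j. R (y i) (y j)) (sorted_list_of_set A) k) \<in> borel_measurable Q"
      using that finite_N by (intro measurable_block_freq) (simp add: finite_subset[OF that finite_N])
    show ?thesis by measurable
  qed
  have "?Bad = (\<Union>A\<in>Pow N. ?BA A)" using nb by auto
  then show mBad: "?Bad \<in> sets Q"
    using mBA finite_N by auto
  have "?few = (\<Union>A\<in>{A\<in>Pow N. real (card A) < K / 2}. {y\<in>space Q. nbrs y = A})" using nb by auto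
  then have mfew: "?few \<in> sets Q"
    using finite_N by auto
  have mU: "(\<Union>A\<in>F. ?BA A) \<in> sets Q"
    using fF by (rule sets.finite_UN) (intro mBA, simp add: F_def)
  have "?Bad \<subseteq> ?few \<union> (\<Union>A\<in>F. ?BA A)"
  proof
    fix y assume y: "y \<in> ?Bad"
    show "y \<in> ?few \<union> (\<Union>A\<in>F. ?BA A)"
    proof (cases "real (card (nbrs y)) < K / 2")
      case False
      then have "real (m * (k+1)) \<le> real (card (nbrs y))" using m(2) by linarith
      then have "m * (k+1) \<le> card (nbrs y)" by (simp only: of_nat_le_iff)
      then have "nbrs y \<in> F" using nb by (simp add: F_def)
      then show ?thesis using y by auto
    qed (use y in simp)
  qed
  then have "measure Q ?Bad \<le> measure Q (?few \<union> (\<Union>A\<in>F. ?BA A))"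
    using mfew mU by (intro Q.finite_measure_mono sets.Un)
  also have "\<dots> \<le> measure Q ?few + measure Q (\<Union>A\<in>F. ?BA A)"
    using mfew mU by (rule measure_Un_le)
  also have "measure Q ?few \<le> 4 / K" by (rule few_nbrs_unlikely[OF K])
  also have "measure Q (\<Union>A\<in>F. ?BA A) \<le> (\<Sum>A\<in>F. measure Q (?BA A))"
    using mBA fF by (intro Q.finite_measure_subadditive_finite) (auto simp: F_def)
  also have "\<dots> \<le> (\<Sum>A\<in>F. measure Q {y\<in>space Q. nbrs y = A} / (e\<^sup>2 * real m))"
    using e m(1) by (intro sum_mono block_freq_on_nbrs) (auto simp: F_def)
  also have "\<dots> = (\<Sum>A\<in>F. measure Q {y\<in>space Q. nbrs y = A}) / (e\<^sup>2 * real m)"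
    by (simp add: sum_divide_distrib)
  also have "(\<Sum>A\<in>F. measure Q {y\<in>space Q. nbrs y = A}) = measure Q (\<Union>A\<in>F. {y\<in>space Q. nbrs y = A})"
    using fF by (intro Q.finite_measure_finite_Union[symmetric]) (auto simp: disjoint_family_on_def)
  also have "measure Q (\<Union>A\<in>F. {y\<in>space Q. nbrs y = A}) / (e\<^sup>2 * real m) \<le> 1 / (e\<^sup>2 * real m)"
    by (intro divide_right_mono) auto
  finally show "measure Q ?Bad \<le> 4 / K + 1 / (e\<^sup>2 * real m)" by simp
qed

end

section \<open>Local uniformity of the density\<close>

abbreviation law :: "nat \<Rightarrow> ((nat \<Rightarrow> real) \<Rightarrow> real) \<Rightarrow> (nat \<Rightarrow> real) measure" where
  "law d f \<equiv> density (lebesgue_d d) (\<lambda>x. ennreal (f x))"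

lemma density_integrable:
  assumes "is_density d f"
  shows "integrable (lebesgue_d d) f"
  using assms by (auto simp: is_density_def integrable_iff_bounded)

lemma density_measurable: "is_density d f \<Longrightarrow> f \<in> borel_measurable (lebesgue_d d)"
  by (simp add: is_density_def)

lemma density_nonneg: "is_density d f \<Longrightarrow> 0 \<le> f x"
  by (simp add: is_density_def)

lemma prob_space_law: "is_density d f \<Longrightarrow> prob_space (law d f)"
  by (rule prob_spaceI) (simp add: is_density_def emeasure_density cong: nn_integral_cong)

lemma measure_law:
  assumes f: "is_density d f" and A: "A \<in> sets (lebesgue_d d)"
  shows "measure (law d f) A = (\<integral> x. indicator A x * f x \<partial>lebesgue_d d)"
proof -
  note [measurable] = density_measurable[OF f] A
  have "measure (law d f) A = (\<integral> x. indicator A x \<partial>law d f)"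
    using sets.sets_into_space[OF A] by (simp add: Int_absorb2)
  also have "\<dots> = (\<integral> x. f x *\<^sub>R indicator A x \<partial>lebesgue_d d)"
    by (rule integral_density) (auto simp: density_nonneg[OF f])
  finally show ?thesis by (simp add: mult.commute)
qed

lemma integrable_indicator_mult_density:
  assumes f: "is_density d f" and A: "A \<in> sets (lebesgue_d d)"
  shows "integrable (lebesgue_d d) (\<lambda>x. indicator A x * f x)"
  using integrable_mult_indicator[OF A density_integrable[OF f]] by simp

lemma local_sample_law:
  assumes f: "is_density d f" and N: "finite N" and pos: "0 < measure (law d f) (dball d x r)"
  shows "local_sample (law d f) (dball d x r) (\<lambda>y z. eucl_dist d y z \<le> r) N"
proof -
  interpret prob_space "law d f" by (rule prob_space_law[OF f])
  have [measurable]: "fst \<in> measurable (law d f \<Otimes>\<^sub>M law d f) (lebesgue_d d)"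
    "snd \<in> measurable (law d f \<Otimes>\<^sub>M law d f) (lebesgue_d d)"
    using measurable_fst[of "law d f" "law d f"] measurable_snd[of "law d f" "law d f"]
    by (simp_all add: measurable_cong_sets[OF refl sets_density])
  show ?thesis
    by unfold_locales (use N pos in \<open>auto\<close>)
qed

text \<open>The substitution \<open>y = x + r u\<close> carries the ball \<open>B(x, r)\<close> to
  the unit ball and turns \<open>b\<close> into the lens function. This scale invariance is why the
  estimator can do without the radius.\<close>

lemma lens_moment_eq_local:
  fixes d :: nat and x :: "nat \<Rightarrow> real"
  assumes r: "0 < r"
  defines "b \<equiv> \<lambda>y. measure (lebesgue_d d) (dball d x r \<inter> dball d y r) / (r ^ d * unit_vol d)"
  shows "(\<integral> y. indicator (dball d x r) y * b y ^ k \<partial>lebesgue_d d) = r ^ d * unit_vol d * lens_moment d k"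
proof -
  let ?L = "lebesgue_d d"
  have [measurable]: "b \<in> borel_measurable ?L"
    unfolding b_def
    using measurable_measure_Int_dball[OF sigma_finite_lebesgue_d refl sets_dball, of d x r r]
    by (intro borel_measurable_divide borel_measurable_const)
  have b: "b (affd d x r u) = lens d u" for u
  proof -
    have "measure ?L (dball d x r \<inter> dball d (affd d x r u) r)
       = r ^ d * measure ?L {v \<in> space ?L. affd d x r v \<in> dball d x r \<inter> dball d (affd d x r u) r}"
      by (rule measure_affd[OF r]) auto
    also have "{v \<in> space ?L. affd d x r v \<in> dball d x r \<inter> dball d (affd d x r u) r}
        = dball d (\<lambda>_. 0) 1 \<inter> dball d u 1"
      using affd_in_dball_iff[OF r, of _ d x] affd_in_dball_affd_iff[OF r, of _ d x u]
      by (auto simp: dball_def)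
    finally show ?thesis
      using r by (simp add: b_def lens_def)
  qed
  have "(\<integral> y. indicator (dball d x r) y * b y ^ k \<partial>?L)
     = r ^ d * (\<integral> u. indicator (dball d x r) (affd d x r u) * b (affd d x r u) ^ k \<partial>?L)"
    by (rule integral_affd[OF r]) measurable
  also have "(\<integral> u. indicator (dball d x r) (affd d x r u) * b (affd d x r u) ^ k \<partial>?L)
     = (\<integral> u. indicator (dball d (\<lambda>_. 0) 1) u * lens d u ^ k \<partial>?L)"
    using affd_in_dball_iff[OF r] by (intro Bochner_Integration.integral_cong) (auto simp: b indicator_def)
  also have "\<dots> = unit_vol d * lens_moment d k"
    using unit_vol_pos[of d] by (simp add: lens_moment_def)
  finally show ?thesis by simp
qed

text \<open>Both quantities average the \<open>k\<close>-th power of an overlap fraction over the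
  ball, one with respect to the normalised law and one with respect to the uniform distribution. If
  \<open>W\<close> is the mean distance of the two densities, the change of the averaging measure
  costs \<open>W\<close> and the change of the overlap fraction costs \<open>k * W\<close>.\<close>

lemma star_prob_close:
  assumes f: "is_density d f" and r: "0 < r" and x: "\<delta>' < f x" "0 < \<delta>'"
    and osc: "local_osc d f r x \<le> ennreal (r ^ d * unit_vol d * \<delta>')"
  defines "\<mu> \<equiv> measure (law d f) (dball d x r)"
  shows "r ^ d * unit_vol d * (f x - \<delta>') \<le> \<mu>"
    and "\<bar>local_sample.star_prob (law d f) (dball d x r) (\<lambda>y z. eucl_dist d y z \<le> r) k - lens_moment d k\<bar>
           \<le> 2 * real (k + 1) * \<delta>' / (f x - \<delta>')"
proof -
  let ?L = "lebesgue_d d" and ?B = "dball d x r"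
  define \<beta> where "\<beta> = r ^ d * unit_vol d"
  have \<beta>: "0 < \<beta>" using r unit_vol_pos[of d] by (simp add: \<beta>_def)
  note [measurable] = density_measurable[OF f]
  note fint = density_integrable[OF f]
  have vol: "measure ?L ?B = \<beta>" using measure_dball[OF r, of d x] by (simp add: \<beta>_def)
  have iB: "integrable ?L (\<lambda>y. indicator ?B y :: real)" by (rule integrable_indicator_dball[OF r])
  have IB: "(\<integral> y. indicator ?B y \<partial>?L) = \<beta>"
    using integral_indicator_dball[OF r] by (simp add: \<beta>_def)
  have iBf: "integrable ?L (\<lambda>y. indicator ?B y * f y)"
    by (rule integrable_indicator_mult_density[OF f]) simp
  have iOsc: "integrable ?L (\<lambda>y. indicator ?B y * \<bar>f y - f x\<bar>)"
  proof -
    have "integrable ?L (\<lambda>y. \<bar>indicator ?B y * f y - indicator ?B y * f x\<bar>)"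
      using iBf iB by (intro integrable_abs Bochner_Integration.integrable_diff integrable_mult_left)
    then show ?thesis by (simp add: abs_mult left_diff_distrib[symmetric] right_diff_distrib[symmetric])
  qed
  define Osc where "Osc = (\<integral> y. indicator ?B y * \<bar>f y - f x\<bar> \<partial>?L)"
  have "ennreal Osc = (\<integral>\<^sup>+ y. ennreal (indicator ?B y * \<bar>f y - f x\<bar>) \<partial>?L)"
    unfolding Osc_def by (rule nn_integral_eq_integral[OF iOsc, symmetric]) simp
  also have "\<dots> = local_osc d f r x"
    unfolding local_osc_def by (intro nn_integral_cong) (auto simp: indicator_def)
  also have "\<dots> \<le> ennreal (\<beta> * \<delta>')" using osc by (simp add: \<beta>_def)
  finally have Osc: "Osc \<le> \<beta> * \<delta>'"
    using \<beta> x by (subst (asm) ennreal_le_iff) auto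
  have \<mu>: "\<mu> = (\<integral> y. indicator ?B y * f y \<partial>?L)"
    unfolding \<mu>_def by (rule measure_law[OF f]) simp
  have "\<mu> - \<beta> * f x = (\<integral> y. indicator ?B y * f y - indicator ?B y * f x \<partial>?L)"
    using iBf iB IB by (simp add: \<mu>)
  also have "\<bar>\<dots>\<bar> \<le> (\<integral> y. \<bar>indicator ?B y * f y - indicator ?B y * f x\<bar> \<partial>?L)"
    by (rule integral_abs_bound)
  also have "\<dots> = Osc"
    unfolding Osc_def by (intro Bochner_Integration.integral_cong) (auto simp: indicator_def)
  finally have \<mu>Osc: "\<bar>\<mu> - \<beta> * f x\<bar> \<le> Osc" .
  show \<mu>lo: "r ^ d * unit_vol d * (f x - \<delta>') \<le> \<mu>"
    using \<mu>Osc Osc by (simp add: \<beta>_def[symmetric] right_diff_distrib)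
  then have \<mu>lo': "\<beta> * (f x - \<delta>') \<le> \<mu>" by (simp add: \<beta>_def)
  moreover have "0 < \<beta> * (f x - \<delta>')" using \<beta> x by simp
  ultimately have \<mu>pos: "0 < \<mu>" by linarith
  interpret S: local_sample "law d f" ?B "\<lambda>y z. eucl_dist d y z \<le> r" "{}"
    by (rule local_sample_law[OF f]) (use \<mu>pos in \<open>simp_all add: \<mu>_def\<close>)

  \<comment> \<open>The difference between the density of the law conditioned on the ball and the
    uniform density there.\<close>
  define w where "w y = f y / \<mu> - 1 / \<beta>" for y
  have iw: "integrable ?L (\<lambda>y. indicator ?B y * \<bar>w y\<bar>)"
  proof -
    have "integrable ?L (\<lambda>y. \<bar>indicator ?B y * f y / \<mu> - indicator ?B y * (1 / \<beta>)\<bar>)"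
      using iBf iB by (intro integrable_abs Bochner_Integration.integrable_diff integrable_mult_left integrable_divide)
    also have "(\<lambda>y. \<bar>indicator ?B y * f y / \<mu> - indicator ?B y * (1 / \<beta>)\<bar>) = (\<lambda>y. indicator ?B y * \<bar>w y\<bar>)"
      by (auto simp: fun_eq_iff w_def indicator_def)
    finally show ?thesis .
  qed
  define W where "W = (\<integral> y. indicator ?B y * \<bar>w y\<bar> \<partial>?L)"
  \<comment> \<open>The value \<open>f x / \<mu>\<close> is inserted between the two densities.
    \<open>Osc\<close> bounds both the oscillation of \<open>f\<close> and the distance between
    \<open>\<mu>\<close> and \<open>\<beta> * f x\<close>, hence the factor 2.\<close>
  have "W \<le> (\<integral> y. indicator ?B y * \<bar>f y - f x\<bar> / \<mu> + indicator ?B y * \<bar>f x / \<mu> - 1 / \<beta>\<bar> \<partial>?L)"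
    unfolding W_def
  proof (rule integral_mono[OF iw])
    show "integrable ?L (\<lambda>y. indicator ?B y * \<bar>f y - f x\<bar> / \<mu> + indicator ?B y * \<bar>f x / \<mu> - 1 / \<beta>\<bar>)"
      using iOsc iB by (intro Bochner_Integration.integrable_add integrable_mult_left integrable_divide)
    fix y
    have "w y = (f y - f x) / \<mu> + (f x / \<mu> - 1 / \<beta>)" by (simp add: w_def diff_divide_distrib)
    then have "\<bar>w y\<bar> \<le> \<bar>(f y - f x) / \<mu>\<bar> + \<bar>f x / \<mu> - 1 / \<beta>\<bar>" by (simp only: abs_triangle_ineq)
    then show "indicator ?B y * \<bar>w y\<bar> \<le> indicator ?B y * \<bar>f y - f x\<bar> / \<mu> + indicator ?B y * \<bar>f x / \<mu> - 1 / \<beta>\<bar>"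
      using \<mu>pos by (auto simp: indicator_def)
  qed
  also have "\<dots> = Osc / \<mu> + \<beta> * \<bar>f x / \<mu> - 1 / \<beta>\<bar>"
    using iOsc iB IB by (simp add: Osc_def)
  also have "\<beta> * \<bar>f x / \<mu> - 1 / \<beta>\<bar> = \<bar>\<mu> - \<beta> * f x\<bar> / \<mu>"
  proof -
    have "\<beta> * (f x / \<mu> - 1 / \<beta>) = (\<beta> * f x - \<mu>) / \<mu>" using \<beta> \<mu>pos by (simp add: field_simps)
    then have "\<bar>\<beta> * (f x / \<mu> - 1 / \<beta>)\<bar> = \<bar>(\<beta> * f x - \<mu>) / \<mu>\<bar>" by (rule arg_cong)
    then show ?thesis using \<beta> \<mu>pos by (simp add: abs_mult abs_minus_commute)
  qed
  also have "Osc / \<mu> + \<bar>\<mu> - \<beta> * f x\<bar> / \<mu> \<le> 2 * Osc / \<mu>"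
    using \<mu>Osc \<mu>pos by (simp add: add_divide_distrib[symmetric] divide_right_mono)
  also have "\<dots> \<le> 2 * (\<beta> * \<delta>') / (\<beta> * (f x - \<delta>'))"
    using Osc \<mu>lo' \<beta> x by (intro frac_le) auto
  also have "\<dots> = 2 * \<delta>' / (f x - \<delta>')" using \<beta> by simp
  finally have W: "W \<le> 2 * \<delta>' / (f x - \<delta>')" .

  \<comment> \<open>The fractions of the ball covered by the ball around \<open>y\<close>, once by
    the law and once by volume. They differ by at most \<open>W\<close>, as an integral of
    \<open>w\<close> over a subset of the ball.\<close>
  define a where "a y = measure (law d f) (?B \<inter> dball d y r) / \<mu>" for y
  define b where "b y = measure ?L (?B \<inter> dball d y r) / \<beta>" for y
  have [measurable]: "a \<in> borel_measurable ?L"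
    unfolding a_def
    using measurable_measure_Int_dball[OF S.sigma_finite_measure_axioms _ sets_dball, of d x r r]
    by (intro borel_measurable_divide borel_measurable_const) simp
  have [measurable]: "b \<in> borel_measurable ?L"
    unfolding b_def
    using measurable_measure_Int_dball[OF sigma_finite_lebesgue_d refl sets_dball, of d x r r]
    by (intro borel_measurable_divide borel_measurable_const)
  have a01: "0 \<le> a y" "a y \<le> 1" for y
  proof -
    show "0 \<le> a y" using \<mu>pos by (simp add: a_def)
    have "measure (law d f) (?B \<inter> dball d y r) \<le> \<mu>"
      unfolding \<mu>_def by (rule S.finite_measure_mono) auto
    then show "a y \<le> 1" using \<mu>pos by (simp add: a_def)
  qed
  have b01: "0 \<le> b y" "b y \<le> 1" for y
  proof -
    show "0 \<le> b y" using \<beta> by (simp add: b_def)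
    have "measure ?L (?B \<inter> dball d y r) \<le> measure ?L ?B"
      by (rule measure_mono_fmeasurable) (auto intro!: fmeasurable_dball r)
    then show "b y \<le> 1" using \<beta> by (simp add: b_def vol)
  qed
  have ab: "\<bar>a y - b y\<bar> \<le> W" for y
  proof -
    let ?C = "?B \<inter> dball d y r"
    have iC: "integrable ?L (\<lambda>z. indicator ?C z * f z)"
      by (rule integrable_indicator_mult_density[OF f]) simp
    have iC1: "integrable ?L (indicator ?C :: _ \<Rightarrow> real)"
    proof (rule Bochner_Integration.integrable_bound[OF iB])
      show "AE z in ?L. norm (indicator ?C z :: real) \<le> norm (indicator ?B z :: real)"
        by (intro AE_I2) (auto simp: indicator_def)
    qed measurable
    have "?C \<subseteq> space ?L" by (auto simp: dball_def)
    then have b_eq: "b y = (\<integral> z. indicator ?C z / \<beta> \<partial>?L)"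
      by (simp add: b_def Int_absorb2)
    have a_eq: "a y = (\<integral> z. indicator ?C z * f z / \<mu> \<partial>?L)"
      by (simp add: a_def measure_law[OF f])
    have diff: "a y - b y = (\<integral> z. indicator ?C z * f z / \<mu> - indicator ?C z / \<beta> \<partial>?L)"
      unfolding a_eq b_eq
      by (rule Bochner_Integration.integral_diff[symmetric]) (intro integrable_divide iC iC1)+
    have "\<bar>a y - b y\<bar> \<le> (\<integral> z. \<bar>indicator ?C z * f z / \<mu> - indicator ?C z / \<beta>\<bar> \<partial>?L)"
      unfolding diff by (rule integral_abs_bound)
    also have "\<dots> \<le> W"
      unfolding W_def
    proof (rule integral_mono[OF _ iw])
      show "integrable ?L (\<lambda>z. \<bar>indicator ?C z * f z / \<mu> - indicator ?C z / \<beta>\<bar>)"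
        by (intro integrable_abs Bochner_Integration.integrable_diff integrable_divide iC iC1)
      show "\<bar>indicator ?C z * f z / \<mu> - indicator ?C z / \<beta>\<bar> \<le> indicator ?B z * \<bar>w z\<bar>" for z
        by (auto simp: indicator_def w_def)
    qed
    finally show ?thesis .
  qed

  have star: "S.star_prob k = (\<integral> y. indicator ?B y * a y ^ k * f y / \<mu> \<partial>?L)"
  proof -
    have seq: "{z \<in> ?B. eucl_dist d y z \<le> r} = ?B \<inter> dball d y r" for y
      by (auto simp: dball_def)
    have "(\<integral> y. indicator ?B y * measure (law d f) {z \<in> ?B. eucl_dist d y z \<le> r} ^ k \<partial>law d f)
       = (\<integral> y. indicator ?B y * (a y * \<mu>) ^ k \<partial>law d f)"
      using \<mu>pos by (simp add: seq a_def)
    also have "\<dots> = (\<integral> y. f y *\<^sub>R (indicator ?B y * (a y * \<mu>) ^ k) \<partial>?L)"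
      by (rule integral_density) (auto simp: density_nonneg[OF f])
    also have "\<dots> = (\<integral> y. \<mu> ^ (k+1) * (indicator ?B y * a y ^ k * f y / \<mu>) \<partial>?L)"
      using \<mu>pos by (intro Bochner_Integration.integral_cong) (auto simp: power_mult_distrib)
    also have "\<dots> = \<mu> ^ (k+1) * (\<integral> y. indicator ?B y * a y ^ k * f y / \<mu> \<partial>?L)"
      by (rule integral_mult_right_zero)
    finally show ?thesis
      unfolding S.star_prob_def using \<mu>pos by (simp add: \<mu>_def[symmetric])
  qed
  have lens: "lens_moment d k = (\<integral> y. indicator ?B y * b y ^ k / \<beta> \<partial>?L)"
    using lens_moment_eq_local[OF r, of d x k] \<beta> by (simp add: b_def \<beta>_def[symmetric])
  have i1: "integrable ?L (\<lambda>y. indicator ?B y * a y ^ k * f y / \<mu>)"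
  proof (intro integrable_divide, rule Bochner_Integration.integrable_bound[OF iBf])
    show "AE y in ?L. norm (indicator ?B y * a y ^ k * f y) \<le> norm (indicator ?B y * f y)"
      using a01 by (intro AE_I2) (auto simp: indicator_def abs_mult power_le_one mult_left_le_one_le)
  qed measurable
  have i2: "integrable ?L (\<lambda>y. indicator ?B y * b y ^ k / \<beta>)"
  proof (intro integrable_divide, rule Bochner_Integration.integrable_bound[OF iB])
    show "AE y in ?L. norm (indicator ?B y * b y ^ k) \<le> norm (indicator ?B y :: real)"
      using b01 by (intro AE_I2) (auto simp: indicator_def power_le_one)
  qed measurable
  have diff: "S.star_prob k - lens_moment d k = (\<integral> y. indicator ?B y * a y ^ k * f y / \<mu> - indicator ?B y * b y ^ k / \<beta> \<partial>?L)"
    unfolding star lens by (rule Bochner_Integration.integral_diff[symmetric, OF i1 i2])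
  have "\<bar>S.star_prob k - lens_moment d k\<bar> \<le> (\<integral> y. \<bar>indicator ?B y * a y ^ k * f y / \<mu> - indicator ?B y * b y ^ k / \<beta>\<bar> \<partial>?L)"
    unfolding diff by (rule integral_abs_bound)
  also have "\<dots> \<le> (\<integral> y. indicator ?B y * \<bar>w y\<bar> + indicator ?B y * (real k * W / \<beta>) \<partial>?L)"
  proof (rule integral_mono)
    show "integrable ?L (\<lambda>y. \<bar>indicator ?B y * a y ^ k * f y / \<mu> - indicator ?B y * b y ^ k / \<beta>\<bar>)"
      by (intro integrable_abs Bochner_Integration.integrable_diff i1 i2)
    show "integrable ?L (\<lambda>y. indicator ?B y * \<bar>w y\<bar> + indicator ?B y * (real k * W / \<beta>))"
      by (intro Bochner_Integration.integrable_add iw integrable_mult_left iB)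
    fix y
    \<comment> \<open>On [0, 1] the \<open>k\<close>-th power is Lipschitz with constant
      \<open>k\<close>. The other replacement, of the density, costs at most
      \<open>\<bar>w y\<bar>\<close> because \<open>a y ^ k \<le> 1\<close>.\<close>
    have "\<bar>a y ^ k - b y ^ k\<bar> \<le> real k * \<bar>a y - b y\<bar>"
      using norm_power_diff[of "a y" "b y" k] a01 b01 by simp
    also have "\<dots> \<le> real k * W" by (intro mult_left_mono ab) simp
    finally have 1: "\<bar>(a y ^ k - b y ^ k) / \<beta>\<bar> \<le> real k * W / \<beta>"
      using \<beta> by (simp add: divide_right_mono)
    have "\<bar>a y ^ k * w y\<bar> \<le> 1 * \<bar>w y\<bar>"
      unfolding abs_mult using a01 by (intro mult_right_mono) (auto simp: power_le_one)
    moreover have "a y ^ k * f y / \<mu> - b y ^ k / \<beta> = a y ^ k * w y + (a y ^ k - b y ^ k) / \<beta>"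
      by (simp add: w_def right_diff_distrib diff_divide_distrib)
    ultimately have "\<bar>a y ^ k * f y / \<mu> - b y ^ k / \<beta>\<bar> \<le> \<bar>w y\<bar> + real k * W / \<beta>"
      using 1 by linarith
    then show "\<bar>indicator ?B y * a y ^ k * f y / \<mu> - indicator ?B y * b y ^ k / \<beta>\<bar>
        \<le> indicator ?B y * \<bar>w y\<bar> + indicator ?B y * (real k * W / \<beta>)"
      by (auto simp: indicator_def)
  qed
  also have "\<dots> = W + \<beta> * (real k * W / \<beta>)"
    using iw iB IB by (simp add: W_def)
  also have "\<dots> = real (k + 1) * W" using \<beta> by (simp add: algebra_simps)
  also have "\<dots> \<le> real (k + 1) * (2 * \<delta>' / (f x - \<delta>'))" by (intro mult_left_mono W) simp
  also have "\<dots> = 2 * real (k + 1) * \<delta>' / (f x - \<delta>')" by simp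
  finally show "\<bar>S.star_prob k - lens_moment d k\<bar> \<le> 2 * real (k + 1) * \<delta>' / (f x - \<delta>')" .
qed

section \<open>Exceptional centres of small probability\<close>

lemma law_vanishing_sets:
  assumes f: "is_density d f" and A: "\<And>j::nat. A j \<in> sets (lebesgue_d d)"
    and lim: "\<And>x. x \<in> space (lebesgue_d d) \<Longrightarrow> f x \<noteq> 0 \<Longrightarrow> eventually (\<lambda>j. x \<notin> A j) sequentially"
    and e: "0 < e"
  shows "\<exists>j. measure (law d f) (A j) < e"
proof -
  note [measurable] = density_measurable[OF f] A
  \<comment> \<open>Dominated convergence with \<open>f\<close> itself as the dominating function;
    points where \<open>f\<close> vanishes contribute zero whether or not they leave the
    sets.\<close>
  have "(\<lambda>j. \<integral> x. indicator (A j) x * f x \<partial>lebesgue_d d) \<longlonglongrightarrow> (\<integral> x. 0 \<partial>lebesgue_d d)"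
  proof (rule integral_dominated_convergence[OF _ _ density_integrable[OF f]])
    show "AE x in lebesgue_d d. (\<lambda>j. indicator (A j) x * f x) \<longlonglongrightarrow> 0"
    proof (rule AE_I2)
      fix x assume x: "x \<in> space (lebesgue_d d)"
      show "(\<lambda>j. indicator (A j) x * f x) \<longlonglongrightarrow> 0"
      proof (cases "f x = 0")
        case False
        have "eventually (\<lambda>j. 0 = indicator (A j) x * f x) sequentially"
          using lim[OF x False] by eventually_elim simp
        then show ?thesis by (rule Lim_transform_eventually[OF tendsto_const])
      qed simp
    qed
    show "AE x in lebesgue_d d. norm (indicator (A j) x * f x) \<le> f x" for j
      using density_nonneg[OF f] by (intro AE_I2) (auto simp: indicator_def)
  qed measurable
  then have "eventually (\<lambda>j. (\<integral> x. indicator (A j) x * f x \<partial>lebesgue_d d) < e) sequentially"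
    by (rule order_tendstoD) (use e in simp)
  then have "\<exists>j. (\<integral> x. indicator (A j) x * f x \<partial>lebesgue_d d) < e"
    by (rule eventually_happens'[OF sequentially_bot])
  then show ?thesis by (simp add: measure_law[OF f A])
qed

lemma law_small_density:
  assumes f: "is_density d f" and e: "0 < e"
  shows "\<exists>\<delta>>0. measure (law d f) {x\<in>space (lebesgue_d d). f x < \<delta>} < e"
proof -
  note [measurable] = density_measurable[OF f]
  have "\<exists>j. measure (law d f) {x\<in>space (lebesgue_d d). f x < 1 / real (Suc j)} < e"
  proof (rule law_vanishing_sets[OF f _ _ e])
    fix x assume "f x \<noteq> 0"
    then have "0 < f x" using density_nonneg[OF f, of x] by simp
    then have "eventually (\<lambda>j. 1 / real (Suc j) < f x) sequentially"
      using order_tendstoD(2)[OF LIMSEQ_inverse_real_of_nat] by (simp add: inverse_eq_divide)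
    then show "eventually (\<lambda>j. x \<notin> {x\<in>space (lebesgue_d d). f x < 1 / real (Suc j)}) sequentially"
      by eventually_elim simp
  qed measurable
  then obtain j where "measure (law d f) {x\<in>space (lebesgue_d d). f x < 1 / real (Suc j)} < e" ..
  then show ?thesis by (intro exI[of _ "1 / real (Suc j)"]) simp
qed

lemma law_large_density:
  assumes f: "is_density d f" and e: "0 < e"
  shows "\<exists>j::nat. measure (law d f) {x\<in>space (lebesgue_d d). real j < f x} < e"
proof (rule law_vanishing_sets[OF f _ _ e])
  note [measurable] = density_measurable[OF f]
  show "{x\<in>space (lebesgue_d d). real j < f x} \<in> sets (lebesgue_d d)" for j by measurable
  fix x
  obtain n :: nat where "f x \<le> real n" using real_arch_simple by blast
  then show "eventually (\<lambda>j. x \<notin> {x\<in>space (lebesgue_d d). real j < f x}) sequentially"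
    by (intro eventually_sequentiallyI[of n]) auto
qed

text \<open>Markov's inequality controls only the volume of the set of bad centres. Passing to the
  law multiplies by \<open>f\<close>, so the part where \<open>f\<close> exceeds a level
  \<open>K\<close> is split off beforehand, at a cost of \<open>e / 2\<close>.\<close>

lemma law_large_osc:
  assumes f: "is_density d f" and e: "0 < e" and \<delta>': "0 < \<delta>'"
  shows "\<exists>r0>0. \<forall>r. 0 < r \<and> r \<le> r0 \<longrightarrow>
    measure (law d f) {x\<in>space (lebesgue_d d). local_osc d f r x > ennreal (r ^ d * unit_vol d * \<delta>')} \<le> e"
proof -
  interpret prob_space "law d f" by (rule prob_space_law[OF f])
  let ?L = "lebesgue_d d"
  note [measurable] = density_measurable[OF f]
  obtain K :: nat where K: "measure (law d f) {x\<in>space ?L. real K < f x} < e / 2"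
    using law_large_density[OF f, of "e / 2"] e by auto
  \<comment> \<open>The bad set will have volume at most \<open>s / \<delta>'\<close>; multiplied by
    the bound \<open>K\<close> on the density this must not exceed \<open>e / 2\<close>. Using
    \<open>K + 1\<close> avoids a division by zero.\<close>
  define s where "s = e * \<delta>' / (2 * (real K + 1))"
  have s: "0 < s" using e \<delta>' by (simp add: s_def)
  obtain r0 where r0: "r0 > 0" "\<And>r. 0 < r \<Longrightarrow> r \<le> r0 \<Longrightarrow>
      (\<integral>\<^sup>+ x. local_osc d f r x \<partial>?L) \<le> ennreal (r ^ d * unit_vol d * s)"
    using nn_integral_local_osc_small[OF density_integrable[OF f] s] by blast
  show ?thesis
  proof (intro exI[of _ r0] conjI allI impI r0(1))
    fix r assume r: "0 < r \<and> r \<le> r0"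
    define \<beta> where "\<beta> = r ^ d * unit_vol d"
    have \<beta>: "0 < \<beta>" using r unit_vol_pos[of d] by (simp add: \<beta>_def)
    let ?A = "{x\<in>space ?L. local_osc d f r x > ennreal (\<beta> * \<delta>')}"
    let ?K = "{x\<in>space ?L. real K < f x}"
    have "ennreal (\<beta> * \<delta>') * emeasure ?L ?A = (\<integral>\<^sup>+ x. ennreal (\<beta> * \<delta>') * indicator ?A x \<partial>?L)"
      by (rule nn_integral_cmult_indicator[symmetric]) measurable
    also have "\<dots> \<le> (\<integral>\<^sup>+ x. local_osc d f r x \<partial>?L)"
      by (intro nn_integral_mono) (auto simp: indicator_def)
    also have "\<dots> \<le> ennreal (\<beta> * s)" using r0(2)[of r] r by (simp add: \<beta>_def)
    finally have 1: "ennreal (\<beta> * \<delta>') * emeasure ?L ?A \<le> ennreal (\<beta> * s)" .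
    have "emeasure ?L ?A = ennreal (1 / (\<beta> * \<delta>')) * (ennreal (\<beta> * \<delta>') * emeasure ?L ?A)"
      using \<beta> \<delta>' by (simp add: mult.assoc[symmetric] ennreal_mult[symmetric])
    also have "\<dots> \<le> ennreal (1 / (\<beta> * \<delta>')) * ennreal (\<beta> * s)" by (rule mult_left_mono[OF 1]) simp
    also have "\<dots> = ennreal (s / \<delta>')"
      using \<beta> \<delta>' s by (simp add: ennreal_mult[symmetric])
    finally have 2: "emeasure ?L ?A \<le> ennreal (s / \<delta>')" .
    have "emeasure (law d f) (?A - ?K) = (\<integral>\<^sup>+ x. ennreal (f x) * indicator (?A - ?K) x \<partial>?L)"
      by (rule emeasure_density) measurable
    also have "\<dots> \<le> (\<integral>\<^sup>+ x. ennreal (real K) * indicator ?A x \<partial>?L)"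
      by (intro nn_integral_mono) (auto simp: indicator_def intro!: ennreal_leI simp del: ennreal_of_nat_eq_real_of_nat)
    also have "\<dots> = ennreal (real K) * emeasure ?L ?A"
      by (rule nn_integral_cmult_indicator) measurable
    also have "\<dots> \<le> ennreal (real K) * ennreal (s / \<delta>')" by (rule mult_left_mono[OF 2]) simp
    also have "\<dots> = ennreal (real K * (s / \<delta>'))" by (rule ennreal_mult[symmetric]) (use s \<delta>' in auto)
    also have "\<dots> \<le> ennreal (e / 2)"
    proof (rule ennreal_leI)
      have "real K * (s / \<delta>') = e / 2 * (real K / (real K + 1))" using \<delta>' by (simp add: s_def)
      also have "\<dots> \<le> e / 2 * 1" using e by (intro mult_left_mono) auto
      finally show "real K * (s / \<delta>') \<le> e / 2" by simp
    qed
    finally have 3: "measure (law d f) (?A - ?K) \<le> e / 2"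
      using e by (simp add: emeasure_eq_measure)
    have "measure (law d f) ?A \<le> measure (law d f) ((?A - ?K) \<union> ?K)"
      by (rule finite_measure_mono) auto
    also have "\<dots> \<le> measure (law d f) (?A - ?K) + measure (law d f) ?K"
      by (rule measure_Un_le) auto
    also have "\<dots> \<le> e" using 3 K by simp
    finally show "measure (law d f) {x\<in>space ?L. local_osc d f r x > ennreal (r ^ d * unit_vol d * \<delta>')} \<le> e"
      by (simp add: \<beta>_def)
  qed
qed

section \<open>The estimator\<close>

definition star_freq :: "nat \<Rightarrow> nat \<Rightarrow> (nat \<Rightarrow> nat \<Rightarrow> bool) \<Rightarrow> real" where
  "star_freq k n a = block_freq a (filter (a 0) [1..<n]) k"

text \<open>Agreement on distinct entries is enough, since a block never tests a vertex against
  itself. The graph relation is false on the diagonal, whereas the bare distance condition is true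
  there.\<close>

lemma block_freq_cong:
  assumes "distinct xs" "\<And>i j. i \<in> set xs \<Longrightarrow> j \<in> set xs \<Longrightarrow> i \<noteq> j \<Longrightarrow> a i j = a' i j"
  shows "block_freq a xs k = block_freq a' xs k"
proof -
  have "a (xs ! (b*(k+1))) (xs ! (b*(k+1)+l)) = a' (xs ! (b*(k+1))) (xs ! (b*(k+1)+l))"
    if b: "b < length xs div (k+1)" and l: "l \<in> {1..k}" for b l
  proof -
    have "b*(k+1) + l < (b + 1) * (k+1)" using l by (simp add: algebra_simps)
    also have "\<dots> \<le> (length xs div (k+1)) * (k+1)" using b by (intro mult_right_mono) auto
    also have "\<dots> \<le> length xs" by (rule div_times_less_eq_dividend)
    finally have 1: "b*(k+1) + l < length xs" .
    then have 2: "b*(k+1) < length xs" by linarith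
    have "xs ! (b*(k+1)) \<noteq> xs ! (b*(k+1)+l)"
      using nth_eq_iff_index_eq[OF assms(1) 2 1] l by simp
    then show ?thesis using 1 2 by (intro assms(2) nth_mem)
  qed
  then show ?thesis
    unfolding block_freq_def
    by (intro arg_cong2[where f="(/)"] sum.cong refl arg_cong[where f=of_bool] ball_cong) simp_all
qed

text \<open>The graph takes finitely many values, so any function of it is a finite sum, over the
  possible edge sets, of constants times indicators of measurable events. In particular an estimator
  defined by \<open>LEAST\<close> needs no separate measurability argument.\<close>

lemma measurable_adjacency_function:
  fixes g :: "(nat \<Rightarrow> nat \<Rightarrow> bool) \<Rightarrow> real"
  shows "(\<lambda>X. g (rgg_adj n d r X)) \<in> borel_measurable (PiM {..<n} (\<lambda>_. law d f))"
proof -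
  let ?P = "PiM {..<n} (\<lambda>_. law d f)"
  let ?V = "{..<n} \<times> {..<n}"
  define E where "E X = {p\<in>?V. fst p \<noteq> snd p \<and> eucl_dist d (X (fst p)) (X (snd p)) \<le> r}" for X :: "nat \<Rightarrow> nat \<Rightarrow> real"
  have comp [measurable]: "(\<lambda>X. X i) \<in> measurable ?P (lebesgue_d d)" if "i < n" for i
    using measurable_component_singleton[of i "{..<n}" "\<lambda>_. law d f"] that
    by (simp add: measurable_cong_sets[OF refl sets_density])
  have pE: "Measurable.pred ?P (\<lambda>X. E X = T)" if T: "T \<subseteq> ?V" for T
  proof -
    have "E X = T \<longleftrightarrow> (\<forall>p\<in>?V. (fst p \<noteq> snd p \<and> eucl_dist d (X (fst p)) (X (snd p)) \<le> r) = (p \<in> T))" for X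
      using T unfolding E_def by blast
    moreover have "Measurable.pred ?P (\<lambda>X. \<forall>p\<in>?V. (fst p \<noteq> snd p \<and> eucl_dist d (X (fst p)) (X (snd p)) \<le> r) = (p \<in> T))"
    proof (rule pred_intros_finite)
      fix p assume "p \<in> ?V"
      then have "fst p < n" "snd p < n" by auto
      then have [measurable]: "(\<lambda>X. eucl_dist d (X (fst p)) (X (snd p))) \<in> borel_measurable ?P"
        by (intro measurable_eucl_dist comp)
      show "Measurable.pred ?P (\<lambda>X. (fst p \<noteq> snd p \<and> eucl_dist d (X (fst p)) (X (snd p)) \<le> r) = (p \<in> T))"
        by measurable
    qed simp
    ultimately show ?thesis by simp
  qed
  have adj: "rgg_adj n d r X = (\<lambda>i j. (i, j) \<in> E X)" for X
    by (auto simp: rgg_adj_def E_def fun_eq_iff)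
  have "g (rgg_adj n d r X) = (\<Sum>T\<in>Pow ?V. of_bool (E X = T) * g (\<lambda>i j. (i, j) \<in> T))" for X
  proof -
    have "(\<Sum>T\<in>Pow ?V. of_bool (E X = T) * g (\<lambda>i j. (i, j) \<in> T)) = (\<Sum>T\<in>{E X}. of_bool (E X = T) * g (\<lambda>i j. (i, j) \<in> T))"
      by (rule sum.mono_neutral_right) (auto simp: E_def)
    then show ?thesis by (simp add: adj)
  qed
  moreover have "(\<lambda>X. \<Sum>T\<in>Pow ?V. of_bool (E X = T) * g (\<lambda>i j. (i, j) \<in> T)) \<in> borel_measurable ?P"
  proof (rule borel_measurable_sum)
    fix T assume "T \<in> Pow ?V"
    then have [measurable]: "Measurable.pred ?P (\<lambda>X. E X = T)" by (intro pE) auto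
    show "(\<lambda>X. of_bool (E X = T) * g (\<lambda>i j. (i, j) \<in> T)) \<in> borel_measurable ?P" by measurable
  qed
  ultimately show ?thesis by simp
qed

section \<open>From the abstract sample to the random graph\<close>

lemma star_freq_fun_upd:
  assumes y: "y \<in> space (PiM {1..<n} (\<lambda>_. law d f))" and n: "1 \<le> n"
  shows "star_freq k n (rgg_adj n d r (y(0 := x)))
    = block_freq (\<lambda>i j. eucl_dist d (y i) (y j) \<le> r) (sorted_list_of_set {i\<in>{1..<n}. y i \<in> dball d x r}) k"
proof -
  let ?a = "rgg_adj n d r (y(0 := x))"
  have sp: "y i \<in> space (lebesgue_d d)" if "i \<in> {1..<n}" for i
    using y that by (auto simp: space_PiM PiE_def Pi_def)
  have "?a 0 i \<longleftrightarrow> y i \<in> dball d x r" if "i \<in> {1..<n}" for i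
    using that n sp[OF that] by (auto simp: rgg_adj_def dball_def)
  then have S: "set (filter (?a 0) [1..<n]) = {i\<in>{1..<n}. y i \<in> dball d x r}" by auto
  have xs: "filter (?a 0) [1..<n] = sorted_list_of_set {i\<in>{1..<n}. y i \<in> dball d x r}"
    unfolding S[symmetric]
    by (rule sorted_distinct_set_unique) (auto intro: sorted_filter[of id, simplified])
  show ?thesis
    unfolding star_freq_def xs
  proof (rule block_freq_cong)
    fix i j
    assume "i \<in> set (sorted_list_of_set {i\<in>{1..<n}. y i \<in> dball d x r})"
      "j \<in> set (sorted_list_of_set {i\<in>{1..<n}. y i \<in> dball d x r})" "i \<noteq> j"
    then show "?a i j = (eucl_dist d (y i) (y j) \<le> r)"
      by (auto simp: rgg_adj_def)
  qed simp
qed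

text \<open>The tolerance \<open>e\<close> is shared equally between bias and fluctuation. The bias
  bound has the denominator \<open>f x - \<delta>' \<ge> \<delta> / 2\<close>; the fluctuation is
  governed by the concentration bound for the sample of the other \<open>n - 1\<close>
  points.\<close>

lemma star_freq_deviation_given_center:
  assumes f: "is_density d f" and r: "0 < r" and e: "0 < e" and n: "1 \<le> n"
    and \<delta>: "0 < \<delta>" "\<delta> \<le> f x" and \<delta>': "0 < \<delta>'" "\<delta>' \<le> \<delta> / 2" "4 * real (k + 1) * \<delta>' / \<delta> \<le> e / 2"
    and osc: "local_osc d f r x \<le> ennreal (r ^ d * unit_vol d * \<delta>')"
    and m: "1 \<le> m" and K: "0 < K" "K \<le> real (n - 1) * (r ^ d * unit_vol d * (\<delta> / 2))" "real (m * (k+1)) \<le> K / 2"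
  shows "emeasure (PiM {1..<n} (\<lambda>_. law d f))
      {y \<in> space (PiM {1..<n} (\<lambda>_. law d f)). e < \<bar>star_freq k n (rgg_adj n d r (y(0 := x))) - lens_moment d k\<bar>}
    \<le> ennreal (4 / K + 1 / ((e / 2)\<^sup>2 * real m))"
proof -
  let ?Q = "PiM {1..<n} (\<lambda>_. law d f)" and ?B = "dball d x r"
  let ?R = "\<lambda>y z. eucl_dist d y z \<le> r"
  interpret Q: prob_space ?Q by (intro prob_space_PiM prob_space_law f)
  have fx: "\<delta> / 2 \<le> f x - \<delta>'" using \<delta> \<delta>' by linarith
  then have fx': "\<delta>' < f x" using \<delta> by linarith
  note close = star_prob_close[OF f r fx' \<delta>'(1) osc]
  have \<beta>: "0 < r ^ d * unit_vol d" using r unit_vol_pos[of d] by simp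
  have \<mu>: "r ^ d * unit_vol d * (\<delta> / 2) \<le> measure (law d f) ?B"
    using close(1) mult_left_mono[OF fx, of "r ^ d * unit_vol d"] \<beta> by linarith
  moreover have "0 < r ^ d * unit_vol d * (\<delta> / 2)" using \<beta> \<delta> by simp
  ultimately have \<mu>pos: "0 < measure (law d f) ?B" by linarith
  interpret S: local_sample "law d f" ?B ?R "{1..<n}"
    by (rule local_sample_law[OF f _ \<mu>pos]) simp
  \<comment> \<open>The true expected number of neighbours, which varies with \<open>x\<close>;
    \<open>K\<close> is a lower bound common to all admissible centres.\<close>
  define K' where "K' = real (card {1..<n}) * measure (law d f) ?B"
  have KK': "K \<le> K'"
    using K(2) mult_left_mono[OF \<mu>, of "real (n - 1)"] by (simp add: K'_def)
  have bias: "\<bar>S.star_prob k - lens_moment d k\<bar> \<le> e / 2"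
  proof -
    have "\<bar>S.star_prob k - lens_moment d k\<bar> \<le> 2 * real (k + 1) * \<delta>' / (f x - \<delta>')"
      by (rule close(2))
    also have "\<dots> \<le> 2 * real (k + 1) * \<delta>' / (\<delta> / 2)"
      using fx \<delta> \<delta>' by (intro divide_left_mono mult_pos_pos) auto
    also have "\<dots> = 4 * real (k + 1) * \<delta>' / \<delta>" by simp
    finally show ?thesis using \<delta>'(3) by simp
  qed
  let ?dev = "{y \<in> space ?Q. \<bar>block_freq (\<lambda>i j. ?R (y i) (y j)) (sorted_list_of_set (S.nbrs y)) k - S.star_prob k\<bar> > e / 2}"
  have "0 < e / 2" "0 < K'" "real (m * (k+1)) \<le> K' / 2" using e K KK' by linarith+
  note conc = S.block_freq_concentration[OF \<open>0 < e / 2\<close> K'_def \<open>0 < K'\<close> m this(3)]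
  have "{y \<in> space ?Q. e < \<bar>star_freq k n (rgg_adj n d r (y(0 := x))) - lens_moment d k\<bar>} \<subseteq> ?dev"
  proof
    fix y assume y: "y \<in> {y \<in> space ?Q. e < \<bar>star_freq k n (rgg_adj n d r (y(0 := x))) - lens_moment d k\<bar>}"
    then have ysp: "y \<in> space ?Q" by simp
    have "star_freq k n (rgg_adj n d r (y(0 := x)))
      = block_freq (\<lambda>i j. ?R (y i) (y j)) (sorted_list_of_set (S.nbrs y)) k"
      unfolding star_freq_fun_upd[OF ysp n] S.nbrs_def ..
    then have "e < \<bar>block_freq (\<lambda>i j. ?R (y i) (y j)) (sorted_list_of_set (S.nbrs y)) k - lens_moment d k\<bar>"
      using y by simp
    then have "e / 2 < \<bar>block_freq (\<lambda>i j. ?R (y i) (y j)) (sorted_list_of_set (S.nbrs y)) k - S.star_prob k\<bar>"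
      using bias by linarith
    then show "y \<in> ?dev" using ysp by simp
  qed
  then have "emeasure ?Q {y \<in> space ?Q. e < \<bar>star_freq k n (rgg_adj n d r (y(0 := x))) - lens_moment d k\<bar>}
      \<le> emeasure ?Q ?dev"
    using conc(1) by (rule emeasure_mono)
  also have "\<dots> = ennreal (measure ?Q ?dev)" by (rule Q.emeasure_eq_measure)
  also have "\<dots> \<le> ennreal (4 / K' + 1 / ((e / 2)\<^sup>2 * real m))"
    by (rule ennreal_leI[OF conc(2)])
  also have "\<dots> \<le> ennreal (4 / K + 1 / ((e / 2)\<^sup>2 * real m))"
  proof (rule ennreal_leI)
    have "4 / K' \<le> 4 / K" using K(1) KK' by (intro divide_left_mono) auto
    then show "4 / K' + 1 / ((e / 2)\<^sup>2 * real m) \<le> 4 / K + 1 / ((e / 2)\<^sup>2 * real m)" by simp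
  qed
  finally show ?thesis .
qed

text \<open>Integrates over the position of vertex \<open>0\<close>: a centre in \<open>G\<close>
  contributes at most \<eta>, and for any other centre the conditional probability is bounded by
  1.\<close>

lemma star_freq_deviation:
  assumes f: "is_density d f" and n: "1 \<le> n" and \<eta>: "0 \<le> \<eta>"
    and G: "G \<in> sets (lebesgue_d d)" "\<And>x. x \<in> G \<Longrightarrow>
      emeasure (PiM {1..<n} (\<lambda>_. law d f))
      {y \<in> space (PiM {1..<n} (\<lambda>_. law d f)). e < \<bar>star_freq k n (rgg_adj n d r (y(0 := x))) - c\<bar>} \<le> ennreal \<eta>"
  shows "measure (PiM {..<n} (\<lambda>_. law d f))
      {X \<in> space (PiM {..<n} (\<lambda>_. law d f)). e < \<bar>star_freq k n (rgg_adj n d r X) - c\<bar>}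
    \<le> \<eta> + measure (law d f) (space (lebesgue_d d) - G)"
proof -
  let ?\<nu> = "law d f"
  let ?Q = "PiM {1..<n} (\<lambda>_. ?\<nu>)" and ?P = "PiM {..<n} (\<lambda>_. ?\<nu>)"
  interpret \<nu>: prob_space ?\<nu> by (rule prob_space_law[OF f])
  interpret P: prob_space ?P by (intro prob_space_PiM prob_space_law f)
  interpret Q: prob_space ?Q by (intro prob_space_PiM prob_space_law f)
  interpret S: product_prob_space "\<lambda>_::nat. ?\<nu>" by unfold_locales
  have ins: "{..<n} = insert 0 {1..<n}" using n by auto
  define Bad where "Bad = {X. e < \<bar>star_freq k n (rgg_adj n d r X) - c\<bar>}"
  have [measurable]: "(\<lambda>X. star_freq k n (rgg_adj n d r X)) \<in> borel_measurable ?P"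
    by (rule measurable_adjacency_function)
  have mBad: "(\<lambda>X. indicator Bad X :: ennreal) \<in> borel_measurable (PiM (insert 0 {1..<n}) (\<lambda>_. ?\<nu>))"
  proof -
    have "(\<lambda>X. of_bool (e < \<bar>star_freq k n (rgg_adj n d r X) - c\<bar>) :: ennreal) \<in> borel_measurable ?P"
      by measurable
    then show ?thesis
      unfolding ins by (simp add: Bad_def indicator_def)
  qed
  have sBad: "{X \<in> space ?P. e < \<bar>star_freq k n (rgg_adj n d r X) - c\<bar>} \<in> sets ?P" by measurable
  have "emeasure ?P {X \<in> space ?P. e < \<bar>star_freq k n (rgg_adj n d r X) - c\<bar>}
     = (\<integral>\<^sup>+ X. indicator {X \<in> space ?P. e < \<bar>star_freq k n (rgg_adj n d r X) - c\<bar>} X \<partial>?P)"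
    using sBad by simp
  also have "\<dots> = (\<integral>\<^sup>+ X. indicator Bad X \<partial>?P)"
    by (intro nn_integral_cong) (auto simp: Bad_def indicator_def)
  also have "\<dots> = (\<integral>\<^sup>+ X. indicator Bad X \<partial>PiM (insert 0 {1..<n}) (\<lambda>_. ?\<nu>))"
    unfolding ins ..
  also have "\<dots> = (\<integral>\<^sup>+ x. (\<integral>\<^sup>+ y. indicator Bad (y(0 := x)) \<partial>?Q) \<partial>?\<nu>)"
    by (rule S.product_nn_integral_insert_rev[OF _ _ mBad]) auto
  also have "\<dots> \<le> (\<integral>\<^sup>+ x. ennreal \<eta> + indicator (space (lebesgue_d d) - G) x \<partial>?\<nu>)"
  proof (rule nn_integral_mono)
    fix x assume x: "x \<in> space ?\<nu>"
    let ?D = "{y \<in> space ?Q. e < \<bar>star_freq k n (rgg_adj n d r (y(0 := x))) - c\<bar>}"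
    have mupd: "(\<lambda>y. y(0 := x)) \<in> measurable ?Q ?P"
      unfolding ins using x by (intro measurable_fun_upd[where J="{1..<n}"]) auto
    have "(\<lambda>y. star_freq k n (rgg_adj n d r (y(0 := x)))) \<in> borel_measurable ?Q"
      by (rule measurable_compose[OF mupd]) (rule measurable_adjacency_function)
    then have mD: "?D \<in> sets ?Q" by measurable
    have "(\<integral>\<^sup>+ y. indicator Bad (y(0 := x)) \<partial>?Q) = (\<integral>\<^sup>+ y. indicator ?D y \<partial>?Q)"
      by (intro nn_integral_cong) (auto simp: Bad_def indicator_def)
    also have "\<dots> = emeasure ?Q ?D" using mD by simp
    also have "\<dots> \<le> ennreal \<eta> + indicator (space (lebesgue_d d) - G) x"
    proof (cases "x \<in> G")
      case True
      then show ?thesis using G(2)[OF True] by simp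
    next
      case False
      then have "indicator (space (lebesgue_d d) - G) x = (1 :: ennreal)" using x by simp
      moreover have "emeasure ?Q ?D \<le> 1" by (rule Q.emeasure_le_1)
      ultimately show ?thesis by (simp add: add_increasing)
    qed
    finally show "(\<integral>\<^sup>+ y. indicator Bad (y(0 := x)) \<partial>?Q) \<le> ennreal \<eta> + indicator (space (lebesgue_d d) - G) x" .
  qed
  also have "\<dots> = ennreal \<eta> + emeasure ?\<nu> (space (lebesgue_d d) - G)"
  proof -
    have "space (lebesgue_d d) - G \<in> sets ?\<nu>" using G(1) by auto
    then show ?thesis
      using \<nu>.emeasure_space_1 by (subst nn_integral_add) (auto simp del: space_density)
  qed
  also have "\<dots> = ennreal (\<eta> + measure ?\<nu> (space (lebesgue_d d) - G))"
    using \<eta> by (simp add: \<nu>.emeasure_eq_measure)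
  finally show ?thesis
    unfolding P.emeasure_eq_measure using \<eta> by (subst (asm) ennreal_le_iff) auto
qed

text \<open>The order of the choices matters: \<delta> from the law alone, \<open>\<delta>'\<close>
  from \<delta>, \<open>e\<close> and \<open>k\<close>, and the radius bound from
  \<open>\<delta>'\<close>. The share of \<eta> is one eighth each for too few neighbours and for
  the block fluctuation, and one quarter each for low density and for large oscillation.\<close>

lemma star_freq_tendsto:
  assumes f: "is_density d f" and r: "\<And>n. 0 < r n" "r \<longlonglongrightarrow> 0"
    and nr: "filterlim (\<lambda>n. real n * r n ^ d) at_top sequentially" and e: "0 < e"
  shows "(\<lambda>n. measure (PiM {..<n} (\<lambda>_. law d f))
      {X \<in> space (PiM {..<n} (\<lambda>_. law d f)). e < \<bar>star_freq k n (rgg_adj n d (r n) X) - lens_moment d k\<bar>})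
    \<longlonglongrightarrow> 0"
    (is "?p \<longlonglongrightarrow> 0")
proof (rule order_tendstoI)
  fix a :: real assume "a < 0"
  then show "eventually (\<lambda>n. a < ?p n) sequentially"
    by (intro always_eventually allI) (rule less_le_trans[OF _ measure_nonneg])
next
  fix \<eta> :: real assume \<eta>: "0 < \<eta>"
  interpret \<nu>: prob_space "law d f" by (rule prob_space_law[OF f])
  note [measurable] = density_measurable[OF f]
  let ?L = "lebesgue_d d"
  obtain \<delta> where \<delta>: "0 < \<delta>" "measure (law d f) {x\<in>space ?L. f x < \<delta>} < \<eta> / 4"
    using law_small_density[OF f, of "\<eta> / 4"] \<eta> by auto
  \<comment> \<open>The first entry keeps \<open>f x - \<delta>'\<close> above
    \<open>\<delta> / 2\<close>; the second brings the bias down to \<open>e / 2\<close>.\<close>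
  define \<delta>' where "\<delta>' = min (\<delta> / 2) (e * \<delta> / (8 * real (k + 1)))"
  have "0 < \<delta>'" using \<delta> e by (simp add: \<delta>'_def)
  moreover have "\<delta>' \<le> \<delta> / 2" unfolding \<delta>'_def by (rule min.cobounded1)
  ultimately have \<delta>': "0 < \<delta>'" "\<delta>' \<le> \<delta> / 2" .
  have "4 * real (k + 1) * \<delta>' / \<delta> \<le> 4 * real (k + 1) * (e * \<delta> / (8 * real (k + 1))) / \<delta>"
    using \<delta> by (intro divide_right_mono mult_left_mono) (auto simp: \<delta>'_def)
  also have "\<dots> = e / 2"
  proof -
    have "4 * c * (e * \<delta> / (8 * c)) / \<delta> = e / 2" if "0 < c" for c
      using that \<delta>(1) by (simp add: field_simps)
    note scaled = this
    show ?thesis by (rule scaled) simp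
  qed
  finally have \<delta>'e: "4 * real (k + 1) * \<delta>' / \<delta> \<le> e / 2" .
  obtain r0 where r0: "0 < r0" "\<And>r. 0 < r \<Longrightarrow> r \<le> r0 \<Longrightarrow>
      measure (law d f) {x\<in>space ?L. local_osc d f r x > ennreal (r ^ d * unit_vol d * \<delta>')} \<le> \<eta> / 4"
    using law_large_osc[OF f, of "\<eta> / 4" \<delta>'] \<eta> \<delta>' by auto
  obtain m :: nat where m: "1 / ((e / 2)\<^sup>2 * (\<eta> / 8)) < real m" using reals_Archimedean2 by blast
  have "0 < 1 / ((e / 2)\<^sup>2 * (\<eta> / 8))" using e \<eta> by simp
  then have m1: "1 \<le> m" using m by linarith
  have m2: "1 / ((e / 2)\<^sup>2 * real m) \<le> \<eta> / 8"
    using m m1 e \<eta> by (simp add: field_simps)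
  \<comment> \<open>Half of \<open>K\<close> neighbours must fill \<open>m\<close> blocks of
    \<open>k + 1\<close> vertices, and \<open>32 / \<eta>\<close> makes \<open>4 / K\<close> at most
    \<open>\<eta> / 8\<close>.\<close>
  define K where "K = max (2 * real (m * (k+1))) (32 / \<eta>)"
  have K0: "0 < K" using \<eta> by (simp add: K_def less_max_iff_disj)
  have "4 / K \<le> 4 / (32 / \<eta>)" using \<eta> K0 by (intro divide_left_mono) (auto simp: K_def)
  then have K1: "4 / K \<le> \<eta> / 8" by simp
  have "2 * real (m * (k+1)) \<le> K" unfolding K_def by (rule max.cobounded1)
  then have K2: "real (m * (k+1)) \<le> K / 2" by linarith
  \<comment> \<open>For \<open>n \<ge> 2\<close> one has \<open>n - 1 \<ge> n / 2\<close>, which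
    together with \<open>f x - \<delta>' \<ge> \<delta> / 2\<close> produces the denominator 4: the
    expected degree is at least \<open>n * r n ^ d * V\<close>.\<close>
  define V where "V = unit_vol d * \<delta> / 4"
  have V: "0 < V" using unit_vol_pos[of d] \<delta> by (simp add: V_def)
  have ev1: "eventually (\<lambda>n. K / V \<le> real n * r n ^ d) sequentially"
    using nr by (simp add: filterlim_at_top)
  have ev2: "eventually (\<lambda>n. r n < r0) sequentially"
    using r(2) r0(1) by (rule order_tendstoD(2))
  show "eventually (\<lambda>n. ?p n < \<eta>) sequentially"
    using ev1 ev2 eventually_ge_at_top[of "2::nat"]
  proof eventually_elim
    fix n :: nat
    assume n: "K / V \<le> real n * r n ^ d" "r n < r0" "2 \<le> n"
    let ?G = "{x\<in>space ?L. \<delta> \<le> f x \<and> local_osc d f (r n) x \<le> ennreal (r n ^ d * unit_vol d * \<delta>')}"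
    have "K \<le> real n * r n ^ d * V" using n(1) V by (simp add: pos_divide_le_eq)
    also have "\<dots> = (real n / 2) * (r n ^ d * unit_vol d * (\<delta> / 2))" by (simp add: V_def)
    also have "\<dots> \<le> real (n - 1) * (r n ^ d * unit_vol d * (\<delta> / 2))"
      using n(3) r(1)[of n] unit_vol_pos[of d] \<delta> by (intro mult_right_mono) auto
    finally have K3: "K \<le> real (n - 1) * (r n ^ d * unit_vol d * (\<delta> / 2))" .
    have "?p n \<le> (4 / K + 1 / ((e / 2)\<^sup>2 * real m)) + measure (law d f) (space ?L - ?G)"
    proof (rule star_freq_deviation[OF f])
      show "1 \<le> n" using n by simp
      show "0 \<le> 4 / K + 1 / ((e / 2)\<^sup>2 * real m)" using K0 by (intro add_nonneg_nonneg) auto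
      show "?G \<in> sets ?L" by measurable
      fix x assume "x \<in> ?G"
      then show "emeasure (PiM {1..<n} (\<lambda>_. law d f))
         {y \<in> space (PiM {1..<n} (\<lambda>_. law d f)). e < \<bar>star_freq k n (rgg_adj n d (r n) (y(0 := x))) - lens_moment d k\<bar>}
        \<le> ennreal (4 / K + 1 / ((e / 2)\<^sup>2 * real m))"
        using n by (intro star_freq_deviation_given_center[OF f r(1) e _ \<delta>(1) _ \<delta>' \<delta>'e _ m1 K0 K3 K2]) auto
    qed
    also have "measure (law d f) (space ?L - ?G) \<le> \<eta> / 4 + \<eta> / 4"
    proof -
      let ?A = "{x\<in>space ?L. f x < \<delta>}"
      let ?O = "{x\<in>space ?L. local_osc d f (r n) x > ennreal (r n ^ d * unit_vol d * \<delta>')}"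
      have "space ?L - ?G \<subseteq> ?A \<union> ?O" by (auto simp: not_le)
      then have "measure (law d f) (space ?L - ?G) \<le> measure (law d f) (?A \<union> ?O)"
        by (rule \<nu>.finite_measure_mono) auto
      also have "\<dots> \<le> measure (law d f) ?A + measure (law d f) ?O"
        by (rule measure_Un_le) auto
      also have "\<dots> \<le> \<eta> / 4 + \<eta> / 4"
        using \<delta>(2) r0(2)[OF r(1), of n] n(2) by (intro add_mono) auto
      finally show ?thesis .
    qed
    finally show "?p n < \<eta>" using K1 m2 \<eta> by linarith
  qed
qed

section \<open>Consistency of the estimator\<close>

lemma measure_sample_space_ignoring_randomization:
  assumes f: "is_density d f" and A: "{X \<in> space (PiM {..<n} (\<lambda>_. law d f)). p X} \<in> sets (PiM {..<n} (\<lambda>_. law d f))"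
  shows "measure (sample_space n d f) {\<omega> \<in> space (sample_space n d f). p (fst \<omega>)}
    = measure (PiM {..<n} (\<lambda>_. law d f)) {X \<in> space (PiM {..<n} (\<lambda>_. law d f)). p X}"
proof -
  let ?P = "PiM {..<n} (\<lambda>_. law d f)" and ?U = "uniform_measure lborel {0..1::real}"
  interpret U: prob_space ?U by (rule prob_space_uniform_measure) auto
  have "{\<omega> \<in> space (sample_space n d f). p (fst \<omega>)} = {X \<in> space ?P. p X} \<times> space ?U"
    unfolding sample_space_def space_pair_measure by auto
  then have "emeasure (sample_space n d f) {\<omega> \<in> space (sample_space n d f). p (fst \<omega>)}
     = emeasure ?P {X \<in> space ?P. p X} * emeasure ?U (space ?U)"
    unfolding sample_space_def using A by (simp only: U.emeasure_pair_measure_Times sets.top)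
  then show ?thesis
    unfolding U.emeasure_space_1 by (simp add: measure_def)
qed

theorem theorem2:
  shows "\<exists>\<Delta> :: nat \<Rightarrow> (nat \<Rightarrow> nat \<Rightarrow> bool) \<Rightarrow> real \<Rightarrow> real.
    \<forall>(d::nat) f (r::nat \<Rightarrow> real).
      d \<ge> 1 \<and> is_density d f \<and> (\<forall>n. 0 < r n)
      \<and> filterlim (\<lambda>n. real n * r n ^ d) at_top sequentially
      \<and> r \<longlonglongrightarrow> 0
      \<longrightarrow>
      (\<forall>n. (\<lambda>\<omega>. \<Delta> n (rgg_adj n d (r n) (fst \<omega>)) (snd \<omega>))
              \<in> borel_measurable (sample_space n d f))
      \<and> (\<forall>\<epsilon>>0. (\<lambda>n. measure (sample_space n d f)
              {\<omega> \<in> space (sample_space n d f).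
                 \<bar>\<Delta> n (rgg_adj n d (r n) (fst \<omega>)) (snd \<omega>) - real d\<bar> > \<epsilon>})
            \<longlonglongrightarrow> 0)"
proof -
  have "\<forall>d. \<exists>p. (\<forall>d'\<le>d. snd p < lens_moment d' (fst p)) \<and> (\<forall>d'>d. lens_moment d' (fst p) < snd p)"
    using lens_moment_separates by simp
  then obtain p where p: "\<And>d. (\<forall>d'\<le>d. snd (p d) < lens_moment d' (fst (p d))) \<and> (\<forall>d'>d. lens_moment d' (fst (p d)) < snd (p d))"
    by (rule choice[THEN exE]) blast
  define kk where "kk d = fst (p d)" for d :: nat
  define \<tau> where "\<tau> d = snd (p d)" for d :: nat
  have above: "\<tau> d < lens_moment d' (kk d)" if "d' \<le> d" for d d'
    using p[of d] that by (simp add: \<tau>_def kk_def)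
  have below: "lens_moment d' (kk d) < \<tau> d" if "d < d'" for d d'
    using p[of d] that by (simp add: \<tau>_def kk_def)
  \<comment> \<open>If no index passes its test, \<open>LEAST\<close> yields an unspecified number.
    On the event used below the true dimension passes, so the value is determined there.\<close>
  define \<Delta>0 where "\<Delta>0 n a = real (LEAST d. 1 \<le> d \<and> \<tau> d < star_freq (kk d) n a)" for n a
  define \<Delta> where "\<Delta> n a u = \<Delta>0 n a" for n a and u :: real
  show ?thesis
  proof (intro exI[of _ \<Delta>] allI impI conjI; elim conjE)
    fix d :: nat and f and r :: "nat \<Rightarrow> real" and n
    have "(\<lambda>\<omega>. \<Delta>0 n (rgg_adj n d (r n) (fst \<omega>))) \<in> borel_measurable (sample_space n d f)"
      unfolding sample_space_def
      by (rule measurable_compose[OF measurable_fst measurable_adjacency_function])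
    then show "(\<lambda>\<omega>. \<Delta> n (rgg_adj n d (r n) (fst \<omega>)) (snd \<omega>)) \<in> borel_measurable (sample_space n d f)"
      by (simp add: \<Delta>_def)
  next
    fix d :: nat and f and r :: "nat \<Rightarrow> real" and \<epsilon> :: real
    assume \<epsilon>: "0 < \<epsilon>" and d: "1 \<le> d" and f: "is_density d f" and r: "\<forall>n. 0 < r n"
      and nr: "filterlim (\<lambda>n. real n * r n ^ d) at_top sequentially" and r0: "r \<longlonglongrightarrow> 0"
    let ?P = "\<lambda>n. PiM {..<n} (\<lambda>_. law d f)"
    \<comment> \<open>Half the distance between the limit of the statistic and its threshold: a
      frequency within this distance of its limit lies on the same side of the threshold as the
      limit. It is positive for every \<open>c\<close>, as one of the two separation inequalities
      applies.\<close>
    define gap where "gap c = \<bar>lens_moment d (kk c) - \<tau> c\<bar> / 2" for c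
    have gap: "0 < gap c" for c
      using above[of d c] below[of c d] by (cases "d \<le> c") (auto simp: gap_def)
    let ?bad = "\<lambda>c n. {X \<in> space (?P n). gap c < \<bar>star_freq (kk c) n (rgg_adj n d (r n) X) - lens_moment d (kk c)\<bar>}"
    let ?err = "\<lambda>n. {X \<in> space (?P n). \<epsilon> < \<bar>\<Delta>0 n (rgg_adj n d (r n) X) - real d\<bar>}"
    have bad_sets: "?bad c n \<in> sets (?P n)" for c n
    proof -
      have [measurable]: "(\<lambda>X. star_freq (kk c) n (rgg_adj n d (r n) X)) \<in> borel_measurable (?P n)"
        by (rule measurable_adjacency_function)
      show ?thesis by measurable
    qed
    have err_sets: "?err n \<in> sets (?P n)" for n
    proof -
      have [measurable]: "(\<lambda>X. \<Delta>0 n (rgg_adj n d (r n) X)) \<in> borel_measurable (?P n)"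
        by (rule measurable_adjacency_function)
      show ?thesis by measurable
    qed
    \<comment> \<open>If the frequencies for all \<open>c\<close> from 1 to \<open>d\<close> are
      close to their limits, index \<open>d\<close> passes and every smaller one fails. What the
      larger indices do cannot change the least one, so a finite union bound suffices.\<close>
    have sub: "?err n \<subseteq> (\<Union>c\<in>{1..d}. ?bad c n)" for n
    proof
      fix X assume X: "X \<in> ?err n"
      show "X \<in> (\<Union>c\<in>{1..d}. ?bad c n)"
      proof (rule ccontr)
        let ?a = "rgg_adj n d (r n) X"
        assume "X \<notin> (\<Union>c\<in>{1..d}. ?bad c n)"
        then have near: "\<bar>star_freq (kk c) n ?a - lens_moment d (kk c)\<bar> \<le> gap c" if "1 \<le> c" "c \<le> d" for c
          using X that by force
        have "(LEAST c. 1 \<le> c \<and> \<tau> c < star_freq (kk c) n ?a) = d"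
        proof (rule Least_equality)
          have "\<tau> d < lens_moment d (kk d)" by (rule above) simp
          then show "1 \<le> d \<and> \<tau> d < star_freq (kk d) n ?a"
            using near[OF d order_refl] d by (auto simp: gap_def abs_if split: if_splits)
        next
          fix c assume c: "1 \<le> c \<and> \<tau> c < star_freq (kk c) n ?a"
          show "d \<le> c"
          proof (rule ccontr)
            assume "\<not> d \<le> c"
            then have "c < d" by simp
            then have "lens_moment d (kk c) < \<tau> c" by (rule below)
            then show False
              using near[of c] c \<open>c < d\<close> by (auto simp: gap_def abs_if split: if_splits)
          qed
        qed
        then show False using X \<epsilon> by (simp add: \<Delta>0_def)
      qed
    qed
    have "(\<lambda>n. \<Sum>c\<in>{1..d}. measure (?P n) (?bad c n)) \<longlonglongrightarrow> (\<Sum>c\<in>{1..d}. 0)"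
      using r by (intro tendsto_sum star_freq_tendsto[OF f _ r0 nr gap]) simp
    then have lim: "(\<lambda>n. \<Sum>c\<in>{1..d}. measure (?P n) (?bad c n)) \<longlonglongrightarrow> 0" by simp
    have "measure (?P n) (?err n) \<le> (\<Sum>c\<in>{1..d}. measure (?P n) (?bad c n))" for n
    proof -
      interpret P: prob_space "?P n" by (intro prob_space_PiM prob_space_law f)
      have "measure (?P n) (?err n) \<le> measure (?P n) (\<Union>c\<in>{1..d}. ?bad c n)"
        using sub by (rule P.finite_measure_mono) (intro sets.finite_UN bad_sets finite_atLeastAtMost)
      also have "\<dots> \<le> (\<Sum>c\<in>{1..d}. measure (?P n) (?bad c n))"
        using bad_sets by (intro P.finite_measure_subadditive_finite) auto
      finally show ?thesis .
    qed
    then have "(\<lambda>n. measure (?P n) (?err n)) \<longlonglongrightarrow> 0"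
      by (intro tendsto_sandwich[OF _ _ tendsto_const lim] always_eventually allI) auto
    then show "(\<lambda>n. measure (sample_space n d f)
              {\<omega> \<in> space (sample_space n d f).
                 \<bar>\<Delta> n (rgg_adj n d (r n) (fst \<omega>)) (snd \<omega>) - real d\<bar> > \<epsilon>}) \<longlonglongrightarrow> 0"
      unfolding \<Delta>_def
      by (subst measure_sample_space_ignoring_randomization[OF f err_sets])
  qed
qed

end
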